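(* Let $\nabla$ be a connection on a smooth manifold $M$. For all $\varphi\in\Upsilon^\bullet(M)$, $X\in\mathfrak{X}(M)$ and $m\in M$, $$(L^s_X\varphi)_m=\lim_{t\to0}\frac1t\left(P^\gamma_{2t,0}(\Psi^X_{-t})^*_{\Psi^X_{2t}(m)}\varphi_{\Psi^X_t(m)}-\varphi_m\right)=\left.\frac{d}{dt}\right|_{t=0}P^\gamma_{2t,0}(\Psi^X_{-t})^*_{\Psi^X_{2t}(m)}\varphi_{\Psi^X_t(m)},$$ where $P^\gamma$ is the parallel transport with respect to $\nabla^0$ along the integral curve $\gamma$ of $X$ starting at $m$.
   Context: $M$ is a smooth manifold of positive dimension; a connection on $M$ is an affine connection on $TM$ (possibly with torsion), extended to tensor fields. $\Upsilon^r(M)=\Gamma(\mathrm{Sym}^rT^*M)$ is the space of totally symmetric covariant $r$-tensor fields, $\Upsilon^0(M)=C^\infty(M)$, $\Upsilon^\bullet(M)=\bigoplus_r\Upsilon^r(M)$. The symmetric derivative is $\nabla^sf=df$ and $(\nabla^s\varphi)(X_1,\dots,X_{r+1})=\sum_{j}(\nabla_{X_j}\varphi)(X_1,\dots,\hat{X}_j,\dots,X_{r+1})$ for $\varphi\in\Upsilon^r(M)$. The symmetric Lie derivative is $L^s_X=\iota_X\circ\nabla^s-\nabla^s\circ\iota_X$, with $\iota_X$ the contraction with $X$ in the first argument (zero on functions). $\nabla^0$ is the associated torsion-free connection $\nabla^0_XY=\nabla_XY-\frac12T_\nabla(X,Y)$, with $T_\nabla$ the torsion of $\nabla$. $\Psi^X$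 is the local flow of $X$. $P^\gamma_{t_0,t_1}$ denotes parallel transport along $\gamma$ from $\gamma(t_0)$ to $\gamma(t_1)$ (extended to tensors), so $P^\gamma_{2t,0}$ maps tensors at $\gamma(2t)=\Psi^X_{2t}(m)$ to tensors at $m$. $(\Psi^X_{-t})^*_{\Psi^X_{2t}(m)}$ is the pointwise pullback by $\Psi^X_{-t}$, mapping tensors at $\Psi^X_t(m)$ to tensors at $\Psi^X_{2t}(m)$. The expressions are considered for $t$ small enough that they are defined. *)

theory Defs
  imports "HOL-Analysis.Analysis" "HOL-Library.Multiset"
begin

section \<open>Smooth maps between Euclidean spaces\<close>

primrec C_k_on :: "nat \<Rightarrow> 'a::real_normed_vector set \<Rightarrow> ('a \<Rightarrow> 'b::real_normed_vector) \<Rightarrow> bool" where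
  "C_k_on 0 S f = continuous_on S f"
| "C_k_on (Suc k) S f =
     ((\<forall>x\<in>S. f differentiable (at x)) \<and>
      (\<forall>v. C_k_on k S (\<lambda>x. frechet_derivative f (at x) v)))"

text \<open>Only used on open sets \<open>S\<close>.\<close>
definition smooth_on :: "'a::real_normed_vector set \<Rightarrow> ('a \<Rightarrow> 'b::real_normed_vector) \<Rightarrow> bool" where
  "smooth_on S f \<longleftrightarrow> (\<forall>k. C_k_on k S f)"


section \<open>Manifolds and tangent vectors\<close>

text \<open>
  The underlying set of the manifold is the type \<open>'m\<close>, which is Hausdorff and second countable in
  the theorem; the model space \<open>'e\<close> is a Euclidean space.  Since \<open>DIM('e) \<ge> 1\<close> for every Euclidean
  space type, the manifold has positive dimension.
\<close>

type_synonym ('m, 'e) chart = "'m set \<times> ('m \<Rightarrow> 'e)"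

abbreviation chart_dom :: "('m, 'e) chart \<Rightarrow> 'm set" where
  "chart_dom C \<equiv> fst C"

abbreviation chart_map :: "('m, 'e) chart \<Rightarrow> 'm \<Rightarrow> 'e" where
  "chart_map C \<equiv> snd C"

definition chart_inv :: "('m, 'e) chart \<Rightarrow> 'e \<Rightarrow> 'm" where
  "chart_inv C = inv_into (chart_dom C) (chart_map C)"

definition chart_img :: "('m, 'e) chart \<Rightarrow> 'e set" where
  "chart_img C = chart_map C ` chart_dom C"

definition smooth_atlas :: "('m::topological_space, 'e::euclidean_space) chart set \<Rightarrow> bool" where
  "smooth_atlas A \<longleftrightarrow>
     (\<Union>C\<in>A. chart_dom C) = UNIV \<and>
     (\<forall>C\<in>A. open (chart_dom C) \<and> open (chart_img C) \<and>
        homeomorphism (chart_dom C) (chart_img C) (chart_map C) (chart_inv C)) \<and>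
     (\<forall>C\<in>A. \<forall>D\<in>A. smooth_on (chart_map C ` (chart_dom C \<inter> chart_dom D)) (chart_map D \<circ> chart_inv C))"

text \<open>
  Every point gets a preferred chart, and the tangent space at \<open>p\<close> is the model space \<open>'e\<close>: a vector
  \<open>v :: 'e\<close> stands for the tangent vector at \<open>p\<close> whose components in the preferred chart at \<open>p\<close> are
  \<open>v\<close>.  Its components in any other chart around \<open>p\<close> are obtained with the derivative of the
  transition map.  The preferred chart may jump from point to point, so smoothness is never
  expressed by means of these representatives, but by means of the components in a fixed chart.
\<close>

definition chart_at :: "('m, 'e) chart set \<Rightarrow> 'm \<Rightarrow> ('m, 'e) chart" where
  "chart_at A p = (SOME C. C \<in> A \<and> p \<in> chart_dom C)"

definition to_coord :: "('m, 'e::euclidean_space) chart set \<Rightarrow> ('m, 'e) chart \<Rightarrow> 'm \<Rightarrow> 'e \<Rightarrow> 'e" where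
  "to_coord A C p v =
     frechet_derivative (chart_map C \<circ> chart_inv (chart_at A p)) (at (chart_map (chart_at A p) p)) v"

definition from_coord :: "('m, 'e::euclidean_space) chart set \<Rightarrow> ('m, 'e) chart \<Rightarrow> 'm \<Rightarrow> 'e \<Rightarrow> 'e" where
  "from_coord A C p u =
     frechet_derivative (chart_map (chart_at A p) \<circ> chart_inv C) (at (chart_map C p)) u"

definition smooth_fun :: "('m, 'e::euclidean_space) chart set \<Rightarrow> ('m \<Rightarrow> real) \<Rightarrow> bool" where
  "smooth_fun A f \<longleftrightarrow> (\<forall>C\<in>A. smooth_on (chart_img C) (f \<circ> chart_inv C))"

text \<open>The differential of a function at \<open>p\<close>, and of a map at \<open>p\<close>.\<close>

definition dfun :: "('m, 'e::euclidean_space) chart set \<Rightarrow> ('m \<Rightarrow> real) \<Rightarrow> 'm \<Rightarrow> 'e \<Rightarrow> real" where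
  "dfun A f p v =
     frechet_derivative (f \<circ> chart_inv (chart_at A p)) (at (chart_map (chart_at A p) p)) v"

definition tangent_map :: "('m, 'e::euclidean_space) chart set \<Rightarrow> ('m \<Rightarrow> 'm) \<Rightarrow> 'm \<Rightarrow> 'e \<Rightarrow> 'e" where
  "tangent_map A F p v =
     frechet_derivative (chart_map (chart_at A (F p)) \<circ> F \<circ> chart_inv (chart_at A p))
       (at (chart_map (chart_at A p) p)) v"


section \<open>Vector fields and flows\<close>

definition vf_coord :: "('m, 'e::euclidean_space) chart set \<Rightarrow> ('m, 'e) chart \<Rightarrow> ('m \<Rightarrow> 'e) \<Rightarrow> 'e \<Rightarrow> 'e" where
  "vf_coord A C X x = to_coord A C (chart_inv C x) (X (chart_inv C x))"

definition smooth_vf :: "('m, 'e::euclidean_space) chart set \<Rightarrow> ('m \<Rightarrow> 'e) \<Rightarrow> bool" where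
  "smooth_vf A X \<longleftrightarrow> (\<forall>C\<in>A. smooth_on (chart_img C) (vf_coord A C X))"

text \<open>An arbitrary smooth vector field with value \<open>v\<close> at \<open>p\<close>.\<close>
definition extend_vf :: "('m, 'e::euclidean_space) chart set \<Rightarrow> 'm \<Rightarrow> 'e \<Rightarrow> 'm \<Rightarrow> 'e" where
  "extend_vf A p v = (SOME V. smooth_vf A V \<and> V p = v)"

text \<open>\<open>[X, Y] = DY(X) - DX(Y)\<close> in the preferred chart, i.e. the commutator of derivations.\<close>
definition lie_bracket :: "('m, 'e::euclidean_space) chart set \<Rightarrow> ('m \<Rightarrow> 'e) \<Rightarrow> ('m \<Rightarrow> 'e) \<Rightarrow> 'm \<Rightarrow> 'e" where
  "lie_bracket A X Y p =
     (let C = chart_at A p; x = chart_map C p in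
        frechet_derivative (vf_coord A C Y) (at x) (X p) -
        frechet_derivative (vf_coord A C X) (at x) (Y p))"

definition has_velocity ::
  "('m::topological_space, 'e::euclidean_space) chart set \<Rightarrow> (real \<Rightarrow> 'm) \<Rightarrow> 'e \<Rightarrow> real \<Rightarrow> real set \<Rightarrow> bool" where
  "has_velocity A c u t I \<longleftrightarrow>
     continuous (at t within I) c \<and>
     ((\<lambda>s. chart_map (chart_at A (c t)) (c s)) has_vector_derivative u) (at t within I)"

definition integral_curve_on ::
  "('m::topological_space, 'e::euclidean_space) chart set \<Rightarrow> ('m \<Rightarrow> 'e) \<Rightarrow> (real \<Rightarrow> 'm) \<Rightarrow> real set \<Rightarrow> bool" where
  "integral_curve_on A X c I \<longleftrightarrow> (\<forall>t\<in>I. has_velocity A c (X (c t)) t I)"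

text \<open>
  The local flow with its maximal domain: the point reached at time \<open>t\<close> by the integral curve
  starting at \<open>p\<close>.  Outside the domain of the flow the value is arbitrary.
\<close>
definition flow ::
  "('m::topological_space, 'e::euclidean_space) chart set \<Rightarrow> ('m \<Rightarrow> 'e) \<Rightarrow> real \<Rightarrow> 'm \<Rightarrow> 'm" where
  "flow A X t p =
     (THE q. \<exists>c a b. a < 0 \<and> 0 < b \<and> t \<in> {a<..<b} \<and>
        integral_curve_on A X c {a<..<b} \<and> c 0 = p \<and> c t = q)"


section \<open>Connections and parallel transport\<close>

definition affine_connection ::
  "('m, 'e::euclidean_space) chart set \<Rightarrow> (('m \<Rightarrow> 'e) \<Rightarrow> ('m \<Rightarrow> 'e) \<Rightarrow> ('m \<Rightarrow> 'e)) \<Rightarrow> bool" where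
  "affine_connection A nabla \<longleftrightarrow>
     (\<forall>X Y. smooth_vf A X \<longrightarrow> smooth_vf A Y \<longrightarrow> smooth_vf A (nabla X Y)) \<and>
     (\<forall>X X' Y. smooth_vf A X \<longrightarrow> smooth_vf A X' \<longrightarrow> smooth_vf A Y \<longrightarrow>
        nabla (\<lambda>p. X p + X' p) Y = (\<lambda>p. nabla X Y p + nabla X' Y p)) \<and>
     (\<forall>f X Y. smooth_fun A f \<longrightarrow> smooth_vf A X \<longrightarrow> smooth_vf A Y \<longrightarrow>
        nabla (\<lambda>p. f p *\<^sub>R X p) Y = (\<lambda>p. f p *\<^sub>R nabla X Y p)) \<and>
     (\<forall>X Y Y'. smooth_vf A X \<longrightarrow> smooth_vf A Y \<longrightarrow> smooth_vf A Y' \<longrightarrow>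
        nabla X (\<lambda>p. Y p + Y' p) = (\<lambda>p. nabla X Y p + nabla X Y' p)) \<and>
     (\<forall>f X Y. smooth_fun A f \<longrightarrow> smooth_vf A X \<longrightarrow> smooth_vf A Y \<longrightarrow>
        nabla X (\<lambda>p. f p *\<^sub>R Y p) = (\<lambda>p. dfun A f p (X p) *\<^sub>R Y p + f p *\<^sub>R nabla X Y p))"

definition torsion ::
  "('m, 'e::euclidean_space) chart set \<Rightarrow> (('m \<Rightarrow> 'e) \<Rightarrow> ('m \<Rightarrow> 'e) \<Rightarrow> ('m \<Rightarrow> 'e)) \<Rightarrow>
     ('m \<Rightarrow> 'e) \<Rightarrow> ('m \<Rightarrow> 'e) \<Rightarrow> ('m \<Rightarrow> 'e)" where
  "torsion A nabla X Y = (\<lambda>p. nabla X Y p - nabla Y X p - lie_bracket A X Y p)"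

definition torsion_free_part ::
  "('m, 'e::euclidean_space) chart set \<Rightarrow> (('m \<Rightarrow> 'e) \<Rightarrow> ('m \<Rightarrow> 'e) \<Rightarrow> ('m \<Rightarrow> 'e)) \<Rightarrow>
     ('m \<Rightarrow> 'e) \<Rightarrow> ('m \<Rightarrow> 'e) \<Rightarrow> ('m \<Rightarrow> 'e)" where
  "torsion_free_part A nabla X Y = (\<lambda>p. nabla X Y p - (1/2) *\<^sub>R torsion A nabla X Y p)"

text \<open>\<open>\<nabla>\<^sub>u Y\<close> at \<open>p\<close> for a single tangent vector \<open>u\<close>; by function-linearity in the first argument it does
  not depend on the extension of \<open>u\<close>.\<close>
definition nabla_at ::
  "('m, 'e::euclidean_space) chart set \<Rightarrow> (('m \<Rightarrow> 'e) \<Rightarrow> ('m \<Rightarrow> 'e) \<Rightarrow> ('m \<Rightarrow> 'e)) \<Rightarrow>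
     'm \<Rightarrow> 'e \<Rightarrow> ('m \<Rightarrow> 'e) \<Rightarrow> 'e" where
  "nabla_at A nabla p u Y = nabla (extend_vf A p u) Y p"

text \<open>
  The covariant derivative at time \<open>t\<close> of a vector field \<open>V\<close> along a curve \<open>c\<close> is \<open>w\<close>.  Near \<open>t\<close> write
  \<open>V s = (\<Sum>i. a i s *\<^sub>R E i (c s))\<close> with smooth vector fields \<open>E i\<close> (locally always possible, as
  vector fields that agree with a coordinate frame near \<open>c t\<close> show); the Leibniz rule along \<open>c\<close> and
  the agreement with \<open>\<nabla>\<^sub>u (E i)\<close>, \<open>u\<close> the velocity, on the fields \<open>E i \<circ> c\<close> then force the formula for \<open>w\<close>.
\<close>
definition has_cov_deriv_along ::
  "('m::topological_space, 'e::euclidean_space) chart set \<Rightarrow> (('m \<Rightarrow> 'e) \<Rightarrow> ('m \<Rightarrow> 'e) \<Rightarrow> ('m \<Rightarrow> 'e)) \<Rightarrow>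
     (real \<Rightarrow> 'm) \<Rightarrow> (real \<Rightarrow> 'e) \<Rightarrow> 'e \<Rightarrow> real \<Rightarrow> real set \<Rightarrow> bool" where
  "has_cov_deriv_along A nabla c V w t I \<longleftrightarrow>
     (\<exists>u (n::nat) (E :: nat \<Rightarrow> 'm \<Rightarrow> 'e) (a :: nat \<Rightarrow> real \<Rightarrow> real) (a' :: nat \<Rightarrow> real) \<epsilon>.
        has_velocity A c u t I \<and> 0 < \<epsilon> \<and>
        (\<forall>i<n. smooth_vf A (E i) \<and> (a i has_real_derivative a' i) (at t within I)) \<and>
        (\<forall>s\<in>I. \<bar>s - t\<bar> < \<epsilon> \<longrightarrow> V s = (\<Sum>i<n. a i s *\<^sub>R E i (c s))) \<and>
        w = (\<Sum>i<n. a' i *\<^sub>R E i (c t) + a i t *\<^sub>R nabla_at A nabla (c t) u (E i)))"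

definition parallel_along ::
  "('m::topological_space, 'e::euclidean_space) chart set \<Rightarrow> (('m \<Rightarrow> 'e) \<Rightarrow> ('m \<Rightarrow> 'e) \<Rightarrow> ('m \<Rightarrow> 'e)) \<Rightarrow>
     (real \<Rightarrow> 'm) \<Rightarrow> (real \<Rightarrow> 'e) \<Rightarrow> real set \<Rightarrow> bool" where
  "parallel_along A nabla c V I \<longleftrightarrow> (\<forall>t\<in>I. has_cov_deriv_along A nabla c V 0 t I)"

definition parallel_transport ::
  "('m::topological_space, 'e::euclidean_space) chart set \<Rightarrow> (('m \<Rightarrow> 'e) \<Rightarrow> ('m \<Rightarrow> 'e) \<Rightarrow> ('m \<Rightarrow> 'e)) \<Rightarrow>
     (real \<Rightarrow> 'm) \<Rightarrow> real \<Rightarrow> real \<Rightarrow> 'e \<Rightarrow> 'e" where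
  "parallel_transport A nabla c t0 t1 v =
     (THE w. \<exists>V. parallel_along A nabla c V (closed_segment t0 t1) \<and> V t0 = v \<and> V t1 = w)"


section \<open>Symmetric tensor fields\<close>

text \<open>
  A covariant \<open>r\<close>-tensor at a point is a function of the list of its \<open>r\<close> arguments.  A function on
  lists of arbitrary length encodes a family with one tensor in every degree, degree \<open>r\<close> being its
  restriction to lists of length \<open>r\<close>, and degree \<open>0\<close> the value at the empty list.  Elements of the
  direct sum over all degrees are such functions with only finitely many nonzero degrees.
\<close>

type_synonym 'e ptensor = "'e list \<Rightarrow> real"

definition sym_multilinear :: "nat \<Rightarrow> 'e::euclidean_space ptensor \<Rightarrow> bool" where
  "sym_multilinear r \<alpha> \<longleftrightarrow>
     (\<forall>vs i. length vs = r \<longrightarrow> i < r \<longrightarrow> linear (\<lambda>v. \<alpha> (vs[i := v]))) \<and>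
     (\<forall>vs ws. length vs = r \<longrightarrow> mset ws = mset vs \<longrightarrow> \<alpha> ws = \<alpha> vs)"

text \<open>The degree \<open>r\<close> part is a smooth symmetric tensor field: the entries of \<open>us\<close> are component
  vectors, so that the function required to be smooth is \<open>\<phi>\<close> evaluated on vector fields with
  constant components in the chart \<open>C\<close>.\<close>
definition sym_tensor_field_deg ::
  "('m, 'e::euclidean_space) chart set \<Rightarrow> nat \<Rightarrow> ('m \<Rightarrow> 'e ptensor) \<Rightarrow> bool" where
  "sym_tensor_field_deg A r \<phi> \<longleftrightarrow>
     (\<forall>p. sym_multilinear r (\<phi> p)) \<and>
     (\<forall>C\<in>A. \<forall>us. length us = r \<longrightarrow>
        smooth_on (chart_img C) (\<lambda>x. \<phi> (chart_inv C x) (map (from_coord A C (chart_inv C x)) us)))"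

definition sym_tensor_fields :: "('m, 'e::euclidean_space) chart set \<Rightarrow> ('m \<Rightarrow> 'e ptensor) set" where
  "sym_tensor_fields A =
     {\<phi>. (\<forall>r. sym_tensor_field_deg A r \<phi>) \<and> (\<exists>N. \<forall>p vs. N < length vs \<longrightarrow> \<phi> p vs = 0)}"

text \<open>
  \<open>(\<nabla>\<^sub>v \<phi>)(v\<^sub>1, \<dots>, v\<^sub>r) = v(\<phi>(V\<^sub>1, \<dots>, V\<^sub>r)) - (\<Sum>i. \<phi>(v\<^sub>1, \<dots>, \<nabla>\<^sub>v V\<^sub>i, \<dots>, v\<^sub>r))\<close> for any vector fields
  \<open>V\<^sub>i\<close> extending \<open>v\<^sub>i\<close>; the result does not depend on the extensions.
\<close>
definition nabla_tensor ::
  "('m, 'e::euclidean_space) chart set \<Rightarrow> (('m \<Rightarrow> 'e) \<Rightarrow> ('m \<Rightarrow> 'e) \<Rightarrow> ('m \<Rightarrow> 'e)) \<Rightarrow>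
     ('m \<Rightarrow> 'e ptensor) \<Rightarrow> 'm \<Rightarrow> 'e \<Rightarrow> 'e ptensor" where
  "nabla_tensor A nabla \<phi> p v vs =
     dfun A (\<lambda>q. \<phi> q (map (\<lambda>w. extend_vf A p w q) vs)) p v -
     (\<Sum>i<length vs. \<phi> p (vs[i := nabla_at A nabla p v (extend_vf A p (vs ! i))]))"

text \<open>On functions (degree \<open>0\<close>) this is \<open>df\<close>.\<close>
definition sym_deriv ::
  "('m, 'e::euclidean_space) chart set \<Rightarrow> (('m \<Rightarrow> 'e) \<Rightarrow> ('m \<Rightarrow> 'e) \<Rightarrow> ('m \<Rightarrow> 'e)) \<Rightarrow>
     ('m \<Rightarrow> 'e ptensor) \<Rightarrow> 'm \<Rightarrow> 'e ptensor" where
  "sym_deriv A nabla \<phi> p vs =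
     (\<Sum>j<length vs. nabla_tensor A nabla \<phi> p (vs ! j) (take j vs @ drop (Suc j) vs))"

text \<open>The degree \<open>0\<close> part of \<open>\<phi>\<close> is never evaluated here, i.e. contraction is zero on functions.\<close>
definition contract :: "('m \<Rightarrow> 'e) \<Rightarrow> ('m \<Rightarrow> 'e ptensor) \<Rightarrow> 'm \<Rightarrow> 'e ptensor" where
  "contract X \<phi> p vs = \<phi> p (X p # vs)"

definition sym_lie_deriv ::
  "('m, 'e::euclidean_space) chart set \<Rightarrow> (('m \<Rightarrow> 'e) \<Rightarrow> ('m \<Rightarrow> 'e) \<Rightarrow> ('m \<Rightarrow> 'e)) \<Rightarrow> ('m \<Rightarrow> 'e) \<Rightarrow>
     ('m \<Rightarrow> 'e ptensor) \<Rightarrow> 'm \<Rightarrow> 'e ptensor" where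
  "sym_lie_deriv A nabla X \<phi> p vs =
     contract X (sym_deriv A nabla \<phi>) p vs - sym_deriv A nabla (contract X \<phi>) p vs"

text \<open>Tensors at \<open>c t0\<close> are transported to \<open>c t1\<close> by transporting the arguments back.\<close>
definition tensor_transport ::
  "('m::topological_space, 'e::euclidean_space) chart set \<Rightarrow> (('m \<Rightarrow> 'e) \<Rightarrow> ('m \<Rightarrow> 'e) \<Rightarrow> ('m \<Rightarrow> 'e)) \<Rightarrow>
     (real \<Rightarrow> 'm) \<Rightarrow> real \<Rightarrow> real \<Rightarrow> 'e ptensor \<Rightarrow> 'e ptensor" where
  "tensor_transport A nabla c t0 t1 \<alpha> vs = \<alpha> (map (parallel_transport A nabla c t1 t0) vs)"

text \<open>Pullback to \<open>q\<close> of a tensor \<open>\<alpha>\<close> at \<open>F q\<close>.\<close>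
definition pullback_at ::
  "('m, 'e::euclidean_space) chart set \<Rightarrow> ('m \<Rightarrow> 'm) \<Rightarrow> 'm \<Rightarrow> 'e ptensor \<Rightarrow> 'e ptensor" where
  "pullback_at A F q \<alpha> vs = \<alpha> (map (tangent_map A F q) vs)"

end

theory Submission
  imports Defs
begin

text \<open>
  In a chart around \<open>m\<close>, with Christoffel symbols \<open>\<Gamma>\<close> of \<open>\<nabla>\<close> and \<open>\<Gamma>\<^sup>0(u, w) = (\<Gamma>(u, w) + \<Gamma>(w, u)) / 2\<close> of the associated
  torsion-free connection, both sides are equal to
  \<open>D\<phi>(X)(v\<^sub>1, \<dots>, v\<^sub>r) - \<Sum>\<^sub>i \<phi>(v\<^sub>1, \<dots>, 2 \<Gamma>\<^sup>0(X, v\<^sub>i) + DX(v\<^sub>i), \<dots>, v\<^sub>r)\<close>.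

  For the symmetric Lie derivative, the terms of \<open>\<iota>\<^sub>X \<nabla>\<^sup>s \<phi>\<close> that differentiate in a direction \<open>v\<^sub>i\<close> differ from those of
  \<open>\<nabla>\<^sup>s \<iota>\<^sub>X \<phi>\<close> by \<open>\<phi>(\<nabla>\<^bsub>v\<^sub>i\<^esub> X, \<dots>)\<close>, so that \<open>L\<^sup>s\<^sub>X \<phi>\<close> is \<open>\<nabla>\<^sub>X \<phi>\<close> minus the sum of these terms.  Together they contain
  \<open>\<Gamma>(X, v\<^sub>i) + \<Gamma>(v\<^sub>i, X)\<close>, twice the symmetric part (\<open>sym_lie_deriv_m\<close>).  For the other side, let \<open>w\<^sub>i\<close> be the parallel field
  along the integral curve \<open>\<gamma>\<close> with \<open>w\<^sub>i(0) = v\<^sub>i\<close>.  The expression to be differentiated is \<open>\<phi>\<close> at \<open>\<gamma>(t)\<close> on the arguments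
  \<open>T\<Psi>\<^bsub>-t\<^esub> w\<^sub>i(2t)\<close>.  Parallel transport satisfies \<open>w\<^sub>i' = - \<Gamma>\<^sup>0(\<gamma>', w\<^sub>i)\<close> and runs over time \<open>2t\<close>, and \<open>T\<Psi>\<^bsub>-t\<^esub>\<close> is
  \<open>1 - t DX + O(t\<^sup>2)\<close>; hence the derivative of an argument at zero is \<open>- 2 \<Gamma>\<^sup>0(X, v\<^sub>i) - DX(v\<^sub>i)\<close>, and the product rule
  (\<open>multilinear_product_rule\<close>) gives the formula.

  What needs proof is that flow, tangent map and parallel transport exist for small times, are unique, and are computed
  in the chart.  Cutting off with bump functions makes vector fields on the chart global, in both directions: global
  on the model space, where they are Lipschitz and the contraction principle yields a flow that is differentiable
  in the initial point (\<open>ode_exists\<close>, \<open>flow_has_derivative\<close>), and global on the manifold, where the axioms of a connection can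
  be applied to a frame (\<open>to_coord_nabla\<close>).  That the torsion-free part has the symbols \<open>\<Gamma>\<^sup>0\<close> in every chart rests on
  the invariance of the Lie bracket under changes of charts and thus on the symmetry of second derivatives
  (\<open>to_coord_lie_bracket\<close>).
\<close>

section \<open>Calculus of smooth maps\<close>

lemma frechet_derivative_eqI: "(f has_derivative f') (at x) \<Longrightarrow> frechet_derivative f (at x) = f'"
  by (metis frechet_derivative_at)

lemma C_k_on_cong:
  assumes "open S" "\<And>x. x \<in> S \<Longrightarrow> f x = g x"
  shows "C_k_on k S f \<longleftrightarrow> C_k_on k S g"
  using assms(2)
proof (induction k arbitrary: f g)
  case 0
  then show ?case by (auto intro: continuous_on_cong)
next
  case (Suc k)
  have d: "(f has_derivative f') (at x) \<longleftrightarrow> (g has_derivative f') (at x)" if "x \<in> S" for x f'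
    using has_derivative_transform_within_open[OF _ \<open>open S\<close> that, of f f' UNIV g]
      has_derivative_transform_within_open[OF _ \<open>open S\<close> that, of g f' UNIV f] Suc.prems by auto
  then have "frechet_derivative f (at x) = frechet_derivative g (at x)" if "x \<in> S" for x
    using that by (simp add: frechet_derivative_def)
  then have "C_k_on k S (\<lambda>x. frechet_derivative f (at x) v) \<longleftrightarrow>
      C_k_on k S (\<lambda>x. frechet_derivative g (at x) v)" for v
    by (intro Suc.IH) auto
  moreover have "f differentiable (at x) \<longleftrightarrow> g differentiable (at x)" if "x \<in> S" for x
    using d[OF that] by (simp add: differentiable_def)
  ultimately show ?case by simp
qed

lemma C_k_on_subset: "C_k_on k S f \<Longrightarrow> T \<subseteq> S \<Longrightarrow> C_k_on k T f"
  by (induction k arbitrary: f) (auto intro: continuous_on_subset)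

text \<open>Being \<open>C\<^sup>k\<close> on an open set is a local property, because only derivatives at points occur.\<close>

lemma C_k_on_open_cover:
  assumes "\<And>x. x \<in> S \<Longrightarrow> \<exists>U. open U \<and> x \<in> U \<and> C_k_on k U f"
  shows "C_k_on k S f"
  using assms
proof (induction k arbitrary: f)
  case 0
  then show ?case
    by (metis C_k_on.simps(1) continuous_at_imp_continuous_on continuous_on_eq_continuous_at)
next
  case (Suc k)
  have "f differentiable (at x)" if "x \<in> S" for x
    using Suc.prems[OF that] by auto
  moreover have "C_k_on k S (\<lambda>x. frechet_derivative f (at x) v)" for v
    by (rule Suc.IH) (use Suc.prems in force)
  ultimately show ?case by simp
qed

lemma C_k_on_Suc_imp: "C_k_on (Suc k) S f \<Longrightarrow> C_k_on k S f"
proof (induction k arbitrary: f)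
  case 0
  then show ?case
    by (auto simp: continuous_at_imp_continuous_on differentiable_imp_continuous_within)
next
  case (Suc k)
  then show ?case by (metis C_k_on.simps(2))
qed

lemma C_k_on_const: "C_k_on k S (\<lambda>x. c)"
  by (induction k arbitrary: c) auto

lemma C_k_on_bounded_linear:
  assumes l: "bounded_linear l" and S: "open S" and f: "C_k_on k S f"
  shows "C_k_on k S (\<lambda>x. l (f x))"
  using f
proof (induction k arbitrary: f)
  case 0
  then show ?case using bounded_linear.continuous_on[OF l] by auto
next
  case (Suc k)
  have d: "((\<lambda>x. l (f x)) has_derivative (\<lambda>v. l (frechet_derivative f (at x) v))) (at x)" if "x \<in> S" for x
    using Suc.prems that
    by (intro bounded_linear.has_derivative[OF l]) (auto simp: frechet_derivative_works[symmetric])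
  have "C_k_on k S (\<lambda>x. frechet_derivative (\<lambda>x. l (f x)) (at x) v)" for v
    using Suc.IH[of "\<lambda>x. frechet_derivative f (at x) v"] Suc.prems
    by (subst C_k_on_cong[OF S, of _ "\<lambda>x. l (frechet_derivative f (at x) v)"])
      (auto simp: frechet_derivative_eqI[OF d])
  then show ?case using d by (auto simp: differentiable_def)
qed

lemma C_k_on_id: "C_k_on k S (\<lambda>x. x)"
  by (cases k) (auto intro: C_k_on_const)

lemma C_k_on_add:
  assumes S: "open S" and "C_k_on k S f" "C_k_on k S g"
  shows "C_k_on k S (\<lambda>x. f x + g x)"
  using assms(2,3)
proof (induction k arbitrary: f g)
  case 0
  then show ?case by (auto intro: continuous_on_add)
next
  case (Suc k)
  have d: "((\<lambda>x. f x + g x) has_derivative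
      (\<lambda>v. frechet_derivative f (at x) v + frechet_derivative g (at x) v)) (at x)" if "x \<in> S" for x
    using Suc.prems that
    by (intro has_derivative_add) (auto simp: frechet_derivative_works[symmetric])
  have "C_k_on k S (\<lambda>x. frechet_derivative (\<lambda>x. f x + g x) (at x) v)" for v
    using Suc.IH[of "\<lambda>x. frechet_derivative f (at x) v" "\<lambda>x. frechet_derivative g (at x) v"] Suc.prems
    by (subst C_k_on_cong[OF S, of _ "\<lambda>x. frechet_derivative f (at x) v + frechet_derivative g (at x) v"])
      (auto simp: frechet_derivative_eqI[OF d])
  then show ?case using d by (auto simp: differentiable_def)
qed

lemma C_k_on_sum:
  assumes "open S" "\<And>i. i \<in> I \<Longrightarrow> C_k_on k S (f i)"
  shows "C_k_on k S (\<lambda>x. \<Sum>i\<in>I. f i x)"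
  using assms(2)
  by (induction I rule: infinite_finite_induct) (auto intro: C_k_on_const C_k_on_add[OF assms(1)])

lemma C_k_on_bilinear:
  assumes B: "bounded_bilinear B" and S: "open S" and "C_k_on k S f" "C_k_on k S g"
  shows "C_k_on k S (\<lambda>x. B (f x) (g x))"
  using assms(3,4)
proof (induction k arbitrary: f g)
  case 0
  then show ?case by (auto intro: bounded_bilinear.continuous_on[OF B])
next
  case (Suc k)
  let ?D = "\<lambda>x v. B (f x) (frechet_derivative g (at x) v) + B (frechet_derivative f (at x) v) (g x)"
  have d: "((\<lambda>x. B (f x) (g x)) has_derivative ?D x) (at x)" if "x \<in> S" for x
    using Suc.prems that
    by (intro bounded_bilinear.FDERIV[OF B]) (auto simp: frechet_derivative_works[symmetric])
  have "C_k_on k S (\<lambda>x. ?D x v)" for v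
    using Suc.prems Suc.prems[THEN C_k_on_Suc_imp] by (intro C_k_on_add S Suc.IH) auto
  then have "C_k_on k S (\<lambda>x. frechet_derivative (\<lambda>x. B (f x) (g x)) (at x) v)" for v
    by (subst C_k_on_cong[OF S, of _ "\<lambda>x. ?D x v"]) (auto simp: frechet_derivative_eqI[OF d])
  then show ?case using d by (auto simp: differentiable_def)
qed

text \<open>The definition of \<open>C\<^sup>k\<close> speaks of derivatives in constant directions only.  Expanding a direction in
  the standard basis brings derivatives in varying directions, as in the chain rule, into that form.\<close>

lemma frechet_derivative_basis_sum:
  fixes v :: "'a::euclidean_space"
  assumes "g differentiable (at y)"
  shows "frechet_derivative g (at y) v = (\<Sum>b\<in>Basis. (v \<bullet> b) *\<^sub>R frechet_derivative g (at y) b)"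
proof -
  have "linear (frechet_derivative g (at y))"
    using assms by (rule linear_frechet_derivative)
  then have "frechet_derivative g (at y) (\<Sum>b\<in>Basis. (v \<bullet> b) *\<^sub>R b) =
      (\<Sum>b\<in>Basis. (v \<bullet> b) *\<^sub>R frechet_derivative g (at y) b)"
    by (simp add: linear_sum linear_scale)
  then show ?thesis by (simp add: euclidean_representation)
qed

lemma C_k_on_compose:
  fixes f :: "'a::real_normed_vector \<Rightarrow> 'b::euclidean_space"
  assumes S: "open S" and T: "open T" and "f ` S \<subseteq> T" "C_k_on k S f" "C_k_on k T g"
  shows "C_k_on k S (\<lambda>x. g (f x))"
  using assms(3-5)
proof (induction k arbitrary: g f)
  case 0
  then show ?case by (auto intro: continuous_on_compose2)
next
  case (Suc k)
  let ?D = "\<lambda>x v. \<Sum>b\<in>Basis. (frechet_derivative f (at x) v \<bullet> b) *\<^sub>R frechet_derivative g (at (f x)) b"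
  have gd: "g differentiable (at (f x))" if "x \<in> S" for x
    using Suc.prems that by auto
  have "((\<lambda>x. g (f x)) has_derivative (\<lambda>v. frechet_derivative g (at (f x)) (frechet_derivative f (at x) v))) (at x)"
    if "x \<in> S" for x
    using Suc.prems that gd[OF that]
    by (intro has_derivative_compose[of f _ x UNIV g]) (auto simp: frechet_derivative_works[symmetric])
  then have d: "((\<lambda>x. g (f x)) has_derivative ?D x) (at x)" if "x \<in> S" for x
    using that by (simp flip: frechet_derivative_basis_sum[OF gd])
  have "C_k_on k S (\<lambda>x. ?D x v)" for v
    using Suc.prems Suc.prems(2,3)[THEN C_k_on_Suc_imp]
    by (intro C_k_on_sum C_k_on_bilinear[OF bounded_bilinear_scaleR S]
        C_k_on_bounded_linear[OF bounded_linear_inner_left S] Suc.IH S) auto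
  then have "C_k_on k S (\<lambda>x. frechet_derivative (\<lambda>x. g (f x)) (at x) v)" for v
    by (subst C_k_on_cong[OF S, of _ "\<lambda>x. ?D x v"]) (auto simp: frechet_derivative_eqI[OF d])
  then show ?case using d by (auto simp: differentiable_def)
qed

lemma smooth_on_cong:
  "open S \<Longrightarrow> (\<And>x. x \<in> S \<Longrightarrow> f x = g x) \<Longrightarrow> smooth_on S f \<longleftrightarrow> smooth_on S g"
  using C_k_on_cong by (metis smooth_on_def)

lemma smooth_on_subset: "smooth_on S f \<Longrightarrow> T \<subseteq> S \<Longrightarrow> smooth_on T f"
  using C_k_on_subset by (metis smooth_on_def)

lemma smooth_on_open_cover:
  "(\<And>x. x \<in> S \<Longrightarrow> \<exists>U. open U \<and> x \<in> U \<and> smooth_on U f) \<Longrightarrow> smooth_on S f"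
  unfolding smooth_on_def by (meson C_k_on_open_cover)

lemma smooth_on_const: "smooth_on S (\<lambda>x. c)"
  by (simp add: smooth_on_def C_k_on_const)

lemma smooth_on_id: "smooth_on S (\<lambda>x. x)"
  by (simp add: smooth_on_def C_k_on_id)

lemma smooth_on_add:
  "open S \<Longrightarrow> smooth_on S f \<Longrightarrow> smooth_on S g \<Longrightarrow> smooth_on S (\<lambda>x. f x + g x)"
  by (simp add: smooth_on_def C_k_on_add)

lemma smooth_on_sum:
  "open S \<Longrightarrow> (\<And>i. i \<in> I \<Longrightarrow> smooth_on S (f i)) \<Longrightarrow> smooth_on S (\<lambda>x. \<Sum>i\<in>I. f i x)"
  by (simp add: smooth_on_def C_k_on_sum)

lemma smooth_on_bilinear:
  "bounded_bilinear B \<Longrightarrow> open S \<Longrightarrow> smooth_on S f \<Longrightarrow> smooth_on S g \<Longrightarrow> smooth_on S (\<lambda>x. B (f x) (g x))"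
  by (simp add: smooth_on_def C_k_on_bilinear)

lemmas smooth_on_scaleR = smooth_on_bilinear[OF bounded_bilinear_scaleR]
  and smooth_on_mult = smooth_on_bilinear[OF bounded_bilinear_mult]
  and smooth_on_inner = smooth_on_bilinear[OF bounded_bilinear_inner]

lemma smooth_on_compose:
  fixes f :: "'a::real_normed_vector \<Rightarrow> 'b::euclidean_space"
  shows "open S \<Longrightarrow> open T \<Longrightarrow> f ` S \<subseteq> T \<Longrightarrow> smooth_on S f \<Longrightarrow> smooth_on T g \<Longrightarrow> smooth_on S (\<lambda>x. g (f x))"
  by (simp add: smooth_on_def C_k_on_compose)

lemma smooth_on_derivative: "smooth_on S f \<Longrightarrow> smooth_on S (\<lambda>x. frechet_derivative f (at x) v)"
  unfolding smooth_on_def by (metis C_k_on.simps(2))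

lemma smooth_on_imp_differentiable: "smooth_on S f \<Longrightarrow> x \<in> S \<Longrightarrow> f differentiable (at x)"
  unfolding smooth_on_def by (metis C_k_on.simps(2))

lemma smooth_on_has_derivative:
  "smooth_on S f \<Longrightarrow> x \<in> S \<Longrightarrow> (f has_derivative frechet_derivative f (at x)) (at x)"
  using smooth_on_imp_differentiable frechet_derivative_works by blast

lemma smooth_on_imp_continuous_on: "smooth_on S f \<Longrightarrow> continuous_on S f"
  unfolding smooth_on_def by (metis C_k_on.simps(1))

lemma smooth_on_derivative_compose:
  fixes f :: "'a::real_normed_vector \<Rightarrow> 'b::euclidean_space"
  assumes "open S" "open T" "f ` S \<subseteq> T" "smooth_on S f" "smooth_on T g" "smooth_on S h"
  shows "smooth_on S (\<lambda>x. frechet_derivative g (at (f x)) (h x))"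
proof -
  have "smooth_on S (\<lambda>x. \<Sum>b\<in>Basis. (h x \<bullet> b) *\<^sub>R frechet_derivative g (at (f x)) b)"
    by (intro smooth_on_sum smooth_on_scaleR smooth_on_inner smooth_on_const assms
        smooth_on_compose[OF assms(1,2,3)] smooth_on_derivative)
  moreover have "frechet_derivative g (at (f x)) (h x) =
      (\<Sum>b\<in>Basis. (h x \<bullet> b) *\<^sub>R frechet_derivative g (at (f x)) b)" if "x \<in> S" for x
    using assms that by (intro frechet_derivative_basis_sum smooth_on_imp_differentiable[OF assms(5)]) auto
  ultimately show ?thesis
    by (subst smooth_on_cong[OF assms(1)]) auto
qed

lemma C_k_on_real_SucI:
  fixes f :: "real \<Rightarrow> real"
  assumes S: "open S" and d: "\<And>x. x \<in> S \<Longrightarrow> (f has_real_derivative f' x) (at x)" and "C_k_on k S f'"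
  shows "C_k_on (Suc k) S f"
proof -
  have d: "(f has_derivative (\<lambda>v. f' x * v)) (at x)" if "x \<in> S" for x
    using d[OF that] by (simp add: has_field_derivative_def)
  have "C_k_on k S (\<lambda>x. f' x * v)" for v
    using C_k_on_bilinear[OF bounded_bilinear_mult S assms(3) C_k_on_const] .
  then have "C_k_on k S (\<lambda>x. frechet_derivative f (at x) v)" for v
    by (subst C_k_on_cong[OF S, of _ "\<lambda>x. f' x * v"]) (auto simp: frechet_derivative_eqI[OF d])
  then show ?thesis using d by (auto simp: differentiable_def)
qed

lemma smooth_on_inverse: "smooth_on (- {0}) (inverse :: real \<Rightarrow> real)"
proof -
  have "C_k_on k (- {0}) (inverse :: real \<Rightarrow> real)" for k
  proof (induction k)
    case 0
    then show ?case by (auto intro!: continuous_intros)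
  next
    case (Suc k)
    have "C_k_on k (- {0}) (\<lambda>x::real. - (inverse x * inverse x))"
      by (intro C_k_on_bounded_linear[OF bounded_linear_minus[OF bounded_linear_ident]]
          C_k_on_bilinear[OF bounded_bilinear_mult] Suc.IH) auto
    then show ?case
      by (rule C_k_on_real_SucI[rotated 2])
        (auto intro!: derivative_eq_intros simp: power2_eq_square)
  qed
  then show ?thesis by (simp add: smooth_on_def)
qed

subsection \<open>Bump functions\<close>

text \<open>The family \<open>exp(-1/x) / x\<^sup>n\<close>, extended by zero, is closed under differentiation up to linear
  combinations, so that its smoothness in all orders comes out of one simultaneous induction.\<close>

definition flat_exp :: "nat \<Rightarrow> real \<Rightarrow> real" where
  "flat_exp n x = (if x \<le> 0 then 0 else exp (- 1 / x) / x ^ n)"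

text \<open>One term of the exponential series at \<open>1/x\<close> gives the bound.  Its quadratic order makes the derivative
  at zero vanish.\<close>

lemma flat_exp_le:
  assumes "0 < x"
  shows "flat_exp n x \<le> fact (n + 2) * x\<^sup>2"
proof -
  have "(1 / x) ^ (n + 2) / fact (n + 2) = (\<Sum>i\<in>{n + 2}. (1 / x) ^ i /\<^sub>R fact i)"
    by (simp add: divide_inverse del: fact_Suc)
  also have "\<dots> \<le> exp (1 / x)"
    unfolding exp_def by (rule sum_le_suminf) (use assms summable_exp_generic[of "1 / x"] in auto)
  finally have "1 / x ^ (n + 2) / fact (n + 2) \<le> exp (1 / x)"
    by (simp only: power_one_over)
  moreover have "1 \<le> F * E * p" if "1 / p / F \<le> E" "0 < F" "0 < p" for p F E :: real
    using that by (simp add: field_simps)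
  ultimately have "1 \<le> fact (n + 2) * exp (1 / x) * x ^ (n + 2)"
    using assms by simp
  also have "\<dots> = fact (n + 2) * x\<^sup>2 * (x ^ n / exp (- 1 / x))"
    using assms by (simp add: exp_minus power_add power2_eq_square field_simps del: fact_Suc)
  finally have "1 \<le> fact (n + 2) * x\<^sup>2 * (x ^ n / exp (- 1 / x))" .
  then show ?thesis
    using assms by (simp add: flat_exp_def field_simps del: fact_Suc)
qed

lemma flat_exp_has_real_derivative:
  "(flat_exp n has_real_derivative (flat_exp (n + 2) x - n * flat_exp (Suc n) x)) (at x)"
proof -
  consider "x < 0" | "x > 0" | "x = 0" by linarith
  then show ?thesis
  proof cases
    case 1
    have "((\<lambda>x. 0) has_real_derivative 0) (at x)" by simp
    then have "(flat_exp n has_real_derivative 0) (at x)"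
      by (rule has_field_derivative_transform_within_open[of _ _ _ "{..<0}"])
        (use 1 in \<open>auto simp: flat_exp_def\<close>)
    then show ?thesis using 1 by (simp add: flat_exp_def)
  next
    case 2
    have "((\<lambda>x. exp (- 1 / x) / x ^ n) has_real_derivative
        (flat_exp (n + 2) x - n * flat_exp (Suc n) x)) (at x)"
    proof (cases n)
      case 0
      then show ?thesis
        using 2 by (auto intro!: derivative_eq_intros simp: flat_exp_def field_simps power2_eq_square)
    next
      case (Suc m)
      have *: "((\<lambda>x. exp (- 1 / x)) has_real_derivative exp (- 1 / x) * (1 / x\<^sup>2)) (at x)"
        using 2 by (auto intro!: derivative_eq_intros simp: power2_eq_square)
      show ?thesis
        unfolding Suc
        by (rule DERIV_cong[OF DERIV_divide[OF * DERIV_pow]])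
          (use 2 in \<open>simp_all add: flat_exp_def field_simps power2_eq_square\<close>)
    qed
    then show ?thesis
      by (rule has_field_derivative_transform_within_open[of _ _ _ "{0<..}"])
        (use 2 in \<open>auto simp: flat_exp_def\<close>)
  next
    case 3
    have "\<bar>flat_exp n h / h\<bar> \<le> fact (n + 2) * \<bar>h\<bar>" for h
    proof (cases "h > 0")
      case True
      then have "\<bar>flat_exp n h / h\<bar> = flat_exp n h / h"
        by (simp add: flat_exp_def)
      also have "\<dots> \<le> fact (n + 2) * h\<^sup>2 / h"
        using True flat_exp_le[of h n] by (intro divide_right_mono) auto
      finally show ?thesis using True by (simp add: power2_eq_square)
    next
      case False
      have "0 \<le> fact (n + 2) * \<bar>h\<bar>"
        by (intro mult_nonneg_nonneg) auto
      then show ?thesis using False by (simp add: flat_exp_def del: fact_Suc)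
    qed
    then have "\<forall>\<^sub>F h in at 0. norm (flat_exp n h / h) \<le> fact (n + 2) * \<bar>h\<bar>"
      by simp
    moreover have "((\<lambda>h::real. fact (n + 2) * \<bar>h\<bar>) \<longlongrightarrow> 0) (at 0)"
      by (auto intro!: tendsto_eq_intros)
    ultimately have "((\<lambda>h. flat_exp n h / h) \<longlongrightarrow> 0) (at 0)"
      by (rule Lim_null_comparison)
    then show ?thesis using 3 by (simp add: DERIV_def flat_exp_def)
  qed
qed

lemma smooth_on_flat_exp: "smooth_on UNIV (flat_exp n)"
proof -
  have "\<forall>n. C_k_on k UNIV (flat_exp n)" for k
  proof (induction k)
    case 0
    then show ?case
      by (auto intro!: continuous_at_imp_continuous_on DERIV_isCont flat_exp_has_real_derivative)
  next
    case (Suc k)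
    have "C_k_on k UNIV (\<lambda>x. flat_exp (n + 2) x + - real n * flat_exp (Suc n) x)" for n
      using Suc.IH
      by (intro C_k_on_add C_k_on_bilinear[OF bounded_bilinear_mult] C_k_on_const) auto
    then show ?case
      by (intro allI C_k_on_real_SucI[where f' = "\<lambda>x. flat_exp (n + 2) x + - real n * flat_exp (Suc n) x" for n])
        (use flat_exp_has_real_derivative in auto)
  qed
  then show ?thesis by (simp add: smooth_on_def)
qed

text \<open>A quotient \<open>f / (f + g)\<close> is one where \<open>g\<close> vanishes and zero where \<open>f\<close> vanishes; here \<open>f\<close> and \<open>g\<close> are flat
  functions of the squared distance without common zeros.\<close>

lemma bump_function:
  fixes x0 :: "'a::euclidean_space"
  assumes "0 < r"
  obtains \<beta> :: "'a \<Rightarrow> real" where "smooth_on UNIV \<beta>"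
    "\<And>x. x \<in> ball x0 r \<Longrightarrow> \<beta> x = 1" "\<And>x. x \<notin> cball x0 (2 * r) \<Longrightarrow> \<beta> x = 0"
proof
  define s where "s x = (1 / r\<^sup>2) * ((x - x0) \<bullet> (x - x0))" for x
  let ?f = "\<lambda>x. flat_exp 0 (2 - s x)" and ?g = "\<lambda>x. flat_exp 0 (s x - 1)"
  let ?\<beta> = "\<lambda>x. ?f x * inverse (?f x + ?g x)"
  have sub: "smooth_on UNIV (\<lambda>x. x - c)" for c :: "'b::real_normed_vector"
    using smooth_on_add[OF open_UNIV smooth_on_id smooth_on_const, of "- c"] by simp
  have s: "smooth_on UNIV s"
    unfolding s_def by (intro smooth_on_mult smooth_on_const smooth_on_inner sub) auto
  have "smooth_on UNIV (\<lambda>x. 2 + - 1 * s x)"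
    by (intro smooth_on_add smooth_on_const smooth_on_mult s) auto
  then have f: "smooth_on UNIV ?f"
    by (intro smooth_on_compose[OF open_UNIV open_UNIV _ _ smooth_on_flat_exp]) auto
  have "smooth_on UNIV (\<lambda>x. s x - 1)"
    by (rule smooth_on_compose[OF open_UNIV open_UNIV _ s sub]) auto
  then have g: "smooth_on UNIV ?g"
    by (intro smooth_on_compose[OF open_UNIV open_UNIV _ _ smooth_on_flat_exp]) auto
  have pos: "0 < flat_exp 0 (2 - y) + flat_exp 0 (y - 1)" for y
    by (auto simp: flat_exp_def add_pos_nonneg add_pos_pos)
  show "smooth_on UNIV ?\<beta>"
    using pos by (intro smooth_on_mult f open_UNIV
        smooth_on_compose[OF open_UNIV _ _ smooth_on_add[OF open_UNIV f g] smooth_on_inverse])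
      (auto simp: less_imp_neq[symmetric])
  show "?\<beta> x = 1" if "x \<in> ball x0 r" for x
  proof -
    have "(norm (x - x0))\<^sup>2 < r\<^sup>2"
      using that assms by (intro power_strict_mono) (auto simp: dist_norm norm_minus_commute)
    then have "s x < 1"
      using assms by (simp add: s_def power2_norm_eq_inner)
    then show ?thesis by (simp add: flat_exp_def)
  qed
  show "?\<beta> x = 0" if "x \<notin> cball x0 (2 * r)" for x
  proof -
    have "(2 * r)\<^sup>2 < (norm (x - x0))\<^sup>2"
      using that assms by (intro power_strict_mono) (auto simp: dist_norm norm_minus_commute)
    then have "4 * r\<^sup>2 < (x - x0) \<bullet> (x - x0)"
      by (simp add: power2_norm_eq_inner power_mult_distrib)
    then have "4 < s x"
      using assms by (simp add: s_def field_simps)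
    then show ?thesis by (simp add: flat_exp_def)
  qed
qed

subsection \<open>Consequences of compact support\<close>

lemma frechet_derivative_eq_0_outside:
  assumes "closed K" "\<And>x. x \<notin> K \<Longrightarrow> f x = 0" "x \<notin> K"
  shows "frechet_derivative f (at x) = (\<lambda>_. 0)"
proof (rule frechet_derivative_eqI)
  have "((\<lambda>_. 0) has_derivative (\<lambda>_. 0)) (at x)" by simp
  then show "(f has_derivative (\<lambda>_. 0)) (at x)"
    by (rule has_derivative_transform_within_open[of _ _ _ _ "- K"]) (use assms in auto)
qed

lemma bounded_of_compact_support:
  fixes f :: "'a::euclidean_space \<Rightarrow> 'b::real_normed_vector"
  assumes "continuous_on UNIV f" "compact K" "\<And>x. x \<notin> K \<Longrightarrow> f x = 0"
  obtains B where "0 \<le> B" "\<And>x. norm (f x) \<le> B"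
proof -
  have "compact (f ` K)"
    using assms by (meson compact_continuous_image continuous_on_subset subset_UNIV)
  then obtain B where "\<And>y. y \<in> f ` K \<Longrightarrow> norm y \<le> B"
    using compact_imp_bounded bounded_iff by metis
  then have "norm (f x) \<le> max 0 B" for x
    using assms(3)[of x] by (cases "x \<in> K") (fastforce simp: le_max_iff_disj)+
  then show thesis by (intro that[of "max 0 B"]) auto
qed

lemma derivative_bounded_of_compact_support:
  fixes f :: "'a::euclidean_space \<Rightarrow> 'b::real_normed_vector"
  assumes "smooth_on UNIV f" "compact K" "\<And>x. x \<notin> K \<Longrightarrow> f x = 0"
  obtains L where "0 \<le> L" "\<And>x v. norm (frechet_derivative f (at x) v) \<le> L * norm v"
    "\<And>x y. norm (f x - f y) \<le> L * norm (x - y)"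
proof -
  have "\<exists>B. 0 \<le> B \<and> (\<forall>x. norm (frechet_derivative f (at x) b) \<le> B)" for b
    by (rule bounded_of_compact_support[of "\<lambda>x. frechet_derivative f (at x) b" K])
      (use assms in \<open>auto simp: compact_imp_closed smooth_on_imp_continuous_on smooth_on_derivative
        frechet_derivative_eq_0_outside[of K f]\<close>)
  then obtain B where B: "\<And>b. 0 \<le> B b" "\<And>b x. norm (frechet_derivative f (at x) b) \<le> B b"
    by metis
  let ?L = "sum B Basis"
  have L: "norm (frechet_derivative f (at x) v) \<le> ?L * norm v" for x v
  proof -
    have "norm (frechet_derivative f (at x) v) \<le>
        (\<Sum>b\<in>Basis. norm ((v \<bullet> b) *\<^sub>R frechet_derivative f (at x) b))"
      by (subst frechet_derivative_basis_sum)
        (use assms in \<open>auto intro: smooth_on_imp_differentiable simp del: norm_scaleR intro!: norm_sum\<close>)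
    also have "\<dots> \<le> (\<Sum>b\<in>Basis. norm v * B b)"
      unfolding norm_scaleR by (intro sum_mono mult_mono B) (auto simp: Basis_le_norm)
    finally show ?thesis by (simp add: sum_distrib_left mult.commute)
  qed
  have "norm (f x - f y) \<le> ?L * norm (x - y)" for x y
  proof (rule differentiable_bound[OF convex_UNIV])
    show "(f has_derivative frechet_derivative f (at x)) (at x)" for x
      using assms(1) smooth_on_has_derivative by blast
    show "onorm (frechet_derivative f (at x)) \<le> ?L" for x
      using L by (intro onorm_bound sum_nonneg B)
  qed auto
  with L show thesis by (intro that[of ?L]) (auto intro: sum_nonneg B)
qed

lemma derivative_lipschitz_of_compact_support:
  fixes f :: "'a::euclidean_space \<Rightarrow> 'b::euclidean_space"
  assumes "smooth_on UNIV f" "compact K" "\<And>x. x \<notin> K \<Longrightarrow> f x = 0"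
  obtains L where "0 \<le> L"
    "\<And>x y v. norm (frechet_derivative f (at x) v - frechet_derivative f (at y) v) \<le> L * norm (x - y) * norm v"
proof -
  let ?G = "\<lambda>b x. frechet_derivative f (at x) b"
  have "\<exists>B. 0 \<le> B \<and> (\<forall>x y. norm (?G b x - ?G b y) \<le> B * norm (x - y))" for b
    by (rule derivative_bounded_of_compact_support[of "?G b" K])
      (use assms in \<open>auto simp: compact_imp_closed smooth_on_derivative frechet_derivative_eq_0_outside[of K f]\<close>)
  then obtain B where B: "\<And>b. 0 \<le> B b" "\<And>b x y. norm (?G b x - ?G b y) \<le> B b * norm (x - y)"
    by metis
  let ?L = "sum B Basis"
  have "norm (?G v x - ?G v y) \<le> ?L * norm (x - y) * norm v" for x y v
  proof -
    have "?G v x - ?G v y = (\<Sum>b\<in>Basis. (v \<bullet> b) *\<^sub>R (?G b x - ?G b y))"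
      using frechet_derivative_basis_sum[OF smooth_on_imp_differentiable[OF assms(1)], of x v]
        frechet_derivative_basis_sum[OF smooth_on_imp_differentiable[OF assms(1)], of y v]
      by (simp only: UNIV_I scaleR_diff_right sum_subtractf simp_thms)
    also have "norm \<dots> \<le> (\<Sum>b\<in>Basis. norm v * (B b * norm (x - y)))"
    proof (rule sum_norm_le)
      fix b :: 'a assume "b \<in> Basis"
      then show "norm ((v \<bullet> b) *\<^sub>R (?G b x - ?G b y)) \<le> norm v * (B b * norm (x - y))"
        unfolding norm_scaleR by (intro mult_mono B) (auto simp: Basis_le_norm)
    qed
    also have "\<dots> = ?L * norm (x - y) * norm v"
      by (simp add: sum_distrib_left sum_distrib_right mult_ac)
    finally show ?thesis .
  qed
  then show thesis by (intro that[of ?L]) (auto intro: sum_nonneg B)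
qed

subsection \<open>Symmetry of second derivatives\<close>

text \<open>The second difference of \<open>f\<close> over a small parallelogram does not see the order of the two sides, so an
  expansion in terms of the iterated derivative implies symmetry.  The expansion comes from the mean value
  inequality along \<open>u\<close> and the differentiability at \<open>x\<close> of the derivative in direction \<open>u\<close>.\<close>

lemma second_difference_approx:
  fixes f :: "'a::euclidean_space \<Rightarrow> 'b::euclidean_space"
  assumes S: "open S" "x \<in> S" and f: "smooth_on S f" and "0 < e"
  shows "\<forall>\<^sub>F h in at_right 0.
    norm (f (x + h *\<^sub>R u + h *\<^sub>R v) - f (x + h *\<^sub>R u) - f (x + h *\<^sub>R v) + f x
      - (h * h) *\<^sub>R frechet_derivative (\<lambda>y. frechet_derivative f (at y) u) (at x) v) \<le> e * (h * h)"
proof -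
  let ?G = "\<lambda>y. frechet_derivative f (at y) u"
  let ?G' = "frechet_derivative ?G (at x)"
  have G: "(?G has_derivative ?G') (at x)"
    using smooth_on_has_derivative[OF smooth_on_derivative[OF f] S(2)] .
  then have linG: "linear ?G'"
    by (simp add: has_derivative_linear)
  define N where "N = 2 * (norm u + norm v) + 1"
  have N: "0 < N" by (simp add: N_def add_nonneg_pos)
  obtain d where d: "0 < d" "\<And>y. norm (y - x) < d \<Longrightarrow> norm (?G y - ?G x - ?G' (y - x)) \<le> e / N * norm (y - x)"
    using G \<open>0 < e\<close> N unfolding has_derivative_at_alt by (meson divide_pos_pos)
  obtain d' where d': "0 < d'" "ball x d' \<subseteq> S"
    using S openE by blast
  have bd: "norm (f (x + h *\<^sub>R u + h *\<^sub>R v) - f (x + h *\<^sub>R u) - f (x + h *\<^sub>R v) + f x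
      - (h * h) *\<^sub>R ?G' v) \<le> e * (h * h)" if h: "0 < h" "h < min d d' / N" for h
  proof -
    have hN: "h * N < d" "h * N < d'"
      using h N by (auto simp: field_simps)
    have near: "norm (s *\<^sub>R u + c *\<^sub>R v) \<le> h * (norm u + norm v)" if "s \<in> {0..h}" "c \<in> {0, h}" for s c
    proof -
      have "norm (s *\<^sub>R u + c *\<^sub>R v) \<le> s * norm u + c * norm v"
        using that h by (intro norm_triangle_le) auto
      also have "\<dots> \<le> h * norm u + h * norm v"
        using that h by (intro add_mono mult_right_mono) auto
      finally show ?thesis by (simp add: algebra_simps)
    qed
    have hN': "h * (norm u + norm v) < h * N"
      using h by (simp add: N_def add_nonneg_pos)
    have inS: "x + s *\<^sub>R u + c *\<^sub>R v \<in> S" if "s \<in> {0..h}" "c \<in> {0, h}" for s c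
    proof -
      have "dist x (x + s *\<^sub>R u + c *\<^sub>R v) = norm (s *\<^sub>R u + c *\<^sub>R v)"
        by (simp add: dist_norm norm_minus_commute add_ac)
      then show ?thesis using near[OF that] hN hN' d' by auto
    qed
    define \<phi> where "\<phi> s = f (x + s *\<^sub>R u + h *\<^sub>R v) - f (x + s *\<^sub>R u) - s *\<^sub>R h *\<^sub>R ?G' v" for s
    have fd: "((\<lambda>s. f (x + s *\<^sub>R u + c *\<^sub>R v)) has_vector_derivative ?G (x + s *\<^sub>R u + c *\<^sub>R v)) (at s within {0..h})"
      if "s \<in> {0..h}" "c \<in> {0, h}" for s c
      unfolding has_vector_derivative_def
    proof (rule has_derivative_eq_rhs)
      show "((\<lambda>s. f (x + s *\<^sub>R u + c *\<^sub>R v)) has_derivative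
          (\<lambda>t. frechet_derivative f (at (x + s *\<^sub>R u + c *\<^sub>R v)) (t *\<^sub>R u))) (at s within {0..h})"
        by (rule has_derivative_compose[of "\<lambda>s. x + s *\<^sub>R u + c *\<^sub>R v" _ s _ f])
          (auto intro!: derivative_eq_intros smooth_on_has_derivative[OF f inS[OF that]])
      show "(\<lambda>t. frechet_derivative f (at (x + s *\<^sub>R u + c *\<^sub>R v)) (t *\<^sub>R u)) =
          (\<lambda>t. t *\<^sub>R ?G (x + s *\<^sub>R u + c *\<^sub>R v))"
        using linear_scale[OF linear_frechet_derivative[OF smooth_on_imp_differentiable[OF f inS[OF that]]]]
        by (simp add: fun_eq_iff)
    qed
    have d\<phi>: "(\<phi> has_vector_derivative ?G (x + s *\<^sub>R u + h *\<^sub>R v) - ?G (x + s *\<^sub>R u) - h *\<^sub>R ?G' v)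
        (at s within {0..h})" if "s \<in> {0..h}" for s
      unfolding \<phi>_def using fd[OF that, of h] fd[OF that, of 0]
      by (auto intro!: derivative_eq_intros)
    have G_approx: "norm (?G (x + s *\<^sub>R u + c *\<^sub>R v) - ?G x - ?G' (s *\<^sub>R u + c *\<^sub>R v)) \<le> e / N * (h * (norm u + norm v))"
      if "s \<in> {0..h}" "c \<in> {0, h}" for s c
    proof -
      have "norm (?G (x + s *\<^sub>R u + c *\<^sub>R v) - ?G x - ?G' (s *\<^sub>R u + c *\<^sub>R v)) \<le> e / N * norm (s *\<^sub>R u + c *\<^sub>R v)"
        using d(2)[of "x + s *\<^sub>R u + c *\<^sub>R v"] near[OF that] hN hN' by (simp add: add.assoc)
      also have "\<dots> \<le> e / N * (h * (norm u + norm v))"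
        using near[OF that] \<open>0 < e\<close> N by (intro mult_left_mono) auto
      finally show ?thesis .
    qed
    have bound: "norm (?G (x + s *\<^sub>R u + h *\<^sub>R v) - ?G (x + s *\<^sub>R u) - h *\<^sub>R ?G' v) \<le> e * h"
      if "s \<in> {0..h}" for s
    proof -
      let ?a = "?G (x + s *\<^sub>R u + h *\<^sub>R v) - ?G x - ?G' (s *\<^sub>R u + h *\<^sub>R v)"
      let ?b = "?G (x + s *\<^sub>R u + 0 *\<^sub>R v) - ?G x - ?G' (s *\<^sub>R u + 0 *\<^sub>R v)"
      have "norm (?G (x + s *\<^sub>R u + h *\<^sub>R v) - ?G (x + s *\<^sub>R u) - h *\<^sub>R ?G' v) = norm (?a - ?b)"
        by (simp add: linear_add[OF linG] linear_scale[OF linG] algebra_simps)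
      also have "\<dots> \<le> e / N * (h * (norm u + norm v)) + e / N * (h * (norm u + norm v))"
        using h by (intro order_trans[OF norm_triangle_ineq4 add_mono[OF G_approx[OF that] G_approx[OF that]]]) auto
      also have "\<dots> = e / N * h * (2 * (norm u + norm v))" by (simp add: algebra_simps)
      also have "\<dots> \<le> e / N * h * N"
        using h N \<open>0 < e\<close> by (intro mult_left_mono) (auto simp: N_def)
      finally show ?thesis using N by simp
    qed
    have "norm (\<phi> h - \<phi> 0) \<le> e * h * norm (h - 0)"
    proof (rule differentiable_bound[of "{0..h}" \<phi> "\<lambda>s t. t *\<^sub>R (?G (x + s *\<^sub>R u + h *\<^sub>R v) - ?G (x + s *\<^sub>R u) - h *\<^sub>R ?G' v)"])
      show "onorm (\<lambda>t. t *\<^sub>R (?G (x + s *\<^sub>R u + h *\<^sub>R v) - ?G (x + s *\<^sub>R u) - h *\<^sub>R ?G' v)) \<le> e * h"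
        if "s \<in> {0..h}" for s
        using bound[OF that] \<open>0 < e\<close> h by (intro onorm_bound) (auto simp: mult.commute[of "\<bar>_\<bar>"] intro!: mult_right_mono)
    qed (use d\<phi> h in \<open>auto simp: has_vector_derivative_def\<close>)
    then show ?thesis using h by (simp add: \<phi>_def algebra_simps)
  qed
  have "0 < min d d' / N" using d d' N by simp
  then have "\<forall>\<^sub>F h in at_right 0. h \<in> {0 <..< min d d' / N}"
    by (rule eventually_at_right_real)
  then show ?thesis by eventually_elim (use bd in auto)
qed

lemma second_derivative_symmetric:
  fixes f :: "'a::euclidean_space \<Rightarrow> 'b::euclidean_space"
  assumes "open S" "x \<in> S" "smooth_on S f"
  shows "frechet_derivative (\<lambda>y. frechet_derivative f (at y) u) (at x) v =
         frechet_derivative (\<lambda>y. frechet_derivative f (at y) v) (at x) u" (is "?a = ?b")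
proof (rule ccontr)
  assume "?a \<noteq> ?b"
  define e where "e = norm (?a - ?b) / 3"
  have "0 < e" using \<open>?a \<noteq> ?b\<close> by (simp add: e_def)
  let ?Q = "\<lambda>h. f (x + h *\<^sub>R u + h *\<^sub>R v) - f (x + h *\<^sub>R u) - f (x + h *\<^sub>R v) + f x"
  have "\<forall>\<^sub>F h in at_right 0. norm (?Q h - (h * h) *\<^sub>R ?a) \<le> e * (h * h) \<and>
      norm (?Q h - (h * h) *\<^sub>R ?b) \<le> e * (h * h) \<and> (0::real) < h"
    using second_difference_approx[OF assms \<open>0 < e\<close>, of u v] second_difference_approx[OF assms \<open>0 < e\<close>, of v u]
    by (auto intro!: eventually_conj simp: algebra_simps eventually_at_right_less)
  then obtain h where h: "norm (?Q h - (h * h) *\<^sub>R ?a) \<le> e * (h * h)"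
      "norm (?Q h - (h * h) *\<^sub>R ?b) \<le> e * (h * h)" "(0::real) < h"
    using eventually_happens trivial_limit_at_right_real by blast
  have "(h * h) *\<^sub>R (?a - ?b) = (?Q h - (h * h) *\<^sub>R ?b) - (?Q h - (h * h) *\<^sub>R ?a)"
    by (simp add: algebra_simps)
  then have "norm ((h * h) *\<^sub>R (?a - ?b)) \<le> e * (h * h) + e * (h * h)"
    using h by (simp only:) (rule order_trans[OF norm_triangle_ineq4 add_mono])
  moreover have "norm ((h * h) *\<^sub>R (?a - ?b)) = (h * h) * norm (?a - ?b)"
    using h by simp
  moreover have "e * (h * h) + e * (h * h) = (h * h) * (2 * e)"
    by simp
  ultimately have "(h * h) * norm (?a - ?b) \<le> (h * h) * (2 * e)"
    by (simp only:)
  then have "norm (?a - ?b) \<le> 2 * e"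
    using h by simp
  then show False using \<open>0 < e\<close> by (simp add: e_def)
qed

text \<open>A change of charts acts on the components \<open>h\<close> of a vector field by \<open>z \<mapsto> Df(z) h(z)\<close>, whence the second
  derivatives in the transformation behaviour of Lie brackets.\<close>

lemma has_derivative_derivative_apply:
  fixes f :: "'a::euclidean_space \<Rightarrow> 'b::euclidean_space"
  assumes S: "open S" "y \<in> S" and f: "smooth_on S f" and h: "(h has_derivative h') (at y)"
  shows "((\<lambda>z. frechet_derivative f (at z) (h z)) has_derivative
    (\<lambda>v. frechet_derivative (\<lambda>z. frechet_derivative f (at z) (h y)) (at y) v
      + frechet_derivative f (at y) (h' v))) (at y)"
proof -
  let ?G = "\<lambda>b z. frechet_derivative f (at z) b"
  have G: "(?G b has_derivative frechet_derivative (?G b) (at y)) (at y)" for b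
    by (rule smooth_on_has_derivative[OF smooth_on_derivative[OF f] S(2)])
  have expand: "((\<lambda>z. ?G (h z) z) has_derivative
      (\<lambda>v. \<Sum>b\<in>Basis. (h y \<bullet> b) *\<^sub>R frechet_derivative (?G b) (at y) v + (h' v \<bullet> b) *\<^sub>R ?G b y)) (at y)"
    if h: "(h has_derivative h') (at y)" for h h'
  proof (rule has_derivative_transform_within_open[OF _ S])
    show "((\<lambda>z. \<Sum>b\<in>Basis. (h z \<bullet> b) *\<^sub>R ?G b z) has_derivative
        (\<lambda>v. \<Sum>b\<in>Basis. (h y \<bullet> b) *\<^sub>R frechet_derivative (?G b) (at y) v + (h' v \<bullet> b) *\<^sub>R ?G b y)) (at y)"
      by (intro has_derivative_sum has_derivative_scaleR has_derivative_inner_left h G)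
    show "(\<Sum>b\<in>Basis. (h z \<bullet> b) *\<^sub>R ?G b z) = ?G (h z) z" if "z \<in> S" for z
      by (rule frechet_derivative_basis_sum[symmetric, OF smooth_on_imp_differentiable[OF f that]])
  qed
  have "frechet_derivative (?G (h y)) (at y) v = (\<Sum>b\<in>Basis. (h y \<bullet> b) *\<^sub>R frechet_derivative (?G b) (at y) v)" for v
    using frechet_derivative_eqI[OF expand[OF has_derivative_const[of "h y"]]] by simp
  moreover have "?G (h' v) y = (\<Sum>b\<in>Basis. (h' v \<bullet> b) *\<^sub>R ?G b y)" for v
    by (rule frechet_derivative_basis_sum[OF smooth_on_imp_differentiable[OF f S(2)]])
  ultimately show ?thesis
    using expand[OF h] by (simp only: sum.distrib)
qed

lemma smooth_on_cutoff:
  fixes g :: "'a::euclidean_space \<Rightarrow> 'b::real_normed_vector"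
  assumes U: "open U" and g: "smooth_on U g" and \<beta>: "smooth_on UNIV \<beta>"
    and K: "closed K" "K \<subseteq> U" "\<And>x. x \<notin> K \<Longrightarrow> \<beta> x = 0"
  shows "smooth_on UNIV (\<lambda>x. \<beta> x *\<^sub>R g x)"
proof (rule smooth_on_open_cover)
  fix x
  have "smooth_on U (\<lambda>x. \<beta> x *\<^sub>R g x)"
    by (rule smooth_on_scaleR[OF U smooth_on_subset[OF \<beta>] g]) auto
  moreover have "smooth_on (- K) (\<lambda>x. \<beta> x *\<^sub>R g x)"
    by (subst smooth_on_cong[of _ _ "\<lambda>_. 0"]) (use K in \<open>auto simp: smooth_on_const\<close>)
  moreover have "x \<in> U \<or> x \<in> - K" using K by auto
  ultimately show "\<exists>V. open V \<and> x \<in> V \<and> smooth_on V (\<lambda>x. \<beta> x *\<^sub>R g x)"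
    using U K(1) by (meson open_Compl)
qed

section \<open>Ordinary differential equations with a Lipschitz right-hand side\<close>

text \<open>All time intervals contain zero and are so short that the Lipschitz constant times the distance from zero
  is at most one half.  Then suprema can be absorbed into the left-hand side, and this replaces Gronwall's inequality.\<close>

lemma vector_derivative_bound:
  fixes R :: "real \<Rightarrow> 'a::real_normed_vector"
  assumes "a \<le> 0" "0 \<le> b" "s \<in> {a..b}"
    and d: "\<And>s. s \<in> {a..b} \<Longrightarrow> (R has_vector_derivative R' s) (at s within {a..b})"
    and B: "\<And>s. s \<in> {a..b} \<Longrightarrow> norm (R' s) \<le> B"
  shows "norm (R s - R 0) \<le> B * \<bar>s\<bar>"
proof -
  have "norm (R s - R 0) \<le> B * norm (s - 0)"
  proof (rule differentiable_bound[of "{a..b}" R "\<lambda>s t. t *\<^sub>R R' s"])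
    show "onorm (\<lambda>t. t *\<^sub>R R' s) \<le> B" if "s \<in> {a..b}" for s
      using B[OF that] order_trans[OF norm_ge_zero B[OF that]]
      by (intro onorm_bound) (auto simp: mult.commute[of "\<bar>_\<bar>"] intro!: mult_right_mono)
  qed (use assms in \<open>auto simp: has_vector_derivative_def\<close>)
  then show ?thesis by simp
qed

lemma ode_bound:
  fixes R :: "real \<Rightarrow> 'a::real_normed_vector"
  assumes ab: "a \<le> 0" "0 \<le> b" "- T \<le> a" "b \<le> T" and "0 \<le> c" "0 \<le> L" "L * T \<le> 1 / 2"
    and d: "\<And>s. s \<in> {a..b} \<Longrightarrow> (R has_vector_derivative R' s) (at s within {a..b})"
    and R': "\<And>s. s \<in> {a..b} \<Longrightarrow> norm (R' s) \<le> c + L * norm (R s)"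
    and s: "s \<in> {a..b}"
  shows "norm (R s) \<le> 2 * (norm (R 0) + c * T)"
proof -
  have "continuous_on {a..b} (\<lambda>s. norm (R s))"
    using d by (intro continuous_on_norm continuous_on_vector_derivative)
  then obtain s0 where s0: "s0 \<in> {a..b}" "\<And>s. s \<in> {a..b} \<Longrightarrow> norm (R s) \<le> norm (R s0)"
    using continuous_attains_sup[of "{a..b}" "\<lambda>s. norm (R s)"] ab by force
  let ?M = "norm (R s0)"
  have "norm (R s0 - R 0) \<le> (c + L * ?M) * \<bar>s0\<bar>"
  proof (rule vector_derivative_bound[OF ab(1,2) s0(1) d])
    show "norm (R' s) \<le> c + L * ?M" if "s \<in> {a..b}" for s
      using R'[OF that] mult_left_mono[OF s0(2)[OF that] \<open>0 \<le> L\<close>] by linarith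
  qed
  also have "\<dots> \<le> (c + L * ?M) * T"
    using s0(1) ab assms by (intro mult_left_mono) (auto simp: abs_le_iff)
  also have "\<dots> = c * T + (L * T) * ?M" by (simp add: algebra_simps)
  also have "\<dots> \<le> c * T + 1 / 2 * ?M"
    using assms by (intro add_left_mono mult_right_mono) auto
  finally have "?M \<le> 2 * (norm (R 0) + c * T)"
    using norm_triangle_sub[of "R s0" "R 0"] by (simp add: algebra_simps)
  then show ?thesis using s0(2)[OF s] by linarith
qed

lemma ode_zero:
  fixes R :: "real \<Rightarrow> 'a::real_normed_vector"
  assumes "a \<le> 0" "0 \<le> b" "- T \<le> a" "b \<le> T" "0 \<le> L" "L * T \<le> 1 / 2"
    and "\<And>s. s \<in> {a..b} \<Longrightarrow> (R has_vector_derivative R' s) (at s within {a..b})"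
    and "\<And>s. s \<in> {a..b} \<Longrightarrow> norm (R' s) \<le> L * norm (R s)"
    and "R 0 = 0" "s \<in> {a..b}"
  shows "R s = 0"
  using ode_bound[of a b T 0 L R R' s] assms by simp

text \<open>The Picard operator acts on bounded continuous functions on the whole line, a complete space, because time
  is clamped to the interval inside it.  Continuity of \<open>f\<close> is required in the form in which it is used: along
  continuous curves.\<close>

lemma ode_exists:
  fixes f :: "real \<Rightarrow> 'a \<Rightarrow> 'a::euclidean_space"
  assumes T: "0 \<le> T" "0 \<le> L" "L * T \<le> 1 / 2"
    and lip: "\<And>s x y. s \<in> {-T..T} \<Longrightarrow> norm (f s x - f s y) \<le> L * norm (x - y)"
    and cont: "\<And>u. continuous_on {-T..T} u \<Longrightarrow> continuous_on {-T..T} (\<lambda>s. f s (u s))"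
  obtains y where "y 0 = y0" "\<And>s. s \<in> {-T..T} \<Longrightarrow> (y has_vector_derivative f s (y s)) (at s within {-T..T})"
proof -
  define cl where "cl t = max (- T) (min T t)" for t :: real
  have cl: "cl t \<in> {-T..T}" "continuous_on UNIV cl" for t
    using T by (auto simp: cl_def intro!: continuous_intros)
  have cl_id: "cl t = t" if "t \<in> {-T..T}" for t
    using that by (auto simp: cl_def)
  define I where "I u t = integral {-T..t} (\<lambda>s. f s (apply_bcontfun u s))" for u t
  have dI: "(I u has_vector_derivative f t (apply_bcontfun u t)) (at t within {-T..T})" if "t \<in> {-T..T}" for u t
    unfolding I_def using that by (intro integral_has_vector_derivative cont) auto
  define P where "P u = Bcontfun (\<lambda>t. y0 + (I u (cl t) - I u 0))" for u
  have P: "apply_bcontfun (P u) t = y0 + (I u (cl t) - I u 0)" for u t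
  proof -
    have cI: "continuous_on {-T..T} (\<lambda>t. y0 + (I u t - I u 0))"
      by (intro continuous_intros continuous_on_vector_derivative[OF dI])
    then have "continuous_on UNIV (\<lambda>t. y0 + (I u (cl t) - I u 0))"
      by (rule continuous_on_compose2) (use cl in auto)
    moreover have "bounded ((\<lambda>t. y0 + (I u t - I u 0)) ` {-T..T})"
      using cI by (intro compact_imp_bounded compact_continuous_image) auto
    then have "bounded (range (\<lambda>t. y0 + (I u (cl t) - I u 0)))"
      by (rule bounded_subset) (use cl in auto)
    ultimately show ?thesis
      unfolding P_def by (subst Bcontfun_inverse) (auto simp: bcontfun_def)
  qed
  have "\<exists>!u. P u = u"
  proof (rule banach_fix_type[of "1 / 2"])
    show "\<forall>u v. dist (P u) (P v) \<le> 1 / 2 * dist u v"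
    proof (intro allI dist_bound)
      fix u v t
      let ?R = "\<lambda>t. I u t - I v t"
      have "norm (?R (cl t) - ?R 0) \<le> (L * dist u v) * \<bar>cl t\<bar>"
      proof (rule vector_derivative_bound[of "- T" T _ ?R "\<lambda>s. f s (apply_bcontfun u s) - f s (apply_bcontfun v s)"])
        show "norm (f s (apply_bcontfun u s) - f s (apply_bcontfun v s)) \<le> L * dist u v" if "s \<in> {-T..T}" for s
          using lip[OF that, of "apply_bcontfun u s" "apply_bcontfun v s"]
            mult_left_mono[OF dist_bounded[of u s v] \<open>0 \<le> L\<close>] by (simp add: dist_norm)
      qed (use T cl dI in \<open>auto intro!: derivative_intros\<close>)
      also have "\<dots> \<le> (L * dist u v) * T"
        using cl(1)[of t] T by (intro mult_left_mono) (auto simp: abs_le_iff)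
      also have "\<dots> = (L * T) * dist u v" by simp
      also have "\<dots> \<le> 1 / 2 * dist u v"
        using T by (intro mult_right_mono) auto
      finally show "dist (apply_bcontfun (P u) t) (apply_bcontfun (P v) t) \<le> 1 / 2 * dist u v"
        by (simp add: P dist_norm algebra_simps)
    qed
  qed auto
  then obtain u where u: "P u = u" by blast
  have eq: "apply_bcontfun u t = y0 + (I u t - I u 0)" if "t \<in> {-T..T}" for t
    using P[of u t] u that by (simp add: cl_id)
  show thesis
  proof
    show "apply_bcontfun u 0 = y0" using eq[of 0] T by simp
    show "(apply_bcontfun u has_vector_derivative f s (apply_bcontfun u s)) (at s within {-T..T})"
      if "s \<in> {-T..T}" for s
    proof (rule has_vector_derivative_transform[OF that])
      show "apply_bcontfun u t = y0 + (I u t - I u 0)" if "t \<in> {-T..T}" for t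
        using eq[OF that] .
      show "((\<lambda>t. y0 + (I u t - I u 0)) has_vector_derivative f s (apply_bcontfun u s)) (at s within {-T..T})"
        using dI[OF that, of u] by (auto intro!: derivative_eq_intros)
    qed
  qed
qed

text \<open>The derivative of the flow with respect to the initial point solves the linearised equation
  \<open>u' = F'(Y) u\<close>, and its expansion at time zero is \<open>v + s F'(x) v + O(s\<^sup>2)\<close>, uniformly in \<open>x\<close>.
  Both remainders are quadratic because \<open>F'\<close> is Lipschitz.\<close>

lemma flow_has_derivative:
  fixes F :: "'a::euclidean_space \<Rightarrow> 'a"
  assumes T: "0 \<le> T" "L * T \<le> 1 / 2" and nn: "0 \<le> L" "0 \<le> K" "0 \<le> B"
    and dF: "\<And>x. (F has_derivative F' x) (at x)"
    and F'_bound: "\<And>x v. norm (F' x v) \<le> L * norm v"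
    and F'_lip: "\<And>x y v. norm (F' x v - F' y v) \<le> K * norm (x - y) * norm v"
    and F_bound: "\<And>x. norm (F x) \<le> B"
    and Y0: "\<And>x. Y x 0 = x"
    and dY: "\<And>x s. s \<in> {-T..T} \<Longrightarrow> (Y x has_vector_derivative F (Y x s)) (at s within {-T..T})"
  obtains U C where "0 \<le> C" "\<And>x s. s \<in> {-T..T} \<Longrightarrow> ((\<lambda>x. Y x s) has_derivative U s x) (at x)"
    "\<And>x s v. s \<in> {-T..T} \<Longrightarrow> norm (U s x v - v - s *\<^sub>R F' x v) \<le> C * s\<^sup>2 * norm v"
proof -
  have F'_linear: "linear (F' x)" for x
    using dF by (rule has_derivative_linear)
  have F_lip: "norm (F x - F y) \<le> L * norm (x - y)" for x y
    by (rule differentiable_bound[OF convex_UNIV dF]) (auto intro!: onorm_bound F'_bound nn)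
  have remainder: "norm (F z - F x - F' x (z - x)) \<le> K * (norm (z - x))\<^sup>2" for x z
  proof -
    have "norm (F z - F x - F' x (z - x)) \<le> norm (z - x) * (K * norm (z - x))"
    proof (rule differentiable_bound_linearization[where f' = F' and ?x0.0 = x and S = "{p. norm (p - x) \<le> norm (z - x)}"])
      show "x + t *\<^sub>R (z - x) \<in> {p. norm (p - x) \<le> norm (z - x)}" if "t \<in> {0..1}" for t
        using that by (auto simp: mult_left_le_one_le)
      show "onorm (F' p - F' x) \<le> K * norm (z - x)" if "p \<in> {p. norm (p - x) \<le> norm (z - x)}" for p
      proof (rule onorm_bound)
        fix v
        have "norm ((F' p - F' x) v) \<le> K * norm (p - x) * norm v"
          unfolding fun_diff_def by (rule F'_lip)
        also have "\<dots> \<le> K * norm (z - x) * norm v"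
          using that nn by (intro mult_right_mono mult_left_mono) auto
        finally show "norm ((F' p - F' x) v) \<le> K * norm (z - x) * norm v" .
      qed (use nn in auto)
    qed (auto intro: has_derivative_at_withinI dF)
    then show ?thesis by (simp add: power2_eq_square mult_ac)
  qed
  have cF': "continuous_on S (\<lambda>s. F' (p s) (u s))"
    if "continuous_on S p" "continuous_on S u" for S :: "real set" and p u
  proof -
    have "continuous_on UNIV (\<lambda>p. F' p b)" for b
      unfolding continuous_on_iff
    proof (intro ballI allI impI)
      fix x and e :: real assume "0 < e"
      have "dist (F' y b) (F' x b) < e" if "dist y x < e / (K * norm b + 1)" for y
      proof -
        have "0 < K * norm b + 1" using nn by (simp add: add_nonneg_pos)
        then have "(K * norm b + 1) * dist y x < e"
          using that by (simp add: field_simps)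
        moreover have "dist (F' y b) (F' x b) \<le> K * norm b * dist y x"
          using F'_lip[of y b x] by (simp add: dist_norm mult_ac)
        moreover have "K * norm b * dist y x \<le> (K * norm b + 1) * dist y x"
          by (simp add: algebra_simps)
        ultimately show ?thesis by linarith
      qed
      moreover have "0 < e / (K * norm b + 1)"
        using \<open>0 < e\<close> nn by (simp add: add_nonneg_pos)
      ultimately show "\<exists>d>0. \<forall>x'\<in>UNIV. dist x' x < d \<longrightarrow> dist (F' x' b) (F' x b) < e"
        by blast
    qed
    then have "continuous_on S (\<lambda>s. \<Sum>b\<in>Basis. (u s \<bullet> b) *\<^sub>R F' (p s) b)"
      by (intro continuous_on_sum continuous_on_scaleR continuous_on_inner continuous_on_const that
          continuous_on_compose2[of UNIV "\<lambda>p. F' p b" S p for b] subset_UNIV)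
    moreover have "(\<Sum>b\<in>Basis. (v \<bullet> b) *\<^sub>R F' p b) = F' p v" for p v
    proof -
      have "F' p (\<Sum>b\<in>Basis. (v \<bullet> b) *\<^sub>R b) = (\<Sum>b\<in>Basis. (v \<bullet> b) *\<^sub>R F' p b)"
        by (simp add: linear_sum[OF F'_linear] linear_scale[OF F'_linear] del: euclidean_representation)
      then show ?thesis by (simp add: euclidean_representation)
    qed
    ultimately show ?thesis by simp
  qed
  have cY: "continuous_on {-T..T} (Y x)" for x
    by (rule continuous_on_vector_derivative[OF dY])
  have "\<exists>u. u 0 = v \<and> (\<forall>s\<in>{-T..T}. (u has_vector_derivative F' (Y x s) (u s)) (at s within {-T..T}))" for x v
  proof (rule ode_exists[OF T(1) nn(1) T(2), where f = "\<lambda>s. F' (Y x s)" and ?y0.0 = v])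
    show "norm (F' (Y x s) v - F' (Y x s) w) \<le> L * norm (v - w)" for s v w
      using F'_bound[of "Y x s" "v - w"] by (simp add: linear_diff[OF F'_linear])
  qed (use cF'[OF cY] in blast)+
  then have "\<forall>x v. \<exists>u. u 0 = v \<and> (\<forall>s\<in>{-T..T}. (u has_vector_derivative F' (Y x s) (u s)) (at s within {-T..T}))"
    by blast
  then obtain u where u: "\<forall>x v. u x v 0 = v \<and>
      (\<forall>s\<in>{-T..T}. (u x v has_vector_derivative F' (Y x s) (u x v s)) (at s within {-T..T}))"
    unfolding choice_iff by blast
  then have u0: "\<And>x v. u x v 0 = v" and
    du: "\<And>x v s. s \<in> {-T..T} \<Longrightarrow> (u x v has_vector_derivative F' (Y x s) (u x v s)) (at s within {-T..T})"
    by blast+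
  note bound = ode_bound[of "- T" T T] and zero = ode_zero[of "- T" T T L]
  have u_bound: "norm (u x v s) \<le> 2 * norm v" if "s \<in> {-T..T}" for x v s
    using bound[where c = 0, OF _ _ _ _ _ nn(1) T(2) du, of x v s] that T F'_bound by (auto simp: u0)
  have u_add: "u x (v + w) s = u x v s + u x w s" if "s \<in> {-T..T}" for x v w s
  proof -
    have "u x (v + w) s - (u x v s + u x w s) = 0"
    proof (rule zero[where s = s and R = "\<lambda>s. u x (v + w) s - (u x v s + u x w s)"
          and R' = "\<lambda>s. F' (Y x s) (u x (v + w) s - (u x v s + u x w s))"])
      show "((\<lambda>s. u x (v + w) s - (u x v s + u x w s)) has_vector_derivative
          F' (Y x s) (u x (v + w) s - (u x v s + u x w s))) (at s within {-T..T})" if "s \<in> {-T..T}" for s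
        using du[OF that] by (auto intro!: derivative_eq_intros simp: linear_diff[OF F'_linear] linear_add[OF F'_linear])
    qed (use that T nn F'_bound in \<open>auto simp: u0\<close>)
    then show ?thesis by simp
  qed
  have u_scale: "u x (r *\<^sub>R v) s = r *\<^sub>R u x v s" if "s \<in> {-T..T}" for x r v s
  proof -
    have "u x (r *\<^sub>R v) s - r *\<^sub>R u x v s = 0"
    proof (rule zero[where s = s and R = "\<lambda>s. u x (r *\<^sub>R v) s - r *\<^sub>R u x v s"
          and R' = "\<lambda>s. F' (Y x s) (u x (r *\<^sub>R v) s - r *\<^sub>R u x v s)"])
      show "((\<lambda>s. u x (r *\<^sub>R v) s - r *\<^sub>R u x v s) has_vector_derivative
          F' (Y x s) (u x (r *\<^sub>R v) s - r *\<^sub>R u x v s)) (at s within {-T..T})" if "s \<in> {-T..T}" for s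
        using du[OF that] by (auto intro!: derivative_eq_intros simp: linear_diff[OF F'_linear] linear_scale[OF F'_linear])
    qed (use that T nn F'_bound in \<open>auto simp: u0\<close>)
    then show ?thesis by simp
  qed
  have Y_lip: "norm (Y z s - Y x s) \<le> 2 * norm (z - x)" if "s \<in> {-T..T}" for z x s
  proof -
    have d: "((\<lambda>s. Y z s - Y x s) has_vector_derivative F (Y z s) - F (Y x s)) (at s within {-T..T})"
      if "s \<in> {-T..T}" for s
      by (intro derivative_intros dY that)
    show ?thesis
      using bound[where c = 0 and L = L, OF _ _ _ _ _ _ _ d, of s] that T nn F_lip by (auto simp: Y0)
  qed
  have linearised: "norm (Y z s - Y x s - u x (z - x) s) \<le> 8 * K * T * (norm (z - x))\<^sup>2"
    if "s \<in> {-T..T}" for z x s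
  proof -
    have "norm (Y z s - Y x s - u x (z - x) s) \<le>
        2 * (norm (Y z 0 - Y x 0 - u x (z - x) 0) + (K * (2 * norm (z - x))\<^sup>2) * T)"
    proof (rule bound[where L = L and R = "\<lambda>s. Y z s - Y x s - u x (z - x) s" and s = s
          and R' = "\<lambda>s. F (Y z s) - F (Y x s) - F' (Y x s) (u x (z - x) s)"])
      fix s assume s: "s \<in> {-T..T}"
      show "((\<lambda>s. Y z s - Y x s - u x (z - x) s) has_vector_derivative
          F (Y z s) - F (Y x s) - F' (Y x s) (u x (z - x) s)) (at s within {-T..T})"
        by (intro derivative_intros dY du s)
      have "F (Y z s) - F (Y x s) - F' (Y x s) (u x (z - x) s) =
          (F (Y z s) - F (Y x s) - F' (Y x s) (Y z s - Y x s)) + F' (Y x s) (Y z s - Y x s - u x (z - x) s)"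
        by (simp add: linear_diff[OF F'_linear])
      moreover have "norm (F (Y z s) - F (Y x s) - F' (Y x s) (Y z s - Y x s)) \<le> K * (2 * norm (z - x))\<^sup>2"
        using Y_lip[OF s] nn by (intro order_trans[OF remainder] mult_left_mono power_mono) auto
      ultimately show "norm (F (Y z s) - F (Y x s) - F' (Y x s) (u x (z - x) s)) \<le>
          K * (2 * norm (z - x))\<^sup>2 + L * norm (Y z s - Y x s - u x (z - x) s)"
        using F'_bound by (metis add_mono norm_triangle_mono)
    qed (use that T nn in auto)
    then show ?thesis by (simp add: Y0 u0 power_mult_distrib mult_ac)
  qed
  show thesis
  proof
    show "0 \<le> 2 * K * B + 2 * L\<^sup>2" using nn by simp
  next
    fix x s assume s: "s \<in> {-T..T}"
    have "linear (\<lambda>v. u x v s)"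
      by (rule linearI) (rule u_add[OF s] u_scale[OF s])+
    then have "bounded_linear (\<lambda>v. u x v s)"
      by (simp add: linear_conv_bounded_linear)
    moreover have "\<exists>d>0. \<forall>z. norm (z - x) < d \<longrightarrow> norm (Y z s - Y x s - u x (z - x) s) \<le> e * norm (z - x)"
      if "0 < e" for e
    proof (intro exI conjI allI impI)
      have pos: "0 < 8 * K * T + 1" using nn T by (simp add: add_nonneg_pos)
      then show "0 < e / (8 * K * T + 1)" using that by simp
      fix z assume "norm (z - x) < e / (8 * K * T + 1)"
      then have "(8 * K * T + 1) * norm (z - x) < e"
        using pos by (simp add: field_simps)
      then have "8 * K * T * norm (z - x) \<le> e"
        using norm_ge_zero[of "z - x"] unfolding distrib_right by linarith
      then have "8 * K * T * norm (z - x) * norm (z - x) \<le> e * norm (z - x)"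
        by (intro mult_right_mono) auto
      then show "norm (Y z s - Y x s - u x (z - x) s) \<le> e * norm (z - x)"
        using linearised[OF s, of z x] by (simp add: power2_eq_square mult.assoc)
    qed
    ultimately show "((\<lambda>x. Y x s) has_derivative (\<lambda>v. u x v s)) (at x)"
      unfolding has_derivative_at_alt by blast
  next
    fix x s v assume s: "s \<in> {-T..T}"
    let ?c = "\<bar>s\<bar>"
    have c: "- ?c \<le> 0" "0 \<le> ?c" "s \<in> {- ?c .. ?c}" "{- ?c .. ?c} \<subseteq> {-T..T}"
      using s by auto
    have dY': "(Y x has_vector_derivative F (Y x r)) (at r within {- ?c .. ?c})"
      and du': "(u x v has_vector_derivative F' (Y x r) (u x v r)) (at r within {- ?c .. ?c})"
      if "r \<in> {- ?c .. ?c}" for r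
      by (rule has_vector_derivative_within_subset[OF dY c(4)] has_vector_derivative_within_subset[OF du c(4)],
          use that c(4) in blast)+
    have "norm ((u x v s - v - s *\<^sub>R F' x v) - (u x v 0 - v - 0 *\<^sub>R F' x v)) \<le> ((2 * K * B + 2 * L\<^sup>2) * ?c * norm v) * ?c"
    proof (rule vector_derivative_bound[OF c(1-3), where R = "\<lambda>s. u x v s - v - s *\<^sub>R F' x v"
          and R' = "\<lambda>s. F' (Y x s) (u x v s) - F' x v"])
      fix r assume r: "r \<in> {- ?c .. ?c}"
      then have rT: "r \<in> {-T..T}" and rc: "\<bar>r\<bar> \<le> ?c" using c(4) by auto
      show "((\<lambda>s. u x v s - v - s *\<^sub>R F' x v) has_vector_derivative F' (Y x r) (u x v r) - F' x v)
          (at r within {- ?c .. ?c})"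
        using du'[OF r] by (auto intro!: derivative_eq_intros)
      have Yx: "norm (Y x r - x) \<le> B * ?c"
        using vector_derivative_bound[OF c(1,2) r dY' F_bound] mult_left_mono[OF rc nn(3)] by (simp add: Y0)
      have "norm (u x v r - v) \<le> (L * (2 * norm v)) * \<bar>r\<bar>"
      proof -
        have "norm (F' (Y x r) (u x v r)) \<le> L * (2 * norm v)" if "r \<in> {- ?c .. ?c}" for r
          using that c(4) by (intro order_trans[OF F'_bound] mult_left_mono u_bound nn) auto
        from vector_derivative_bound[OF c(1,2) r du' this] show ?thesis by (simp add: u0)
      qed
      also have "\<dots> \<le> (L * (2 * norm v)) * ?c"
        using rc nn by (intro mult_left_mono) auto
      finally have uv: "norm (u x v r - v) \<le> (L * (2 * norm v)) * ?c" .
      have "F' (Y x r) (u x v r) - F' x v = (F' (Y x r) (u x v r) - F' x (u x v r)) + F' x (u x v r - v)"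
        by (simp add: linear_diff[OF F'_linear])
      then have "norm (F' (Y x r) (u x v r) - F' x v) \<le> K * norm (Y x r - x) * norm (u x v r) + L * norm (u x v r - v)"
        by (metis norm_triangle_mono F'_lip F'_bound)
      also have "\<dots> \<le> K * (B * ?c) * (2 * norm v) + L * ((L * (2 * norm v)) * ?c)"
        using Yx uv u_bound[OF rT] nn by (intro add_mono mult_mono mult_nonneg_nonneg) auto
      finally show "norm (F' (Y x r) (u x v r) - F' x v) \<le> (2 * K * B + 2 * L\<^sup>2) * ?c * norm v"
        by (simp add: algebra_simps power2_eq_square)
    qed
    then show "norm (u x v s - v - s *\<^sub>R F' x v) \<le> (2 * K * B + 2 * L\<^sup>2) * s\<^sup>2 * norm v"
      by (simp add: u0 power2_eq_square mult_ac flip: abs_mult)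
  qed
qed

section \<open>Tangent vectors in charts\<close>

locale smooth_manifold =
  fixes A :: "('m::t2_space, 'e::euclidean_space) chart set"
  assumes atlas: "smooth_atlas A"
begin

lemma
  assumes "C \<in> A"
  shows open_chart_dom: "open (chart_dom C)"
    and open_chart_img: "open (chart_img C)"
    and chart_homeomorphism: "homeomorphism (chart_dom C) (chart_img C) (chart_map C) (chart_inv C)"
  using atlas assms by (auto simp: smooth_atlas_def)

lemma chart_map_inv: "C \<in> A \<Longrightarrow> x \<in> chart_img C \<Longrightarrow> chart_map C (chart_inv C x) = x"
  by (rule homeomorphism_apply2[OF chart_homeomorphism])

lemma chart_inv_map: "C \<in> A \<Longrightarrow> p \<in> chart_dom C \<Longrightarrow> chart_inv C (chart_map C p) = p"
  by (rule homeomorphism_apply1[OF chart_homeomorphism])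

lemma chart_map_in: "p \<in> chart_dom C \<Longrightarrow> chart_map C p \<in> chart_img C"
  by (simp add: chart_img_def)

lemma chart_inv_in: "C \<in> A \<Longrightarrow> x \<in> chart_img C \<Longrightarrow> chart_inv C x \<in> chart_dom C"
  using homeomorphism_image2[OF chart_homeomorphism] by blast

lemma continuous_on_chart_inv: "C \<in> A \<Longrightarrow> continuous_on (chart_img C) (chart_inv C)"
  using chart_homeomorphism homeomorphism_def by metis

lemma continuous_on_chart_map: "C \<in> A \<Longrightarrow> continuous_on (chart_dom C) (chart_map C)"
  using chart_homeomorphism homeomorphism_def by metis

lemma chart_at: "chart_at A p \<in> A" "p \<in> chart_dom (chart_at A p)"
proof -
  have "\<exists>C. C \<in> A \<and> p \<in> chart_dom C"
    using atlas by (force simp: smooth_atlas_def)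
  then have "chart_at A p \<in> A \<and> p \<in> chart_dom (chart_at A p)"
    unfolding chart_at_def by (rule someI_ex)
  then show "chart_at A p \<in> A" "p \<in> chart_dom (chart_at A p)" by auto
qed

definition overlap :: "('m, 'e) chart \<Rightarrow> ('m, 'e) chart \<Rightarrow> 'e set" where
  "overlap C D = chart_map C ` (chart_dom C \<inter> chart_dom D)"

definition transition :: "('m, 'e) chart \<Rightarrow> ('m, 'e) chart \<Rightarrow> 'e \<Rightarrow> 'e" where
  "transition C D = chart_map D \<circ> chart_inv C"

lemma overlap_iff: "C \<in> A \<Longrightarrow> x \<in> overlap C D \<longleftrightarrow> x \<in> chart_img C \<and> chart_inv C x \<in> chart_dom D"
proof
  assume C: "C \<in> A"
  show "x \<in> overlap C D \<Longrightarrow> x \<in> chart_img C \<and> chart_inv C x \<in> chart_dom D"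
    using C by (auto simp: overlap_def chart_map_in chart_inv_map)
  show "x \<in> overlap C D" if "x \<in> chart_img C \<and> chart_inv C x \<in> chart_dom D"
    unfolding overlap_def using that C
    by (intro image_eqI[of _ _ "chart_inv C x"]) (auto simp: chart_map_inv chart_inv_in)
qed

lemma chart_map_in_overlap: "p \<in> chart_dom C \<Longrightarrow> p \<in> chart_dom D \<Longrightarrow> chart_map C p \<in> overlap C D"
  by (auto simp: overlap_def)

lemma open_overlap: "C \<in> A \<Longrightarrow> D \<in> A \<Longrightarrow> open (overlap C D)"
proof -
  assume "C \<in> A" "D \<in> A"
  then have "open (chart_img C \<inter> chart_inv C -` chart_dom D)"
    by (intro continuous_open_preimage continuous_on_chart_inv open_chart_img open_chart_dom)
  moreover have "overlap C D = chart_img C \<inter> chart_inv C -` chart_dom D"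
    using overlap_iff[OF \<open>C \<in> A\<close>] by (simp add: set_eq_iff)
  ultimately show ?thesis by simp
qed

lemma smooth_on_transition: "C \<in> A \<Longrightarrow> D \<in> A \<Longrightarrow> smooth_on (overlap C D) (transition C D)"
  using atlas by (auto simp: smooth_atlas_def overlap_def transition_def)

lemma transition_chart_map: "C \<in> A \<Longrightarrow> p \<in> chart_dom C \<Longrightarrow> transition C D (chart_map C p) = chart_map D p"
  by (simp add: transition_def chart_inv_map)

lemma transition_in_overlap: "C \<in> A \<Longrightarrow> D \<in> A \<Longrightarrow> x \<in> overlap C D \<Longrightarrow> transition C D x \<in> overlap D C"
  by (auto simp: overlap_def transition_chart_map)

lemma transition_transition: "C \<in> A \<Longrightarrow> D \<in> A \<Longrightarrow> x \<in> overlap C D \<Longrightarrow> transition D E (transition C D x) = transition C E x"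
  by (auto simp: overlap_def transition_chart_map)

abbreviation dtrans :: "('m, 'e) chart \<Rightarrow> ('m, 'e) chart \<Rightarrow> 'm \<Rightarrow> 'e \<Rightarrow> 'e" where
  "dtrans C D p \<equiv> frechet_derivative (transition C D) (at (chart_map C p))"

lemma transition_has_derivative:
  assumes "C \<in> A" "D \<in> A" "p \<in> chart_dom C" "p \<in> chart_dom D"
  shows "(transition C D has_derivative dtrans C D p) (at (chart_map C p))"
  using smooth_on_has_derivative[OF smooth_on_transition] chart_map_in_overlap assms by blast

lemma linear_dtrans:
  assumes "C \<in> A" "D \<in> A" "p \<in> chart_dom C" "p \<in> chart_dom D"
  shows "linear (dtrans C D p)"
  using transition_has_derivative[OF assms] has_derivative_linear by blast

lemma dtrans_dtrans:
  assumes A: "C \<in> A" "D \<in> A" "E \<in> A" and p: "p \<in> chart_dom C" "p \<in> chart_dom D" "p \<in> chart_dom E"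
  shows "dtrans D E p (dtrans C D p v) = dtrans C E p v"
proof -
  have "((\<lambda>x. transition D E (transition C D x)) has_derivative (\<lambda>v. dtrans D E p (dtrans C D p v)))
      (at (chart_map C p))"
    by (rule has_derivative_compose[OF transition_has_derivative[OF A(1,2) p(1,2)]])
      (simp add: transition_chart_map A p transition_has_derivative)
  then have "(transition C E has_derivative (\<lambda>v. dtrans D E p (dtrans C D p v))) (at (chart_map C p))"
    by (rule has_derivative_transform_within_open[OF _ open_overlap[OF A(1,2)] chart_map_in_overlap[OF p(1,2)]])
      (simp add: transition_transition A)
  then show ?thesis
    by (simp add: frechet_derivative_eqI)
qed

lemma dtrans_self:
  assumes "C \<in> A" "p \<in> chart_dom C"
  shows "dtrans C C p v = v"
proof -
  have "((\<lambda>x. x) has_derivative (\<lambda>v. v)) (at (chart_map C p))" by (rule has_derivative_ident)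
  then have "(transition C C has_derivative (\<lambda>v. v)) (at (chart_map C p))"
    by (rule has_derivative_transform_within_open[OF _ open_chart_img[OF assms(1)] chart_map_in[OF assms(2)]])
      (simp add: transition_def chart_map_inv assms)
  then show ?thesis by (simp add: frechet_derivative_eqI)
qed

text \<open>Both coordinate maps are derivatives of transition maps from or to the preferred chart, so that their rules
  are instances of the chain rule.\<close>

lemma to_coord_eq_dtrans: "to_coord A C p = dtrans (chart_at A p) C p"
  by (simp add: fun_eq_iff to_coord_def transition_def)

lemma from_coord_eq_dtrans: "from_coord A C p = dtrans C (chart_at A p) p"
  by (simp add: fun_eq_iff from_coord_def transition_def)

lemma to_coord_change:
  assumes "C \<in> A" "D \<in> A" "p \<in> chart_dom C" "p \<in> chart_dom D"
  shows "to_coord A D p v = dtrans C D p (to_coord A C p v)"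
  using assms chart_at by (simp add: to_coord_eq_dtrans dtrans_dtrans)

lemma linear_to_coord: "C \<in> A \<Longrightarrow> p \<in> chart_dom C \<Longrightarrow> linear (to_coord A C p)"
  using chart_at by (simp add: to_coord_eq_dtrans linear_dtrans)

lemma linear_from_coord: "C \<in> A \<Longrightarrow> p \<in> chart_dom C \<Longrightarrow> linear (from_coord A C p)"
  using chart_at by (simp add: from_coord_eq_dtrans linear_dtrans)

lemma to_from_coord: "C \<in> A \<Longrightarrow> p \<in> chart_dom C \<Longrightarrow> to_coord A C p (from_coord A C p u) = u"
  using chart_at by (simp add: to_coord_eq_dtrans from_coord_eq_dtrans dtrans_dtrans dtrans_self)

lemma from_to_coord: "C \<in> A \<Longrightarrow> p \<in> chart_dom C \<Longrightarrow> from_coord A C p (to_coord A C p v) = v"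
  using chart_at by (simp add: to_coord_eq_dtrans from_coord_eq_dtrans dtrans_dtrans dtrans_self)

lemma to_coord_eq_iff:
  "C \<in> A \<Longrightarrow> p \<in> chart_dom C \<Longrightarrow> to_coord A C p v = to_coord A C p w \<longleftrightarrow> v = w"
  by (metis from_to_coord)

lemma to_coord_chart_at: "to_coord A (chart_at A p) p v = v"
  using chart_at by (simp add: to_coord_eq_dtrans dtrans_self)

lemma from_coord_chart_at: "from_coord A (chart_at A p) p v = v"
  using chart_at by (simp add: from_coord_eq_dtrans dtrans_self)

lemma vf_coord_chart_map: "C \<in> A \<Longrightarrow> p \<in> chart_dom C \<Longrightarrow> vf_coord A C X (chart_map C p) = to_coord A C p (X p)"
  by (simp add: vf_coord_def chart_inv_map)

lemma from_coord_vf_coord: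
  "C \<in> A \<Longrightarrow> p \<in> chart_dom C \<Longrightarrow> from_coord A C p (vf_coord A C X (chart_map C p)) = X p"
  by (simp add: vf_coord_chart_map from_to_coord)

lemma vf_coord_add:
  "C \<in> A \<Longrightarrow> x \<in> chart_img C \<Longrightarrow> vf_coord A C (\<lambda>p. X p + Y p) x = vf_coord A C X x + vf_coord A C Y x"
  by (simp add: vf_coord_def linear_add[OF linear_to_coord] chart_inv_in)

lemma vf_coord_scaleR:
  "C \<in> A \<Longrightarrow> x \<in> chart_img C \<Longrightarrow>
    vf_coord A C (\<lambda>p. f p *\<^sub>R X p) x = (f \<circ> chart_inv C) x *\<^sub>R vf_coord A C X x"
  by (simp add: vf_coord_def linear_scale[OF linear_to_coord] chart_inv_in)

lemma smooth_vfD: "smooth_vf A X \<Longrightarrow> C \<in> A \<Longrightarrow> smooth_on (chart_img C) (vf_coord A C X)"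
  by (simp add: smooth_vf_def)

lemma smooth_vf_add: "smooth_vf A X \<Longrightarrow> smooth_vf A Y \<Longrightarrow> smooth_vf A (\<lambda>p. X p + Y p)"
  unfolding smooth_vf_def
  by (auto simp: smooth_on_cong[OF open_chart_img vf_coord_add] intro!: smooth_on_add open_chart_img)

lemma smooth_vf_scaleR: "smooth_fun A f \<Longrightarrow> smooth_vf A X \<Longrightarrow> smooth_vf A (\<lambda>p. f p *\<^sub>R X p)"
  unfolding smooth_vf_def smooth_fun_def
  by (simp add: smooth_on_cong[OF open_chart_img vf_coord_scaleR] smooth_on_scaleR open_chart_img del: o_apply)

lemma smooth_fun_const: "smooth_fun A (\<lambda>p. c)"
  by (simp add: smooth_fun_def o_def smooth_on_const)

lemma smooth_vf_sum:
  assumes "finite I" "\<And>i. i \<in> I \<Longrightarrow> smooth_vf A (X i)"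
  shows "smooth_vf A (\<lambda>p. \<Sum>i\<in>I. X i p)"
  using assms
proof (induction I rule: finite_induct)
  case empty
  have "smooth_on (chart_img C) (vf_coord A C (\<lambda>p. 0))" if "C \<in> A" for C
    by (subst smooth_on_cong[OF open_chart_img[OF that], of _ "\<lambda>_. 0"])
      (auto simp: vf_coord_def linear_0[OF linear_to_coord] that chart_inv_in smooth_on_const)
  then show ?case by (simp add: smooth_vf_def)
qed (auto intro: smooth_vf_add)

lemma dfun_chart:
  assumes C: "C \<in> A" "p \<in> chart_dom C" and f: "(f \<circ> chart_inv C) differentiable (at (chart_map C p))"
  shows "dfun A f p v = frechet_derivative (f \<circ> chart_inv C) (at (chart_map C p)) (to_coord A C p v)"
proof -
  let ?D = "chart_at A p"
  note D = chart_at[of p]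
  have "((\<lambda>x. (f \<circ> chart_inv C) (transition ?D C x)) has_derivative
      (\<lambda>v. frechet_derivative (f \<circ> chart_inv C) (at (chart_map C p)) (dtrans ?D C p v))) (at (chart_map ?D p))"
    by (rule has_derivative_compose[OF transition_has_derivative[OF D(1) C(1) D(2) C(2)]])
      (simp add: transition_chart_map D frechet_derivative_works[symmetric] f del: o_apply)
  then have "((f \<circ> chart_inv ?D) has_derivative
      (\<lambda>v. frechet_derivative (f \<circ> chart_inv C) (at (chart_map C p)) (dtrans ?D C p v))) (at (chart_map ?D p))"
    by (rule has_derivative_transform_within_open[OF _ open_overlap[OF D(1) C(1)] chart_map_in_overlap[OF D(2) C(2)]])
      (auto simp: overlap_def transition_chart_map chart_inv_map C D)
  then show ?thesis
    by (simp add: dfun_def frechet_derivative_eqI to_coord_eq_dtrans)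
qed

subsection \<open>Velocities and tangent maps\<close>

lemma eventually_in_chart_dom:
  assumes "C \<in> A" "continuous (at t within I) c" "c t \<in> chart_dom C"
  shows "\<forall>\<^sub>F s in at t within I. c s \<in> chart_dom C"
  using topological_tendstoD[OF assms(2)[unfolded continuous_within] open_chart_dom[OF assms(1)] assms(3)] .

lemma curve_derivative_change:
  assumes A: "C \<in> A" "D \<in> A" "c t \<in> chart_dom C" "c t \<in> chart_dom D" and t: "t \<in> I"
    and c: "continuous (at t within I) c"
    and d: "((\<lambda>s. chart_map C (c s)) has_vector_derivative w) (at t within I)"
  shows "((\<lambda>s. chart_map D (c s)) has_vector_derivative dtrans C D (c t) w) (at t within I)"
proof -
  have "((\<lambda>s. transition C D (chart_map C (c s))) has_derivative (\<lambda>h. dtrans C D (c t) (h *\<^sub>R w))) (at t within I)"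
    by (rule has_derivative_compose[OF d[unfolded has_vector_derivative_def] transition_has_derivative[OF A]])
  then have "((\<lambda>s. chart_map D (c s)) has_derivative (\<lambda>h. dtrans C D (c t) (h *\<^sub>R w))) (at t within I)"
  proof (rule has_derivative_transform_eventually)
    show "\<forall>\<^sub>F s in at t within I. transition C D (chart_map C (c s)) = chart_map D (c s)"
      using eventually_in_chart_dom[OF A(1) c A(3)]
      by eventually_elim (simp add: transition_chart_map A)
  qed (use A t in \<open>auto simp: transition_chart_map\<close>)
  then show ?thesis
    by (simp add: has_vector_derivative_def linear_scale[OF linear_dtrans[OF A]])
qed

lemma has_velocity_iff:
  assumes C: "C \<in> A" "c t \<in> chart_dom C" and t: "t \<in> I"
  shows "has_velocity A c u t I \<longleftrightarrow> continuous (at t within I) c \<and>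
    ((\<lambda>s. chart_map C (c s)) has_vector_derivative to_coord A C (c t) u) (at t within I)"
proof -
  let ?D = "chart_at A (c t)"
  note D = chart_at[of "c t"]
  have "((\<lambda>s. chart_map ?D (c s)) has_vector_derivative u) (at t within I) \<longleftrightarrow>
      ((\<lambda>s. chart_map C (c s)) has_vector_derivative to_coord A C (c t) u) (at t within I)"
    if c: "continuous (at t within I) c"
  proof
    assume "((\<lambda>s. chart_map ?D (c s)) has_vector_derivative u) (at t within I)"
    from curve_derivative_change[OF D(1) C(1) D(2) C(2) t c this]
    show "((\<lambda>s. chart_map C (c s)) has_vector_derivative to_coord A C (c t) u) (at t within I)"
      by (simp add: to_coord_eq_dtrans)
  next
    assume "((\<lambda>s. chart_map C (c s)) has_vector_derivative to_coord A C (c t) u) (at t within I)"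
    from curve_derivative_change[OF C(1) D(1) C(2) D(2) t c this]
    show "((\<lambda>s. chart_map ?D (c s)) has_vector_derivative u) (at t within I)"
      using from_to_coord[OF C] by (simp add: from_coord_eq_dtrans)
  qed
  then show ?thesis by (auto simp: has_velocity_def)
qed

text \<open>The preferred charts at \<open>q\<close> and at \<open>F q\<close>, which may change abruptly with the point, drop out once the tangent
  map is read in a fixed chart.\<close>

lemma to_coord_tangent_map:
  assumes C: "C \<in> A" "q \<in> chart_dom C" and N: "open N" "chart_map C q \<in> N" "N \<subseteq> chart_img C"
    and F: "\<And>x. x \<in> N \<Longrightarrow> G x \<in> chart_img C \<and> F (chart_inv C x) = chart_inv C (G x)"
    and G: "(G has_derivative G') (at (chart_map C q))"
  shows "to_coord A C (F q) (tangent_map A F q v) = G' (to_coord A C q v)"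
proof -
  let ?D' = "chart_at A q" and ?D = "chart_at A (F q)"
  note D' = chart_at[of q] and D = chart_at[of "F q"]
  have Fq: "F q = chart_inv C (G (chart_map C q))" and Gq: "G (chart_map C q) \<in> chart_img C"
    using F[OF N(2)] C by (auto simp: chart_inv_map)
  have FqC: "F q \<in> chart_dom C" and Gx: "G (chart_map C q) = chart_map C (F q)"
    unfolding Fq using Gq C by (auto simp: chart_inv_in chart_map_inv)
  define W where "W = overlap ?D' C \<inter> transition ?D' C -` N"
  have W1: "open W" unfolding W_def
    by (intro continuous_open_preimage smooth_on_imp_continuous_on[OF smooth_on_transition] open_overlap D' C N)
  have W2: "chart_map ?D' q \<in> W"
    using N D' C by (simp add: W_def chart_map_in_overlap transition_chart_map)
  have W3: "transition C ?D (G (transition ?D' C x)) = (chart_map ?D \<circ> F \<circ> chart_inv ?D') x" if "x \<in> W" for x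
  proof -
    have "chart_inv C (transition ?D' C x) = chart_inv ?D' x"
      using that D' C by (auto simp: W_def overlap_iff transition_def chart_inv_map)
    then have "F (chart_inv ?D' x) = chart_inv C (G (transition ?D' C x))"
      using F[of "transition ?D' C x"] that by (simp add: W_def)
    then show ?thesis by (simp add: transition_def)
  qed
  have W4: "((\<lambda>x. transition C ?D (G (transition ?D' C x))) has_derivative
      (\<lambda>v. dtrans C ?D (F q) (G' (dtrans ?D' C q v)))) (at (chart_map ?D' q))"
  proof -
    have 1: "((\<lambda>x. G (transition ?D' C x)) has_derivative (\<lambda>v. G' (dtrans ?D' C q v))) (at (chart_map ?D' q))"
      by (rule has_derivative_compose[OF transition_has_derivative[OF D'(1) C(1) D'(2) C(2)]])
        (simp add: G transition_chart_map D')
    have 2: "(transition C ?D has_derivative dtrans C ?D (F q)) (at (G (transition ?D' C (chart_map ?D' q))))"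
      using transition_has_derivative[OF C(1) D(1) FqC D(2)] by (simp add: transition_chart_map D' Gx)
    show ?thesis by (rule has_derivative_compose[OF 1 2])
  qed
  have "((chart_map ?D \<circ> F \<circ> chart_inv ?D') has_derivative
      (\<lambda>v. dtrans C ?D (F q) (G' (dtrans ?D' C q v)))) (at (chart_map ?D' q))"
    by (rule has_derivative_transform_within_open[OF W4 W1 W2 W3])
  then have "tangent_map A F q v = dtrans C ?D (F q) (G' (to_coord A C q v))"
    by (simp add: tangent_map_def frechet_derivative_eqI to_coord_eq_dtrans)
  then show ?thesis
    using D C FqC by (simp add: to_coord_eq_dtrans[of C "F q"] dtrans_dtrans dtrans_self)
qed

subsection \<open>Global fields and functions with support in a chart\<close>

definition lift_vf :: "('m, 'e) chart \<Rightarrow> ('e \<Rightarrow> 'e) \<Rightarrow> 'm \<Rightarrow> 'e" where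
  "lift_vf C g p = (if p \<in> chart_dom C then from_coord A C p (g (chart_map C p)) else 0)"

definition lift_fun :: "('m, 'e) chart \<Rightarrow> ('e \<Rightarrow> real) \<Rightarrow> 'm \<Rightarrow> real" where
  "lift_fun C g p = (if p \<in> chart_dom C then g (chart_map C p) else 0)"

text \<open>The image of the support in the manifold is compact, hence closed by the Hausdorff property, so
  that a lifted object vanishes near every point outside the chart.\<close>

lemma open_outside_support:
  assumes "C \<in> A" "D \<in> A" "compact K" "K \<subseteq> chart_img C"
  shows "open (chart_img D \<inter> chart_inv D -` (- (chart_inv C ` K)))"
proof -
  have "compact (chart_inv C ` K)"
    using assms by (intro compact_continuous_image continuous_on_subset[OF continuous_on_chart_inv])
  then show ?thesis
    using assms by (intro continuous_open_preimage continuous_on_chart_inv open_chart_img open_Compl compact_imp_closed)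
qed

lemma chart_map_notin_support:
  "C \<in> A \<Longrightarrow> p \<in> chart_dom C \<Longrightarrow> p \<notin> chart_inv C ` K \<Longrightarrow> chart_map C p \<in> chart_img C - K"
  by (force simp: chart_map_in chart_inv_map)

lemma smooth_on_lift_transition:
  assumes "C \<in> A" "D \<in> A" "smooth_on (chart_img C) g"
  shows "smooth_on (overlap D C) (\<lambda>x. g (transition D C x))"
  using transition_in_overlap[OF assms(2,1)] overlap_iff[OF assms(1)] assms
  by (intro smooth_on_compose[OF open_overlap open_chart_img _ smooth_on_transition]) auto

lemma smooth_vf_lift:
  assumes C: "C \<in> A" and g: "smooth_on (chart_img C) g"
    and K: "compact K" "K \<subseteq> chart_img C" "\<And>x. x \<in> chart_img C - K \<Longrightarrow> g x = 0"
  shows "smooth_vf A (lift_vf C g)"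
  unfolding smooth_vf_def
proof (intro ballI smooth_on_open_cover)
  fix D y assume D: "D \<in> A" and y: "y \<in> chart_img D"
  show "\<exists>U. open U \<and> y \<in> U \<and> smooth_on U (vf_coord A D (lift_vf C g))"
  proof (cases "chart_inv D y \<in> chart_dom C")
    case True
    have "vf_coord A D (lift_vf C g) x =
        frechet_derivative (transition C D) (at (transition D C x)) (g (transition D C x))" if x: "x \<in> overlap D C" for x
    proof -
      have "chart_inv D x \<in> chart_dom C" "chart_inv D x \<in> chart_dom D"
        using x D by (auto simp: overlap_iff chart_inv_in)
      then show ?thesis
        using C D to_coord_change[OF C D] by (simp add: vf_coord_def lift_vf_def to_from_coord transition_def)
    qed
    moreover have "smooth_on (overlap D C)
        (\<lambda>x. frechet_derivative (transition C D) (at (transition D C x)) (g (transition D C x)))"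
      by (rule smooth_on_derivative_compose[OF open_overlap[OF D C] open_overlap[OF C D] _
            smooth_on_transition[OF D C] smooth_on_transition[OF C D] smooth_on_lift_transition[OF C D g]])
        (use transition_in_overlap[OF D C] in auto)
    ultimately have "smooth_on (overlap D C) (vf_coord A D (lift_vf C g))"
      by (subst smooth_on_cong[OF open_overlap[OF D C]])
    moreover have "y \<in> overlap D C"
      using True y D by (simp add: overlap_iff)
    ultimately show ?thesis
      using open_overlap[OF D C] by blast
  next
    case False
    let ?U = "chart_img D \<inter> chart_inv D -` (- (chart_inv C ` K))"
    have U: "open ?U" by (rule open_outside_support[OF C D K(1,2)])
    have "vf_coord A D (lift_vf C g) x = 0" if "x \<in> ?U" for x
      using that K(3)[OF chart_map_notin_support[OF C]] chart_inv_in[OF D, of x]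
      by (simp add: vf_coord_def lift_vf_def linear_0[OF linear_to_coord] linear_0[OF linear_from_coord] C D)
    then have "smooth_on ?U (vf_coord A D (lift_vf C g))"
      by (subst smooth_on_cong[OF U, of _ "\<lambda>_. 0"]) (auto simp: smooth_on_const)
    moreover have "chart_inv C ` K \<subseteq> chart_dom C"
      using K(2) chart_inv_in[OF C] by blast
    then have "y \<in> ?U"
      using False y by (simp add: subset_iff) metis
    ultimately show ?thesis using U by blast
  qed
qed

lemma smooth_fun_lift:
  assumes C: "C \<in> A" and g: "smooth_on (chart_img C) g"
    and K: "compact K" "K \<subseteq> chart_img C" "\<And>x. x \<in> chart_img C - K \<Longrightarrow> g x = 0"
  shows "smooth_fun A (lift_fun C g)"
  unfolding smooth_fun_def
proof (intro ballI smooth_on_open_cover)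
  fix D y assume D: "D \<in> A" and y: "y \<in> chart_img D"
  show "\<exists>U. open U \<and> y \<in> U \<and> smooth_on U (lift_fun C g \<circ> chart_inv D)"
  proof (cases "chart_inv D y \<in> chart_dom C")
    case True
    have "(lift_fun C g \<circ> chart_inv D) x = g (transition D C x)" if x: "x \<in> overlap D C" for x
      using x D by (simp add: overlap_iff lift_fun_def transition_def)
    moreover have "smooth_on (overlap D C) (\<lambda>x. g (transition D C x))"
      by (rule smooth_on_lift_transition[OF C D g])
    ultimately have "smooth_on (overlap D C) (lift_fun C g \<circ> chart_inv D)"
      by (subst smooth_on_cong[OF open_overlap[OF D C]])
    moreover have "y \<in> overlap D C"
      using True y D by (simp add: overlap_iff)
    ultimately show ?thesis
      using open_overlap[OF D C] by blast
  next
    case False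
    let ?U = "chart_img D \<inter> chart_inv D -` (- (chart_inv C ` K))"
    have U: "open ?U" by (rule open_outside_support[OF C D K(1,2)])
    have "(lift_fun C g \<circ> chart_inv D) x = 0" if "x \<in> ?U" for x
      using that K(3)[OF chart_map_notin_support[OF C]] by (simp add: lift_fun_def)
    then have "smooth_on ?U (lift_fun C g \<circ> chart_inv D)"
      by (subst smooth_on_cong[OF U, of _ "\<lambda>_. 0"]) (auto simp: smooth_on_const)
    moreover have "chart_inv C ` K \<subseteq> chart_dom C"
      using K(2) chart_inv_in[OF C] by blast
    then have "y \<in> ?U"
      using False y by (simp add: subset_iff) metis
    ultimately show ?thesis using U by blast
  qed
qed

lemma vf_coord_lift: "C \<in> A \<Longrightarrow> x \<in> chart_img C \<Longrightarrow> vf_coord A C (lift_vf C g) x = g x"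
  by (simp add: vf_coord_def lift_vf_def chart_inv_in to_from_coord chart_map_inv)

lemma lift_fun_chart_inv: "C \<in> A \<Longrightarrow> x \<in> chart_img C \<Longrightarrow> (lift_fun C g \<circ> chart_inv C) x = g x"
  by (simp add: lift_fun_def chart_inv_in chart_map_inv)

lemma bump_in_chart:
  assumes "C \<in> A" "p \<in> chart_dom C"
  obtains r \<beta> where "0 < r" "cball (chart_map C p) (2 * r) \<subseteq> chart_img C" "smooth_on UNIV \<beta>"
    "\<And>x. x \<in> ball (chart_map C p) r \<Longrightarrow> \<beta> x = (1::real)"
    "\<And>x. x \<notin> cball (chart_map C p) (2 * r) \<Longrightarrow> \<beta> x = 0"
proof -
  obtain e where e: "0 < e" "cball (chart_map C p) e \<subseteq> chart_img C"
    using open_contains_cball open_chart_img[OF assms(1)] chart_map_in[OF assms(2)] by blast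
  then obtain \<beta> :: "'e \<Rightarrow> real" where "smooth_on UNIV \<beta>"
    "\<And>x. x \<in> ball (chart_map C p) (e / 2) \<Longrightarrow> \<beta> x = 1"
    "\<And>x. x \<notin> cball (chart_map C p) (2 * (e / 2)) \<Longrightarrow> \<beta> x = 0"
    using bump_function[of "e / 2" "chart_map C p"] by (metis half_gt_zero)
  with e show thesis by (intro that[of "e / 2" \<beta>]) auto
qed

lemma extend_vf: "smooth_vf A (extend_vf A p v)" "extend_vf A p v p = v"
proof -
  let ?C = "chart_at A p"
  note C = chart_at[of p]
  obtain r \<beta> where r: "0 < r" "cball (chart_map ?C p) (2 * r) \<subseteq> chart_img ?C" "smooth_on UNIV \<beta>"
    "\<And>x. x \<in> ball (chart_map ?C p) r \<Longrightarrow> \<beta> x = (1::real)"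
    "\<And>x. x \<notin> cball (chart_map ?C p) (2 * r) \<Longrightarrow> \<beta> x = 0"
    using bump_in_chart[OF C] by blast
  let ?V = "lift_vf ?C (\<lambda>x. \<beta> x *\<^sub>R v)"
  have "smooth_vf A ?V"
    using r by (intro smooth_vf_lift[OF C(1), of _ "cball (chart_map ?C p) (2 * r)"]
        smooth_on_scaleR smooth_on_const open_chart_img C smooth_on_subset[OF r(3)]) auto
  moreover have "?V p = v"
    using r by (simp add: lift_vf_def C from_coord_chart_at)
  ultimately have "\<exists>V. smooth_vf A V \<and> V p = v" by blast
  then have "smooth_vf A (extend_vf A p v) \<and> extend_vf A p v p = v"
    unfolding extend_vf_def by (rule someI_ex)
  then show "smooth_vf A (extend_vf A p v)" "extend_vf A p v p = v" by auto
qed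

end

section \<open>Connections in a chart\<close>

context smooth_manifold
begin

text \<open>The formula that defines the bracket in the preferred chart at \<open>p\<close> holds in all charts: in a
  change of charts the second derivatives of the transition map cancel.\<close>

lemma to_coord_lie_bracket:
  assumes C: "C \<in> A" "p \<in> chart_dom C" and X: "smooth_vf A X" and Y: "smooth_vf A Y"
  shows "to_coord A C p (lie_bracket A X Y p) =
    frechet_derivative (vf_coord A C Y) (at (chart_map C p)) (to_coord A C p (X p)) -
    frechet_derivative (vf_coord A C X) (at (chart_map C p)) (to_coord A C p (Y p))"
proof -
  let ?D = "chart_at A p"
  note D = chart_at[of p]
  let ?y = "chart_map ?D p" and ?\<tau> = "transition ?D C"
  have y: "?y \<in> overlap ?D C" "?y \<in> chart_img ?D" using C D by (auto simp: chart_map_in_overlap chart_map_in)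
  note \<tau> = open_overlap[OF D(1) C(1)] y(1) smooth_on_transition[OF D(1) C(1)]
  have change: "vf_coord A C Z (?\<tau> z) = frechet_derivative ?\<tau> (at z) (vf_coord A ?D Z z)"
    if z: "z \<in> overlap ?D C" for Z z
  proof -
    have q: "chart_inv ?D z \<in> chart_dom C" "chart_inv ?D z \<in> chart_dom ?D" "z \<in> chart_img ?D"
      using z D by (auto simp: overlap_iff chart_inv_in)
    then show ?thesis
      using to_coord_change[OF D(1) C(1) q(2,1)] D C
      by (simp add: vf_coord_def transition_def chart_inv_map chart_map_inv)
  qed
  have der: "frechet_derivative (vf_coord A C Z) (at (chart_map C p)) (dtrans ?D C p v) =
      frechet_derivative (\<lambda>z. frechet_derivative ?\<tau> (at z) (Z p)) (at ?y) v +
      dtrans ?D C p (frechet_derivative (vf_coord A ?D Z) (at ?y) v)" if Z: "smooth_vf A Z" for Z v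
  proof -
    have "((\<lambda>z. frechet_derivative ?\<tau> (at z) (vf_coord A ?D Z z)) has_derivative
      (\<lambda>v. frechet_derivative (\<lambda>z. frechet_derivative ?\<tau> (at z) (vf_coord A ?D Z ?y)) (at ?y) v
        + dtrans ?D C p (frechet_derivative (vf_coord A ?D Z) (at ?y) v))) (at ?y)"
      by (rule has_derivative_derivative_apply[OF \<tau> smooth_on_has_derivative[OF smooth_vfD[OF Z D(1)] y(2)]])
    then have "((\<lambda>z. vf_coord A C Z (?\<tau> z)) has_derivative
      (\<lambda>v. frechet_derivative (\<lambda>z. frechet_derivative ?\<tau> (at z) (vf_coord A ?D Z ?y)) (at ?y) v
        + dtrans ?D C p (frechet_derivative (vf_coord A ?D Z) (at ?y) v))) (at ?y)"
      by (rule has_derivative_transform_within_open[OF _ \<tau>(1,2)]) (simp add: change)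
    moreover have "((\<lambda>z. vf_coord A C Z (?\<tau> z)) has_derivative
      (\<lambda>v. frechet_derivative (vf_coord A C Z) (at (chart_map C p)) (dtrans ?D C p v))) (at ?y)"
      by (rule has_derivative_compose[OF transition_has_derivative[OF D(1) C(1) D(2) C(2)]])
        (simp add: transition_chart_map D smooth_on_has_derivative[OF smooth_vfD[OF Z C(1)]] chart_map_in C)
    ultimately have "(\<lambda>v. frechet_derivative (vf_coord A C Z) (at (chart_map C p)) (dtrans ?D C p v)) =
      (\<lambda>v. frechet_derivative (\<lambda>z. frechet_derivative ?\<tau> (at z) (vf_coord A ?D Z ?y)) (at ?y) v
        + dtrans ?D C p (frechet_derivative (vf_coord A ?D Z) (at ?y) v))"
      using has_derivative_unique by blast
    from fun_cong[OF this, of v] show ?thesis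
      using D by (simp add: vf_coord_chart_map to_coord_chart_at)
  qed
  have "lie_bracket A X Y p = frechet_derivative (vf_coord A ?D Y) (at ?y) (X p) -
      frechet_derivative (vf_coord A ?D X) (at ?y) (Y p)"
    by (simp add: lie_bracket_def Let_def)
  then show ?thesis
    using der[OF Y, of "X p"] der[OF X, of "Y p"] second_derivative_symmetric[OF \<tau>, of "X p" "Y p"]
    by (simp add: to_coord_eq_dtrans linear_diff[OF linear_dtrans[OF D(1) C(1) D(2) C(2)]])
qed

end

text \<open>On the ball of radius \<open>r\<close>, the plateau, an object cut off with \<open>\<beta>\<close> agrees with the original, and outside the
  chart it can be continued by zero.\<close>

locale bumped_chart = smooth_manifold A
  for A :: "('m::t2_space, 'e::euclidean_space) chart set" +
  fixes C :: "('m, 'e) chart" and m :: 'm and r :: real and \<beta> :: "'e \<Rightarrow> real"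
  assumes C: "C \<in> A" and m: "m \<in> chart_dom C" and r: "0 < r"
    and support: "cball (chart_map C m) (2 * r) \<subseteq> chart_img C"
    and smooth_\<beta>: "smooth_on UNIV \<beta>"
    and \<beta>_1: "x \<in> ball (chart_map C m) r \<Longrightarrow> \<beta> x = 1"
    and \<beta>_0: "x \<notin> cball (chart_map C m) (2 * r) \<Longrightarrow> \<beta> x = 0"
begin

abbreviation x0 :: 'e where "x0 \<equiv> chart_map C m"

lemma plateau_subset: "ball x0 r \<subseteq> chart_img C"
proof -
  have "ball x0 r \<subseteq> cball x0 (2 * r)" using r by auto
  then show ?thesis using support by simp
qed

lemma smooth_on_\<beta>_mult: "smooth_on (chart_img C) g \<Longrightarrow> smooth_on (chart_img C) (\<lambda>x. \<beta> x * g x)"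
  by (intro smooth_on_mult open_chart_img C smooth_on_subset[OF smooth_\<beta>]) auto

lemma smooth_fun_lift_\<beta>: "smooth_on (chart_img C) g \<Longrightarrow> smooth_fun A (lift_fun C (\<lambda>x. \<beta> x * g x))"
  by (rule smooth_fun_lift[OF C smooth_on_\<beta>_mult compact_cball support]) (auto simp: \<beta>_0)

definition frame :: "'e \<Rightarrow> 'm \<Rightarrow> 'e" where
  "frame b = lift_vf C (\<lambda>x. \<beta> x *\<^sub>R b)"

lemma smooth_frame: "smooth_vf A (frame b)"
  unfolding frame_def
  by (rule smooth_vf_lift[OF C _ compact_cball support])
    (auto simp: \<beta>_0 intro!: smooth_on_scaleR open_chart_img C smooth_on_subset[OF smooth_\<beta>] smooth_on_const)

lemma frame_eq:
  assumes "x \<in> ball x0 r"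
  shows "frame b (chart_inv C x) = from_coord A C (chart_inv C x) b"
proof -
  have "x \<in> chart_img C" using assms plateau_subset by auto
  then show ?thesis
    using assms C by (simp add: frame_def lift_vf_def chart_inv_in chart_map_inv \<beta>_1)
qed

lemma vf_coord_frame_has_derivative:
  assumes "x \<in> ball x0 r"
  shows "(vf_coord A C (frame b) has_derivative (\<lambda>_. 0)) (at x)"
proof -
  have "((\<lambda>_. b) has_derivative (\<lambda>_. 0)) (at x)" by simp
  then show ?thesis
    by (rule has_derivative_transform_within_open[OF _ open_ball assms])
      (use plateau_subset C in \<open>auto simp: frame_def vf_coord_lift \<beta>_1 subset_iff\<close>)
qed

end

locale connection_in_chart = bumped_chart A C m r \<beta>
  for A :: "('m::t2_space, 'e::euclidean_space) chart set" and C m r \<beta> +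
  fixes nabla :: "('m \<Rightarrow> 'e) \<Rightarrow> ('m \<Rightarrow> 'e) \<Rightarrow> ('m \<Rightarrow> 'e)"
  assumes connection: "affine_connection A nabla"
begin

lemma
  assumes "smooth_vf A X" "smooth_vf A Y"
  shows smooth_nabla: "smooth_vf A (nabla X Y)"
    and nabla_add1: "smooth_vf A X' \<Longrightarrow> nabla (\<lambda>p. X p + X' p) Y = (\<lambda>p. nabla X Y p + nabla X' Y p)"
    and nabla_scale1: "smooth_fun A f \<Longrightarrow> nabla (\<lambda>p. f p *\<^sub>R X p) Y = (\<lambda>p. f p *\<^sub>R nabla X Y p)"
    and nabla_add2: "smooth_vf A Y' \<Longrightarrow> nabla X (\<lambda>p. Y p + Y' p) = (\<lambda>p. nabla X Y p + nabla X Y' p)"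
    and nabla_scale2: "smooth_fun A f \<Longrightarrow>
      nabla X (\<lambda>p. f p *\<^sub>R Y p) = (\<lambda>p. dfun A f p (X p) *\<^sub>R Y p + f p *\<^sub>R nabla X Y p)"
  using connection assms unfolding affine_connection_def by blast+

lemma nabla_sum1:
  assumes "finite I" "\<And>i. i \<in> I \<Longrightarrow> smooth_vf A (X i)" and Y: "smooth_vf A Y"
  shows "nabla (\<lambda>p. \<Sum>i\<in>I. X i p) Y = (\<lambda>p. \<Sum>i\<in>I. nabla (X i) Y p)"
  using assms(1,2)
proof (induction I rule: finite_induct)
  case empty
  show ?case using nabla_scale1[OF Y Y smooth_fun_const[of 0]] by simp
next
  case (insert i I)
  then show ?case
    using nabla_add1[of "X i" Y "\<lambda>p. \<Sum>i\<in>I. X i p"] Y by (simp add: smooth_vf_sum)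
qed

lemma nabla_sum2:
  assumes "finite I" "\<And>i. i \<in> I \<Longrightarrow> smooth_vf A (Y i)" and X: "smooth_vf A X"
  shows "nabla X (\<lambda>p. \<Sum>i\<in>I. Y i p) = (\<lambda>p. \<Sum>i\<in>I. nabla X (Y i) p)"
  using assms(1,2)
proof (induction I rule: finite_induct)
  case empty
  have "dfun A (\<lambda>_. 0) p v = 0" for p v
    by (simp add: dfun_def o_def)
  then show ?case using nabla_scale2[OF X X smooth_fun_const[of 0]] by simp
next
  case (insert i I)
  then show ?case
    using nabla_add2[of X "Y i" "\<lambda>p. \<Sum>i\<in>I. Y i p"] X by (simp add: smooth_vf_sum)
qed

text \<open>The Christoffel symbols, as a bilinear map at every point; the frame consists of globally defined fields, to
  which the connection can be applied.  Those of the associated torsion-free connection are the symmetric part.\<close>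

definition christoffel :: "'e \<Rightarrow> 'e \<Rightarrow> 'e \<Rightarrow> 'e" where
  "christoffel x u w = (\<Sum>i\<in>Basis. \<Sum>j\<in>Basis.
     ((u \<bullet> i) * (w \<bullet> j)) *\<^sub>R vf_coord A C (nabla (frame i) (frame j)) x)"

definition christoffel0 :: "'e \<Rightarrow> 'e \<Rightarrow> 'e \<Rightarrow> 'e" where
  "christoffel0 x u w = (1 / 2) *\<^sub>R (christoffel x u w + christoffel x w u)"

lemma linear_christoffel: "linear (christoffel x u)" "linear (\<lambda>u. christoffel x u w)"
  by (auto intro!: linearI simp: christoffel_def inner_add_left algebra_simps sum.distrib scaleR_sum_right)

lemma linear_christoffel0: "linear (christoffel0 x u)"
  by (auto intro!: linearI simp: christoffel0_def linear_add[OF linear_christoffel(1)] linear_add[OF linear_christoffel(2)]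
      linear_scale[OF linear_christoffel(1)] linear_scale[OF linear_christoffel(2)] algebra_simps)

text \<open>On the plateau multiplication with the square of the bump function changes nothing, while it turns
  the coordinate expression of a vector field into a globally valid one, with the coordinate frame cut off
  by one factor and the components by the other.  The axioms of a connection apply to that expression.\<close>

lemma to_coord_nabla:
  assumes X: "smooth_vf A X" and Y: "smooth_vf A Y" and p: "p \<in> chart_dom C" "chart_map C p \<in> ball x0 r"
  shows "to_coord A C p (nabla X Y p) =
    frechet_derivative (vf_coord A C Y) (at (chart_map C p)) (to_coord A C p (X p)) +
    christoffel (chart_map C p) (to_coord A C p (X p)) (to_coord A C p (Y p))"
proof -
  let ?x = "chart_map C p"
  define \<xi> where "\<xi> Z i = lift_fun C (\<lambda>x. \<beta> x * (vf_coord A C Z x \<bullet> i))" for Z i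
  define f where "f = lift_fun C (\<lambda>x. \<beta> x * \<beta> x)"
  have fp: "f p = 1" using p by (simp add: f_def lift_fun_def \<beta>_1)
  have smooth_f: "smooth_fun A f"
    unfolding f_def by (rule smooth_fun_lift_\<beta>[OF smooth_on_subset[OF smooth_\<beta>]]) auto
  have smooth_\<xi>: "smooth_fun A (\<xi> Z i)" if "smooth_vf A Z" for Z i
    unfolding \<xi>_def
    by (intro smooth_fun_lift_\<beta> smooth_on_inner open_chart_img C smooth_on_const smooth_vfD that)
  have smooth_\<xi>_frame: "smooth_vf A (\<lambda>q. \<xi> Z i q *\<^sub>R frame i q)" if "smooth_vf A Z" for Z i
    by (intro smooth_vf_scaleR smooth_\<xi> smooth_frame that)
  have expand: "(\<lambda>q. f q *\<^sub>R Z q) = (\<lambda>q. \<Sum>i\<in>Basis. \<xi> Z i q *\<^sub>R frame i q)" for Z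
  proof
    fix q
    show "f q *\<^sub>R Z q = (\<Sum>i\<in>Basis. \<xi> Z i q *\<^sub>R frame i q)"
    proof (cases "q \<in> chart_dom C")
      case True
      let ?y = "chart_map C q"
      note lin = linear_from_coord[OF C True]
      have "(\<Sum>i\<in>Basis. \<xi> Z i q *\<^sub>R frame i q) =
          (\<Sum>i\<in>Basis. (\<beta> ?y * \<beta> ?y) *\<^sub>R (vf_coord A C Z ?y \<bullet> i) *\<^sub>R from_coord A C q i)"
        using True by (simp add: \<xi>_def frame_def lift_fun_def lift_vf_def linear_scale[OF lin] mult_ac)
      also have "\<dots> = (\<beta> ?y * \<beta> ?y) *\<^sub>R from_coord A C q (\<Sum>i\<in>Basis. (vf_coord A C Z ?y \<bullet> i) *\<^sub>R i)"
        by (simp add: linear_sum[OF lin] linear_scale[OF lin] scaleR_sum_right del: euclidean_representation)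
      also have "\<dots> = f q *\<^sub>R Z q"
        using True by (simp add: euclidean_representation from_coord_vf_coord C f_def lift_fun_def)
      finally show ?thesis by simp
    qed (simp add: f_def \<xi>_def lift_fun_def)
  qed
  have \<xi>p: "\<xi> Z i p = to_coord A C p (Z p) \<bullet> i" for Z i
    using p C by (simp add: \<xi>_def lift_fun_def \<beta>_1 vf_coord_chart_map)
  have "nabla (\<lambda>q. f q *\<^sub>R X q) Z p = nabla X Z p" if "smooth_vf A Z" for Z
    using nabla_scale1[OF X that smooth_f] fp by simp
  moreover have "nabla (\<lambda>q. f q *\<^sub>R X q) Z p = (\<Sum>i\<in>Basis. (to_coord A C p (X p) \<bullet> i) *\<^sub>R nabla (frame i) Z p)"
    if "smooth_vf A Z" for Z
    by (simp add: expand nabla_sum1 smooth_\<xi>_frame X that nabla_scale1 smooth_frame smooth_\<xi> \<xi>p)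
  ultimately have nabla1: "nabla X Z p = (\<Sum>i\<in>Basis. (to_coord A C p (X p) \<bullet> i) *\<^sub>R nabla (frame i) Z p)"
    if "smooth_vf A Z" for Z
    using that by simp
  have dfun_plateau: "dfun A (lift_fun C g) p v = g' (to_coord A C p v)"
    if g: "(h has_derivative g') (at ?x)" "\<And>x. x \<in> ball x0 r \<Longrightarrow> g x = h x" for g h g' v
  proof -
    have d: "((lift_fun C g \<circ> chart_inv C) has_derivative g') (at ?x)"
      by (rule has_derivative_transform_within_open[OF g(1) open_ball p(2)])
        (use g(2) plateau_subset C in \<open>auto simp: lift_fun_chart_inv subset_iff simp del: o_apply\<close>)
    then have "(lift_fun C g \<circ> chart_inv C) differentiable (at ?x)"
      unfolding differentiable_def by blast
    from dfun_chart[OF C p(1) this] show ?thesis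
      by (simp only: frechet_derivative_eqI[OF d])
  qed
  have "dfun A f p (X p) = 0"
    unfolding f_def by (rule dfun_plateau[of "\<lambda>_. 1" "\<lambda>_. 0"]) (simp_all add: \<beta>_1)
  then have "nabla X (\<lambda>q. f q *\<^sub>R Y q) p = nabla X Y p"
    using nabla_scale2[OF X Y smooth_f] fp by simp
  moreover have "dfun A (\<xi> Y j) p (X p) = frechet_derivative (vf_coord A C Y) (at ?x) (to_coord A C p (X p)) \<bullet> j" for j
    unfolding \<xi>_def
  proof (rule dfun_plateau)
    show "((\<lambda>x. vf_coord A C Y x \<bullet> j) has_derivative (\<lambda>v. frechet_derivative (vf_coord A C Y) (at ?x) v \<bullet> j)) (at ?x)"
      by (intro has_derivative_inner_left smooth_on_has_derivative[OF smooth_vfD[OF Y C]] chart_map_in p)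
  qed (simp add: \<beta>_1)
  moreover have "frame j p = from_coord A C p j" for j
    using frame_eq[OF p(2)] p C by (simp add: chart_inv_map)
  ultimately have "nabla X Y p = (\<Sum>j\<in>Basis.
      (frechet_derivative (vf_coord A C Y) (at ?x) (to_coord A C p (X p)) \<bullet> j) *\<^sub>R from_coord A C p j +
      (to_coord A C p (Y p) \<bullet> j) *\<^sub>R (\<Sum>i\<in>Basis. (to_coord A C p (X p) \<bullet> i) *\<^sub>R nabla (frame i) (frame j) p))"
    by (simp add: expand nabla_sum2 smooth_\<xi>_frame X Y nabla_scale2 smooth_frame smooth_\<xi> \<xi>p nabla1)
  then have "to_coord A C p (nabla X Y p) = (\<Sum>j\<in>Basis.
      (frechet_derivative (vf_coord A C Y) (at ?x) (to_coord A C p (X p)) \<bullet> j) *\<^sub>R j) +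
      (\<Sum>j\<in>Basis. (\<Sum>i\<in>Basis. ((to_coord A C p (X p) \<bullet> i) * (to_coord A C p (Y p) \<bullet> j)) *\<^sub>R
         to_coord A C p (nabla (frame i) (frame j) p)))"
    using p C by (simp add: linear_sum[OF linear_to_coord] linear_add[OF linear_to_coord]
        linear_scale[OF linear_to_coord] to_from_coord sum.distrib scaleR_sum_right mult_ac del: euclidean_representation)
  also have "(\<Sum>j\<in>Basis. (\<Sum>i\<in>Basis. ((to_coord A C p (X p) \<bullet> i) * (to_coord A C p (Y p) \<bullet> j)) *\<^sub>R
         to_coord A C p (nabla (frame i) (frame j) p))) =
      christoffel ?x (to_coord A C p (X p)) (to_coord A C p (Y p))"
    using p C by (subst sum.swap) (simp add: christoffel_def vf_coord_chart_map)
  finally show ?thesis by (simp add: euclidean_representation)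
qed

lemma to_coord_torsion_free_part:
  assumes X: "smooth_vf A X" and Y: "smooth_vf A Y" and p: "p \<in> chart_dom C" "chart_map C p \<in> ball x0 r"
  shows "to_coord A C p (torsion_free_part A nabla X Y p) =
    frechet_derivative (vf_coord A C Y) (at (chart_map C p)) (to_coord A C p (X p)) +
    christoffel0 (chart_map C p) (to_coord A C p (X p)) (to_coord A C p (Y p))"
proof -
  note lin = linear_to_coord[OF C p(1)]
  let ?DY = "frechet_derivative (vf_coord A C Y) (at (chart_map C p)) (to_coord A C p (X p))"
  let ?DX = "frechet_derivative (vf_coord A C X) (at (chart_map C p)) (to_coord A C p (Y p))"
  let ?G = "christoffel (chart_map C p) (to_coord A C p (X p)) (to_coord A C p (Y p))"
  let ?G' = "christoffel (chart_map C p) (to_coord A C p (Y p)) (to_coord A C p (X p))"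
  have "to_coord A C p (torsion_free_part A nabla X Y p) =
      (?DY + ?G) - (1 / 2) *\<^sub>R ((?DY + ?G) - (?DX + ?G') - (?DY - ?DX))"
    by (simp add: torsion_free_part_def torsion_def linear_diff[OF lin] linear_scale[OF lin]
        to_coord_nabla[OF X Y p] to_coord_nabla[OF Y X p] to_coord_lie_bracket[OF C p(1) X Y])
  also have "(?DY + ?G) - (?DX + ?G') - (?DY - ?DX) = ?G - ?G'"
    by simp
  also have "?DY + ?G - (1 / 2) *\<^sub>R (?G - ?G') = ?DY + ((1 / 2) *\<^sub>R ?G + (1 / 2) *\<^sub>R ?G) - (1 / 2) *\<^sub>R (?G - ?G')"
    by (simp flip: scaleR_left_distrib)
  also have "\<dots> = ?DY + (1 / 2) *\<^sub>R (?G + ?G')"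
    by (simp add: scaleR_diff_right scaleR_add_right)
  finally show ?thesis by (simp add: christoffel0_def)
qed

lemma to_coord_nabla_at:
  assumes Y: "smooth_vf A Y" and p: "p \<in> chart_dom C" "chart_map C p \<in> ball x0 r"
  shows "to_coord A C p (nabla_at A nabla p u Y) =
      frechet_derivative (vf_coord A C Y) (at (chart_map C p)) (to_coord A C p u) +
      christoffel (chart_map C p) (to_coord A C p u) (to_coord A C p (Y p))"
    and "to_coord A C p (nabla_at A (torsion_free_part A nabla) p u Y) =
      frechet_derivative (vf_coord A C Y) (at (chart_map C p)) (to_coord A C p u) +
      christoffel0 (chart_map C p) (to_coord A C p u) (to_coord A C p (Y p))"
  unfolding nabla_at_def
  using to_coord_nabla[OF extend_vf(1) Y p] to_coord_torsion_free_part[OF extend_vf(1) Y p]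
  by (simp_all add: extend_vf(2))

lemma continuous_on_christoffel0:
  assumes "continuous_on S x" "continuous_on S u" "continuous_on S w" "x ` S \<subseteq> chart_img C"
  shows "continuous_on S (\<lambda>s. christoffel0 (x s) (u s) (w s))"
proof -
  have "continuous_on S (\<lambda>s. vf_coord A C (nabla (frame i) (frame j)) (x s))" for i j
    by (rule continuous_on_compose2[OF smooth_on_imp_continuous_on[OF smooth_vfD[OF smooth_nabla C]] assms(1,4)])
      (auto intro: smooth_frame)
  then show ?thesis
    unfolding christoffel0_def christoffel_def
    by (intro continuous_on_scaleR continuous_on_add continuous_on_sum continuous_on_mult
        continuous_on_inner continuous_on_const assms)
qed

lemma christoffel0_bound:
  obtains G where "0 \<le> G" "\<And>x u w. x \<in> ball x0 r \<Longrightarrow> norm (christoffel0 x u w) \<le> G * norm u * norm w"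
proof -
  have "\<exists>B. \<forall>x\<in>cball x0 (2 * r). norm (vf_coord A C (nabla (frame i) (frame j)) x) \<le> B" for i j
  proof -
    have "compact (vf_coord A C (nabla (frame i) (frame j)) ` cball x0 (2 * r))"
      by (intro compact_continuous_image compact_cball
          continuous_on_subset[OF smooth_on_imp_continuous_on[OF smooth_vfD[OF smooth_nabla C]] support] smooth_frame)
    then show ?thesis using compact_imp_bounded bounded_iff by (metis imageI)
  qed
  then obtain B where B: "\<And>i j x. x \<in> cball x0 (2 * r) \<Longrightarrow> norm (vf_coord A C (nabla (frame i) (frame j)) x) \<le> B i j"
    by metis
  let ?G = "\<Sum>i\<in>Basis. \<Sum>j\<in>Basis. B i j"
  have "0 \<le> B i j" for i j
    using B[of x0 i j] r order_trans[OF norm_ge_zero] by (metis centre_in_cball less_eq_real_def mult_nonneg_nonneg zero_le_numeral)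
  then have G0: "0 \<le> ?G" by (intro sum_nonneg)
  have bound: "norm (christoffel x u w) \<le> ?G * norm u * norm w" if "x \<in> ball x0 r" for x u w
  proof -
    have x: "x \<in> cball x0 (2 * r)" using that r by auto
    have "norm (christoffel x u w) \<le> (\<Sum>i\<in>Basis. \<Sum>j\<in>Basis. norm u * norm w * B i j)"
      unfolding christoffel_def
    proof (intro sum_norm_le)
      fix i j :: 'e assume "i \<in> Basis" "j \<in> Basis"
      then show "norm (((u \<bullet> i) * (w \<bullet> j)) *\<^sub>R vf_coord A C (nabla (frame i) (frame j)) x) \<le> norm u * norm w * B i j"
        unfolding norm_scaleR abs_mult using B[OF x]
        by (intro mult_mono mult_nonneg_nonneg) (auto simp: Basis_le_norm)
    qed
    also have "\<dots> = ?G * norm u * norm w"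
      by (simp add: sum_distrib_left sum_distrib_right mult_ac)
    finally show ?thesis .
  qed
  have "norm (christoffel0 x u w) \<le> ?G * norm u * norm w" if "x \<in> ball x0 r" for x u w
    using bound[OF that, of u w] bound[OF that, of w u] norm_triangle_ineq[of "christoffel x u w" "christoffel x w u"]
    by (simp add: christoffel0_def mult_ac)
  with G0 show thesis by (rule that)
qed

end

section \<open>Integral curves and flows\<close>

lemma (in smooth_manifold) integral_curve_isCont:
  assumes "integral_curve_on A X c I" "open I" "t \<in> I"
  shows "isCont c t"
proof -
  have "continuous (at t within I) c"
    using assms(1,3) by (simp add: integral_curve_on_def has_velocity_def)
  then show ?thesis by (simp only: at_within_open[OF assms(3,2)])
qed

context bumped_chart
begin

text \<open>The coordinate expression of \<open>X\<close>, cut off so as to be defined and Lipschitz on the whole model space.\<close>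

definition cutoff :: "('m \<Rightarrow> 'e) \<Rightarrow> 'e \<Rightarrow> 'e" where
  "cutoff X x = \<beta> x *\<^sub>R vf_coord A C X x"

lemma smooth_cutoff: "smooth_vf A X \<Longrightarrow> smooth_on UNIV (cutoff X)"
  unfolding cutoff_def
  by (rule smooth_on_cutoff[OF open_chart_img[OF C] _ smooth_\<beta> closed_cball support \<beta>_0])
    (auto intro: smooth_vfD C)

lemma cutoff_0: "x \<notin> cball x0 (2 * r) \<Longrightarrow> cutoff X x = 0"
  by (simp add: cutoff_def \<beta>_0)

lemma cutoff_eq: "x \<in> ball x0 r \<Longrightarrow> cutoff X x = vf_coord A C X x"
  by (simp add: cutoff_def \<beta>_1)

lemma cutoff_chart_map:
  "p \<in> chart_dom C \<Longrightarrow> chart_map C p \<in> ball x0 r \<Longrightarrow> cutoff X (chart_map C p) = to_coord A C p (X p)"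
  by (simp add: cutoff_eq vf_coord_chart_map C)

lemma integral_curve_in_chart:
  assumes "integral_curve_on A X c I" "open I" "t \<in> I" "c t \<in> chart_dom C" "chart_map C (c t) \<in> ball x0 r"
  shows "((\<lambda>s. chart_map C (c s)) has_vector_derivative cutoff X (chart_map C (c t))) (at t)"
proof -
  have "has_velocity A c (X (c t)) t I"
    using assms by (simp add: integral_curve_on_def)
  then show ?thesis
    using has_velocity_iff[where c = c, OF C assms(4,3)] assms(4,5) at_within_open[OF assms(3,2)]
    by (simp add: cutoff_chart_map)
qed

lemma integral_curves_agree_near:
  assumes X: "smooth_vf A X" and I: "open I" "t0 \<in> I"
    and c: "integral_curve_on A X c1 I" "integral_curve_on A X c2 I" "c1 t0 = m" "c2 t0 = m"
  shows "\<forall>\<^sub>F t in nhds t0. c1 t = c2 t"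
proof -
  let ?W = "chart_dom C \<inter> chart_map C -` ball x0 r"
  have W: "open ?W" "m \<in> ?W"
    using m r by (simp_all add: continuous_open_preimage continuous_on_chart_map C open_chart_dom)
  have near: "\<forall>\<^sub>F t in nhds t0. c t \<in> ?W" if "integral_curve_on A X c I" "c t0 = m" for c
  proof -
    have "isCont c t0"
      by (rule integral_curve_isCont[OF that(1) I])
    then have "(c \<longlongrightarrow> m) (nhds t0)"
      using that(2) tendsto_at_iff_tendsto_nhds[of c t0] by (simp add: isCont_def)
    then show ?thesis by (rule topological_tendstoD[OF _ W])
  qed
  have "\<forall>\<^sub>F t in nhds t0. c1 t \<in> ?W \<and> c2 t \<in> ?W \<and> t \<in> I"
    by (intro eventually_conj near c eventually_nhds_in_open I)
  then obtain d where d: "0 < d" "\<And>t. dist t t0 < d \<Longrightarrow> c1 t \<in> ?W \<and> c2 t \<in> ?W \<and> t \<in> I"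
    unfolding eventually_nhds_metric by blast
  obtain L where L: "0 \<le> L" "\<And>x y. norm (cutoff X x - cutoff X y) \<le> L * norm (x - y)"
    using derivative_bounded_of_compact_support[OF smooth_cutoff[OF X] compact_cball cutoff_0] by metis
  define T where "T = min (d / 2) (1 / (2 * (L + 1)))"
  have "L * T \<le> L * (1 / (2 * (L + 1)))"
    using L(1) unfolding T_def by (intro mult_left_mono) auto
  also have "\<dots> \<le> 1 / 2" using L(1) by (simp add: field_simps)
  finally have LT: "L * T \<le> 1 / 2" .
  have T: "0 < T" "T < d" using d(1) L(1) by (auto simp: T_def)
  have agree: "c1 (t0 + s) = c2 (t0 + s)" if s: "s \<in> {-T..T}" for s
  proof -
    have curve: "((\<lambda>s. chart_map C (c (t0 + s))) has_vector_derivative cutoff X (chart_map C (c (t0 + s)))) (at s within {-T..T})"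
      if "integral_curve_on A X c I" "c (t0 + s) \<in> ?W" "t0 + s \<in> I" for c s
    proof -
      have 1: "((\<lambda>s. t0 + s) has_vector_derivative 1) (at s)"
        by (auto intro!: derivative_eq_intros)
      have 2: "((\<lambda>s. chart_map C (c s)) has_vector_derivative cutoff X (chart_map C (c (t0 + s)))) (at (t0 + s))"
        using integral_curve_in_chart[OF that(1) I(1) that(3)] that(2) by auto
      show ?thesis
        using vector_diff_chain_at[OF 1 2] by (simp add: o_def has_vector_derivative_at_within)
    qed
    have "chart_map C (c1 (t0 + s)) - chart_map C (c2 (t0 + s)) = 0"
    proof (rule ode_zero[where R = "\<lambda>s. chart_map C (c1 (t0 + s)) - chart_map C (c2 (t0 + s))" and a = "- T" and b = T])
      fix s assume "s \<in> {-T..T}"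
      then have "dist (t0 + s) t0 < d" using T by (auto simp: dist_real_def abs_le_iff)
      note * = d(2)[OF this]
      show "((\<lambda>s. chart_map C (c1 (t0 + s)) - chart_map C (c2 (t0 + s))) has_vector_derivative
          cutoff X (chart_map C (c1 (t0 + s))) - cutoff X (chart_map C (c2 (t0 + s)))) (at s within {-T..T})"
        using * by (intro has_vector_derivative_diff curve c) auto
      show "norm (cutoff X (chart_map C (c1 (t0 + s))) - cutoff X (chart_map C (c2 (t0 + s)))) \<le>
          L * norm (chart_map C (c1 (t0 + s)) - chart_map C (c2 (t0 + s)))"
        by (rule L(2))
    qed (use s T L(1) LT c in auto)
    moreover have "dist (t0 + s) t0 < d" using s T by (auto simp: dist_real_def abs_le_iff)
    from d(2)[OF this] have "c1 (t0 + s) \<in> chart_dom C" "c2 (t0 + s) \<in> chart_dom C" by auto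
    ultimately show ?thesis
      using chart_inv_map[OF C] by (metis eq_iff_diff_eq_0)
  qed
  have "c1 t = c2 t" if "dist t t0 < T" for t
    using agree[of "t - t0"] that by (auto simp: dist_real_def abs_less_iff)
  then show ?thesis using T(1) unfolding eventually_nhds_metric by blast
qed

end

context smooth_manifold
begin

lemma integral_curve_on_subset:
  assumes "integral_curve_on A X c I" "open J" "J \<subseteq> I" "open I"
  shows "integral_curve_on A X c J"
proof -
  have "at t within J = at t within I" if "t \<in> J" for t
    using assms that by (metis at_within_open subsetD)
  then show ?thesis
    using assms unfolding integral_curve_on_def has_velocity_def by auto
qed

text \<open>The set of times at which two integral curves agree is closed in the interval by the Hausdorff property, and
  open by uniqueness in a chart.\<close>

lemma integral_curves_agree:
  assumes X: "smooth_vf A X" and c: "integral_curve_on A X c1 {a<..<b}" "integral_curve_on A X c2 {a<..<b}"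
    and t: "t1 \<in> {a<..<b}" "c1 t1 = c2 t1" "t \<in> {a<..<b}"
  shows "c1 t = c2 t"
proof -
  let ?J = "{a<..<b}"
  let ?Z = "{t \<in> ?J. c1 t = c2 t}"
  have cont: "isCont c t" if "integral_curve_on A X c ?J" "t \<in> ?J" for c t
    using that by (intro integral_curve_isCont) auto
  have "open ?Z"
  proof (subst open_subopen, intro ballI)
    fix t0 assume t0: "t0 \<in> ?Z"
    let ?C = "chart_at A (c1 t0)"
    obtain r \<beta> where "0 < r" "cball (chart_map ?C (c1 t0)) (2 * r) \<subseteq> chart_img ?C" "smooth_on UNIV \<beta>"
      "\<And>x. x \<in> ball (chart_map ?C (c1 t0)) r \<Longrightarrow> \<beta> x = (1::real)"
      "\<And>x. x \<notin> cball (chart_map ?C (c1 t0)) (2 * r) \<Longrightarrow> \<beta> x = 0"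
      using bump_in_chart[OF chart_at] by metis
    then interpret bumped_chart A ?C "c1 t0" r \<beta>
      using chart_at by unfold_locales
    have "\<forall>\<^sub>F t in nhds t0. c1 t = c2 t"
      using t0 by (intro integral_curves_agree_near[OF X _ _ c]) auto
    moreover have "\<forall>\<^sub>F t in nhds t0. t \<in> ?J"
      using t0 by (intro eventually_nhds_in_open) auto
    ultimately have "\<forall>\<^sub>F t in nhds t0. t \<in> ?Z"
      by eventually_elim auto
    then show "\<exists>T. open T \<and> t0 \<in> T \<and> T \<subseteq> ?Z"
      unfolding eventually_nhds by blast
  qed
  moreover have "open (?J - ?Z)"
  proof (subst open_subopen, intro ballI)
    fix t0 assume t0: "t0 \<in> ?J - ?Z"
    then obtain U V where UV: "open U" "open V" "c1 t0 \<in> U" "c2 t0 \<in> V" "U \<inter> V = {}"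
      using hausdorff[of "c1 t0" "c2 t0"] by auto
    have "\<forall>\<^sub>F t in nhds t0. c1 t \<in> U" "\<forall>\<^sub>F t in nhds t0. c2 t \<in> V"
      using cont[OF c(1)] cont[OF c(2)] UV t0 unfolding isCont_def tendsto_at_iff_tendsto_nhds
      by (auto dest: topological_tendstoD)
    moreover have "\<forall>\<^sub>F t in nhds t0. t \<in> ?J"
      using t0 by (intro eventually_nhds_in_open) auto
    ultimately have "\<forall>\<^sub>F t in nhds t0. t \<in> ?J - ?Z"
      by eventually_elim (use UV in auto)
    then show "\<exists>T. open T \<and> t0 \<in> T \<and> T \<subseteq> ?J - ?Z"
      unfolding eventually_nhds by blast
  qed
  moreover have "connected ?J" by simp
  ultimately have "?Z \<inter> ?J = {} \<or> (?J - ?Z) \<inter> ?J = {}"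
    by (intro connectedD) auto
  then show ?thesis using t by blast
qed

lemma flow_eq:
  assumes X: "smooth_vf A X" and c: "integral_curve_on A X c {a<..<b}" and ab: "a < 0" "0 < b"
    and t: "t \<in> {a<..<b}"
  shows "flow A X t (c 0) = c t"
  unfolding flow_def
proof (rule the_equality)
  show "\<exists>c' a b. a < 0 \<and> 0 < b \<and> t \<in> {a<..<b} \<and> integral_curve_on A X c' {a<..<b} \<and> c' 0 = c 0 \<and> c' t = c t"
    using assms by blast
next
  fix q assume "\<exists>c' a b. a < 0 \<and> 0 < b \<and> t \<in> {a<..<b} \<and> integral_curve_on A X c' {a<..<b} \<and> c' 0 = c 0 \<and> c' t = q"
  then obtain c' a' b' where c': "a' < 0" "0 < b'" "t \<in> {a'<..<b'}" "integral_curve_on A X c' {a'<..<b'}"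
      "c' 0 = c 0" "c' t = q"
    by blast
  let ?a = "max a a'" and ?b = "min b b'"
  have "c' t = c t"
  proof (rule integral_curves_agree[OF X, of _ ?a ?b _ 0])
    show "integral_curve_on A X c' {?a<..<?b}"
      by (rule integral_curve_on_subset[OF c'(4)]) auto
    show "integral_curve_on A X c {?a<..<?b}"
      by (rule integral_curve_on_subset[OF c]) auto
  qed (use ab t c' in auto)
  then show "q = c t" using c' by simp
qed

end

context bumped_chart
begin

text \<open>The cut-off field is bounded and globally Lipschitz, so that one existence time serves all initial points.
  It is taken so short that solutions starting in the inner half of the plateau do not leave the plateau, where
  they are integral curves of \<open>X\<close> itself.\<close>

lemma local_flow_exists:
  assumes X: "smooth_vf A X"
  obtains T Y U K where "0 < T" "0 \<le> K" "\<And>x. Y x 0 = x"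
    "\<And>x s. s \<in> {-T..T} \<Longrightarrow> (Y x has_vector_derivative cutoff X (Y x s)) (at s within {-T..T})"
    "\<And>x s. x \<in> ball x0 (r / 2) \<Longrightarrow> s \<in> {-T..T} \<Longrightarrow> Y x s \<in> ball x0 r"
    "\<And>x s. s \<in> {-T..T} \<Longrightarrow> ((\<lambda>x. Y x s) has_derivative U s x) (at x)"
    "\<And>x s v. s \<in> {-T..T} \<Longrightarrow>
      norm (U s x v - v - s *\<^sub>R frechet_derivative (cutoff X) (at x) v) \<le> K * s\<^sup>2 * norm v"
proof -
  let ?F = "cutoff X"
  note F = smooth_cutoff[OF X] compact_cball[of x0 "2 * r"] cutoff_0
  obtain L where L: "0 \<le> L" "\<And>x v. norm (frechet_derivative ?F (at x) v) \<le> L * norm v"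
      "\<And>x y. norm (?F x - ?F y) \<le> L * norm (x - y)"
    using derivative_bounded_of_compact_support[OF F] by metis
  obtain K where K: "0 \<le> K"
      "\<And>x y v. norm (frechet_derivative ?F (at x) v - frechet_derivative ?F (at y) v) \<le> K * norm (x - y) * norm v"
    using derivative_lipschitz_of_compact_support[OF F] by metis
  obtain B where B: "0 \<le> B" "\<And>x. norm (?F x) \<le> B"
    using bounded_of_compact_support[OF smooth_on_imp_continuous_on[OF F(1)] F(2,3)] by metis
  define T where "T = min (r / (2 * (B + 1))) (1 / (2 * (L + 1)))"
  have T: "0 < T" using r B(1) L(1) by (simp add: T_def)
  have "L * T \<le> L * (1 / (2 * (L + 1)))"
    using L(1) unfolding T_def by (intro mult_left_mono) auto
  also have "\<dots> \<le> 1 / 2" using L(1) by (simp add: field_simps)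
  finally have LT: "L * T \<le> 1 / 2" .
  have "B * T \<le> B * (r / (2 * (B + 1)))"
    using B(1) unfolding T_def by (intro mult_left_mono) auto
  also have "\<dots> \<le> r / 2" using B(1) r by (simp add: field_simps)
  finally have BT: "B * T \<le> r / 2" .
  have T0: "0 \<le> T" using T by simp
  have "\<exists>y. y 0 = x \<and> (\<forall>s\<in>{-T..T}. (y has_vector_derivative ?F (y s)) (at s within {-T..T}))" for x
  proof (rule ode_exists[OF T0 L(1) LT, where f = "\<lambda>s. ?F" and ?y0.0 = x])
    show "continuous_on {-T..T} (\<lambda>s. ?F (u s))" if "continuous_on {-T..T} u" for u
      by (rule continuous_on_compose2[OF smooth_on_imp_continuous_on[OF F(1)] that]) auto
  qed (use L(3) in blast)+
  then have "\<exists>Y. \<forall>x. Y x 0 = x \<and> (\<forall>s\<in>{-T..T}. (Y x has_vector_derivative ?F (Y x s)) (at s within {-T..T}))"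
    by (intro choice) blast
  then obtain Y where Y0: "\<And>x. Y x 0 = x" and
      dY: "\<And>x s. s \<in> {-T..T} \<Longrightarrow> (Y x has_vector_derivative ?F (Y x s)) (at s within {-T..T})"
    by blast
  have stays: "Y x s \<in> ball x0 r" if x: "x \<in> ball x0 (r / 2)" and s: "s \<in> {-T..T}" for x s
  proof -
    have "norm (Y x s - Y x 0) \<le> B * \<bar>s\<bar>"
      using T by (intro vector_derivative_bound[of "- T" T _ _ "\<lambda>s. ?F (Y x s)"] dY B s) auto
    also have "\<dots> \<le> B * T" using s B(1) by (intro mult_left_mono) (auto simp: abs_le_iff)
    finally have "norm (Y x s - x) \<le> r / 2" using BT Y0 by simp
    then have "dist x (Y x s) \<le> r / 2" by (simp add: dist_norm norm_minus_commute)
    then show ?thesis using x dist_triangle[of x0 "Y x s" x] by auto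
  qed
  have dF: "(?F has_derivative frechet_derivative ?F (at x)) (at x)" for x
    using smooth_on_has_derivative[OF F(1)] by blast
  obtain U K' where U: "0 \<le> K'" "\<And>x s. s \<in> {-T..T} \<Longrightarrow> ((\<lambda>x. Y x s) has_derivative U s x) (at x)"
    "\<And>x s v. s \<in> {-T..T} \<Longrightarrow>
      norm (U s x v - v - s *\<^sub>R frechet_derivative (cutoff X) (at x) v) \<le> K' * s\<^sup>2 * norm v"
    by (rule flow_has_derivative[OF T0 LT L(1) K(1) B(1) dF L(2) K(2) B(2) Y0 dY]) blast+
  show thesis
    by (rule that[of T K' Y U]) (fact T U Y0 dY stays)+
qed

lemma integral_curve_of_solution:
  assumes X: "smooth_vf A X" and T: "0 < T"
    and dy: "\<And>s. s \<in> {-T..T} \<Longrightarrow> (y has_vector_derivative cutoff X (y s)) (at s within {-T..T})"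
    and y: "\<And>s. s \<in> {-T..T} \<Longrightarrow> y s \<in> ball x0 r"
  shows "integral_curve_on A X (\<lambda>s. chart_inv C (y s)) {-T<..<T}"
  unfolding integral_curve_on_def
proof
  fix s assume s: "s \<in> {-T<..<T}"
  let ?I = "{-T<..<T}" and ?c = "\<lambda>s. chart_inv C (y s)"
  have y_img: "y s \<in> chart_img C" if "s \<in> {-T..T}" for s
    using y[OF that] plateau_subset by auto
  have dom: "?c s \<in> chart_dom C" using s y_img C by (auto intro: chart_inv_in)
  have "(y has_vector_derivative cutoff X (y s)) (at s within ?I)"
    using s by (intro has_vector_derivative_within_subset[OF dy]) auto
  then have "((\<lambda>s. chart_map C (?c s)) has_vector_derivative cutoff X (y s)) (at s within ?I)"
    by (rule has_vector_derivative_transform[OF s, rotated]) (use y_img C in \<open>auto simp: chart_map_inv\<close>)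
  moreover have "cutoff X (y s) = to_coord A C (?c s) (X (?c s))"
    using s y by (simp add: cutoff_eq vf_coord_def)
  moreover have "continuous_on ?I ?c"
  proof (rule continuous_on_compose2[OF continuous_on_chart_inv[OF C]])
    show "continuous_on ?I y"
      by (rule continuous_on_subset[OF continuous_on_vector_derivative[OF dy]]) auto
  qed (use y_img in auto)
  ultimately show "has_velocity A ?c (X (?c s)) s ?I"
    using s by (subst has_velocity_iff[where C = C and c = ?c, OF C dom s]) (auto simp: continuous_on_eq_continuous_within)
qed

lemma flow_of_solution:
  assumes "smooth_vf A X" "0 < T"
    and "\<And>s. s \<in> {-T..T} \<Longrightarrow> (y has_vector_derivative cutoff X (y s)) (at s within {-T..T})"
    and "\<And>s. s \<in> {-T..T} \<Longrightarrow> y s \<in> ball x0 r" and t: "t \<in> {-T<..<T}"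
  shows "flow A X t (chart_inv C (y 0)) = chart_inv C (y t)"
  using flow_eq[OF assms(1) integral_curve_of_solution[OF assms(1-4)] _ _ t] assms(2) by simp

end

section \<open>Parallel transport in a chart\<close>

context connection_in_chart
begin

text \<open>Along a curve \<open>c\<close> in the plateau, with coordinates \<open>y\<close>, parallelism for the torsion-free connection is a linear
  equation for the components.  The global frame, which is constant in coordinates there, presents the field in the
  form that covariant derivatives along a curve require.\<close>

lemma parallel_along_of_solution:
  assumes S: "\<And>s. s \<in> S \<Longrightarrow> y s \<in> ball x0 r" "\<And>s. s \<in> S \<Longrightarrow> c s = chart_inv C (y s)"
    and dy: "\<And>s. s \<in> S \<Longrightarrow> (y has_vector_derivative y' s) (at s within S)"
    and dw: "\<And>s. s \<in> S \<Longrightarrow> (w has_vector_derivative - christoffel0 (y s) (y' s) (w s)) (at s within S)"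
  shows "parallel_along A (torsion_free_part A nabla) c (\<lambda>s. from_coord A C (c s) (w s)) S"
  unfolding parallel_along_def
proof
  fix t assume t: "t \<in> S"
  have y_img: "y s \<in> chart_img C" if "s \<in> S" for s
    using S(1)[OF that] plateau_subset by auto
  have dom: "c s \<in> chart_dom C" and map: "chart_map C (c s) = y s" if "s \<in> S" for s
    using y_img[OF that] S(2)[OF that] C by (auto simp: chart_inv_in chart_map_inv)
  have velocity: "has_velocity A c (from_coord A C (c t) (y' t)) t S"
  proof (subst has_velocity_iff[where c = c, OF C dom[OF t] t], intro conjI)
    have "continuous_on S (\<lambda>s. chart_inv C (y s))"
      by (rule continuous_on_compose2[OF continuous_on_chart_inv[OF C] continuous_on_vector_derivative[OF dy]])
        (use y_img in auto)
    then have "continuous_on S c" using S(2) by (simp cong: continuous_on_cong)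
    then show "continuous (at t within S) c" using t by (simp add: continuous_on_eq_continuous_within)
    have "((\<lambda>s. chart_map C (c s)) has_vector_derivative y' t) (at t within S)"
      by (rule has_vector_derivative_transform[OF t map dy[OF t]])
    then show "((\<lambda>s. chart_map C (c s)) has_vector_derivative
        to_coord A C (c t) (from_coord A C (c t) (y' t))) (at t within S)"
      by (simp add: to_from_coord C dom t)
  qed
  obtain e where e: "bij_betw e {..<DIM('e)} (Basis :: 'e set)"
    using ex_bij_betw_nat_finite[OF finite_Basis] by (auto simp: lessThan_atLeast0)
  let ?w' = "- christoffel0 (y t) (y' t) (w t)"
  have expand: "from_coord A C (c s) (w s) = (\<Sum>i<DIM('e). (w s \<bullet> e i) *\<^sub>R frame (e i) (c s))" if "s \<in> S" for s
  proof -
    have "(\<Sum>i<DIM('e). (w s \<bullet> e i) *\<^sub>R frame (e i) (c s)) = (\<Sum>b\<in>Basis. (w s \<bullet> b) *\<^sub>R frame b (c s))"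
      by (rule sum.reindex_bij_betw[OF e])
    also have "\<dots> = from_coord A C (c s) (\<Sum>b\<in>Basis. (w s \<bullet> b) *\<^sub>R b)"
      using S that dom[OF that] C
      by (simp add: frame_eq linear_sum[OF linear_from_coord] linear_scale[OF linear_from_coord] del: euclidean_representation)
    finally show ?thesis by (simp add: euclidean_representation)
  qed
  have zero: "(\<Sum>i<DIM('e). (?w' \<bullet> e i) *\<^sub>R frame (e i) (c t) + (w t \<bullet> e i) *\<^sub>R
      nabla_at A (torsion_free_part A nabla) (c t) (from_coord A C (c t) (y' t)) (frame (e i))) = 0" (is "?V = 0")
  proof -
    note lin = linear_to_coord[OF C dom[OF t]]
    have "frechet_derivative (vf_coord A C (frame b)) (at (y t)) = (\<lambda>_. 0)" for b
      by (rule frechet_derivative_eqI[OF vf_coord_frame_has_derivative[OF S(1)[OF t]]])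
    then have "to_coord A C (c t) (nabla_at A (torsion_free_part A nabla) (c t) (from_coord A C (c t) (y' t)) (frame b)) =
        christoffel0 (y t) (y' t) b" for b
      using to_coord_nabla_at(2)[OF smooth_frame[of b] dom[OF t], of "from_coord A C (c t) (y' t)"] S t C dom[OF t] map[OF t] frame_eq[OF S(1)[OF t], of b]
      by (simp add: to_from_coord)
    moreover have "to_coord A C (c t) (frame b (c t)) = b" for b
      using S t C dom[OF t] frame_eq[OF S(1)[OF t], of b] by (simp add: to_from_coord)
    ultimately have "to_coord A C (c t) ?V = (\<Sum>i<DIM('e). (?w' \<bullet> e i) *\<^sub>R e i + (w t \<bullet> e i) *\<^sub>R christoffel0 (y t) (y' t) (e i))"
      by (simp add: linear_sum[OF lin] linear_add[OF lin] linear_diff[OF lin] linear_scale[OF lin])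
    also have "\<dots> = (\<Sum>b\<in>Basis. (?w' \<bullet> b) *\<^sub>R b + (w t \<bullet> b) *\<^sub>R christoffel0 (y t) (y' t) b)"
      by (rule sum.reindex_bij_betw[OF e])
    also have "\<dots> = ?w' + christoffel0 (y t) (y' t) (\<Sum>b\<in>Basis. (w t \<bullet> b) *\<^sub>R b)"
      unfolding sum.distrib linear_sum[OF linear_christoffel0] linear_scale[OF linear_christoffel0]
      by (simp only: euclidean_representation)
    also have "\<dots> = 0" by (simp add: euclidean_representation)
    finally show ?thesis
      using to_coord_eq_iff[OF C dom[OF t], of ?V 0] linear_0[OF lin] by simp
  qed
  have "((\<lambda>s. w s \<bullet> b) has_real_derivative (?w' \<bullet> b)) (at t within S)" for b
    using bounded_linear.has_vector_derivative[OF bounded_linear_inner_left dw[OF t]]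
    by (simp add: has_real_derivative_iff_has_vector_derivative)
  then show "has_cov_deriv_along A (torsion_free_part A nabla) c (\<lambda>s. from_coord A C (c s) (w s)) 0 t S"
    unfolding has_cov_deriv_along_def
    using velocity expand zero smooth_frame
    by (intro exI[of _ "from_coord A C (c t) (y' t)"] exI[of _ "DIM('e)"] exI[of _ "\<lambda>i. frame (e i)"]
        exI[of _ "\<lambda>i s. w s \<bullet> e i"] exI[of _ "\<lambda>i. ?w' \<bullet> e i"] exI[of _ 1]) simp
qed

text \<open>Conversely, whatever fields \<open>E i\<close> and coefficients present a parallel field, the Leibniz rule leads to the same
  equation.  The interval must not be a point, since there velocities are not determined by the curve.\<close>

lemma solution_of_parallel_along:
  assumes ab: "a < b"
    and S: "\<And>s. s \<in> {a..b} \<Longrightarrow> y s \<in> ball x0 r" "\<And>s. s \<in> {a..b} \<Longrightarrow> c s = chart_inv C (y s)"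
    and dy: "\<And>s. s \<in> {a..b} \<Longrightarrow> (y has_vector_derivative y' s) (at s within {a..b})"
    and V: "parallel_along A (torsion_free_part A nabla) c V {a..b}"
    and t: "t \<in> {a..b}"
  shows "((\<lambda>s. to_coord A C (c s) (V s)) has_vector_derivative
    - christoffel0 (y t) (y' t) (to_coord A C (c t) (V t))) (at t within {a..b})"
proof -
  have y_img: "y s \<in> chart_img C" if "s \<in> {a..b}" for s
    using S(1)[OF that] plateau_subset by auto
  have dom: "c s \<in> chart_dom C" and map: "chart_map C (c s) = y s" if "s \<in> {a..b}" for s
    using y_img[OF that] S(2)[OF that] C by (auto simp: chart_inv_in chart_map_inv)
  note lin = linear_to_coord[OF C dom]
  have "has_cov_deriv_along A (torsion_free_part A nabla) c V 0 t {a..b}"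
    using V t by (simp add: parallel_along_def)
  then obtain u \<epsilon> and n :: nat and E a' a'' where u: "has_velocity A c u t {a..b}" and \<epsilon>: "0 < \<epsilon>"
    and E: "\<And>i. i < n \<Longrightarrow> smooth_vf A (E i)"
    and da: "\<And>i. i < n \<Longrightarrow> (a' i has_real_derivative a'' i) (at t within {a..b})"
    and V_eq: "\<And>s. s \<in> {a..b} \<Longrightarrow> \<bar>s - t\<bar> < \<epsilon> \<Longrightarrow> V s = (\<Sum>i<n. a' i s *\<^sub>R E i (c s))"
    and zero: "0 = (\<Sum>i<n. a'' i *\<^sub>R E i (c t) + a' i t *\<^sub>R nabla_at A (torsion_free_part A nabla) (c t) u (E i))"
    unfolding has_cov_deriv_along_def by blast
  have "((\<lambda>s. chart_map C (c s)) has_vector_derivative to_coord A C (c t) u) (at t within {a..b})"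
    using u has_velocity_iff[where c = c, OF C dom[OF t] t] by blast
  then have "(y has_vector_derivative to_coord A C (c t) u) (at t within {a..b})"
    by (rule has_vector_derivative_transform[OF t, rotated]) (simp add: map)
  then have u': "to_coord A C (c t) u = y' t"
    using vector_derivative_unique_within_closed_interval[of a b t y] ab t dy[OF t] by auto
  define \<eta> where "\<eta> i = vf_coord A C (E i)" for i
  have \<eta>: "to_coord A C (c s) (E i (c s)) = \<eta> i (y s)" if "s \<in> {a..b}" for i s
    using vf_coord_chart_map[OF C dom[OF that], of "E i"] map[OF that] by (simp add: \<eta>_def)
  let ?D = "\<lambda>i. frechet_derivative (\<eta> i) (at (y t)) (y' t)"
  have d\<eta>: "((\<lambda>s. \<eta> i (y s)) has_vector_derivative ?D i) (at t within {a..b})" if "i < n" for i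
  proof -
    have d: "(\<eta> i has_derivative frechet_derivative (\<eta> i) (at (y t))) (at (y t))"
      unfolding \<eta>_def by (rule smooth_on_has_derivative[OF smooth_vfD[OF E[OF that] C] y_img[OF t]])
    have "((\<lambda>s. \<eta> i (y s)) has_derivative (\<lambda>h. frechet_derivative (\<eta> i) (at (y t)) (h *\<^sub>R y' t))) (at t within {a..b})"
      by (rule has_derivative_compose[OF dy[OF t, unfolded has_vector_derivative_def] d])
    then show ?thesis
      by (simp add: has_vector_derivative_def linear_scale[OF has_derivative_linear[OF d]])
  qed
  have "((\<lambda>s. \<Sum>i<n. a' i s *\<^sub>R \<eta> i (y s)) has_vector_derivative
      (\<Sum>i<n. a' i t *\<^sub>R ?D i + a'' i *\<^sub>R \<eta> i (y t))) (at t within {a..b})"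
    by (intro has_vector_derivative_sum has_vector_derivative_scaleR da d\<eta>) auto
  moreover have coord_V: "to_coord A C (c s) (V s) = (\<Sum>i<n. a' i s *\<^sub>R \<eta> i (y s))"
    if "s \<in> {a..b}" "\<bar>s - t\<bar> < \<epsilon>" for s
    unfolding V_eq[OF that] using that(1)
    by (simp add: linear_sum[OF lin[OF that(1)]] linear_scale[OF lin[OF that(1)]] \<eta>[OF that(1)])
  ultimately have "((\<lambda>s. to_coord A C (c s) (V s)) has_vector_derivative
      (\<Sum>i<n. a' i t *\<^sub>R ?D i + a'' i *\<^sub>R \<eta> i (y t))) (at t within {a..b})"
    by (elim has_vector_derivative_transform_within[OF _ \<epsilon> t]) (simp add: dist_real_def)
  moreover have "0 = to_coord A C (c t) 0"
    by (simp add: linear_0[OF lin[OF t]])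
  then have "0 = (\<Sum>i<n. a'' i *\<^sub>R \<eta> i (y t) + a' i t *\<^sub>R (?D i + christoffel0 (y t) (y' t) (\<eta> i (y t))))"
    using to_coord_nabla_at(2)[OF E dom[OF t], of _ u] S(1)[OF t] t
    by (subst (asm) (2) zero) (simp add: linear_sum[OF lin[OF t]] linear_add[OF lin[OF t]] linear_scale[OF lin[OF t]]
        \<eta>[OF t] map[OF t] u' \<eta>_def[symmetric])
  then have "(\<Sum>i<n. a' i t *\<^sub>R ?D i + a'' i *\<^sub>R \<eta> i (y t)) = - (\<Sum>i<n. a' i t *\<^sub>R christoffel0 (y t) (y' t) (\<eta> i (y t)))"
    by (simp add: sum.distrib scaleR_add_right eq_neg_iff_add_eq_0 algebra_simps)
  moreover have "(\<Sum>i<n. a' i t *\<^sub>R christoffel0 (y t) (y' t) (\<eta> i (y t))) = christoffel0 (y t) (y' t) (to_coord A C (c t) (V t))"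
    using coord_V[OF t] \<epsilon> by (simp add: linear_sum[OF linear_christoffel0] linear_scale[OF linear_christoffel0])
  ultimately show ?thesis by simp
qed

text \<open>Existence and uniqueness for the linear equation turn parallel transport into evaluation of a solution.  For
  \<open>t = 0\<close> the interval is a point, over which every field is parallel, but the conditions at the two ends coincide,
  so that the transport is still well-defined and the identity.\<close>

lemma parallel_transport_in_chart:
  assumes T: "0 < T"
    and y: "\<And>s. s \<in> {-T..T} \<Longrightarrow> y s \<in> ball x0 r"
    and c: "\<And>s. s \<in> {-T..T} \<Longrightarrow> c s = chart_inv C (y s)"
    and dy: "\<And>s. s \<in> {-T..T} \<Longrightarrow> (y has_vector_derivative y' s) (at s within {-T..T})"
    and y': "continuous_on {-T..T} y'"
  obtains \<tau> w where "0 < \<tau>" "\<tau> \<le> T" "\<And>v. w v 0 = v"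
    "\<And>v s. s \<in> {-\<tau>..\<tau>} \<Longrightarrow> (w v has_vector_derivative - christoffel0 (y s) (y' s) (w v s)) (at s within {-\<tau>..\<tau>})"
    "\<And>v t. t \<in> {-\<tau>..\<tau>} \<Longrightarrow>
      to_coord A C (c t) (parallel_transport A (torsion_free_part A nabla) c 0 t v) = w (to_coord A C (c 0) v) t"
proof -
  obtain B where B: "\<And>s. s \<in> {-T..T} \<Longrightarrow> norm (y' s) \<le> B"
    using compact_imp_bounded[OF compact_continuous_image[OF y' compact_Icc]] unfolding bounded_iff by blast
  then have B0: "0 \<le> B" using T order_trans[OF norm_ge_zero B[of 0]] by simp
  obtain G where G: "0 \<le> G" "\<And>x u w. x \<in> ball x0 r \<Longrightarrow> norm (christoffel0 x u w) \<le> G * norm u * norm w"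
    using christoffel0_bound by blast
  define L where "L = G * B"
  have L: "0 \<le> L" "norm (christoffel0 (y s) (y' s) v) \<le> L * norm v" if "s \<in> {-T..T}" for s v
  proof -
    show "0 \<le> L" using G(1) B0 by (simp add: L_def)
    have "norm (christoffel0 (y s) (y' s) v) \<le> G * norm (y' s) * norm v" by (rule G(2)[OF y[OF that]])
    also have "\<dots> \<le> G * B * norm v"
      using G(1) B[OF that] by (intro mult_right_mono mult_left_mono) auto
    finally show "norm (christoffel0 (y s) (y' s) v) \<le> L * norm v" by (simp add: L_def)
  qed
  have L0: "0 \<le> L" using L(1)[of 0] T by simp
  define \<tau> where "\<tau> = min T (1 / (2 * (L + 1)))"
  have \<tau>: "0 < \<tau>" "\<tau> \<le> T" using T L0 by (auto simp: \<tau>_def)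
  have "L * \<tau> \<le> L * (1 / (2 * (L + 1)))"
    using L0 unfolding \<tau>_def by (intro mult_left_mono) auto
  also have "\<dots> \<le> 1 / 2" using L0 by (simp add: field_simps)
  finally have L\<tau>: "L * \<tau> \<le> 1 / 2" .
  have sub: "{-\<tau>..\<tau>} \<subseteq> {-T..T}" using \<tau> by auto
  have "\<exists>w. w 0 = v \<and> (\<forall>s\<in>{-\<tau>..\<tau>}. (w has_vector_derivative - christoffel0 (y s) (y' s) (w s)) (at s within {-\<tau>..\<tau>}))" for v
  proof (rule ode_exists[OF less_imp_le[OF \<tau>(1)] L0 L\<tau>, where f = "\<lambda>s w. - christoffel0 (y s) (y' s) w" and ?y0.0 = v])
    show "norm (- christoffel0 (y s) (y' s) v - - christoffel0 (y s) (y' s) w) \<le> L * norm (v - w)" if "s \<in> {-\<tau>..\<tau>}" for s v w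
      using L(2)[of s "w - v"] that sub by (simp add: linear_diff[OF linear_christoffel0] norm_minus_commute subset_iff)
    have img: "y ` {-\<tau>..\<tau>} \<subseteq> chart_img C"
      using y sub plateau_subset by blast
    show "continuous_on {-\<tau>..\<tau>} (\<lambda>s. - christoffel0 (y s) (y' s) (u s))" if "continuous_on {-\<tau>..\<tau>} u" for u
      by (intro continuous_on_minus continuous_on_christoffel0 that img continuous_on_subset[OF y' sub]
          continuous_on_subset[OF continuous_on_vector_derivative[OF dy] sub])
  qed blast
  then have "\<exists>w. \<forall>v. w v 0 = v \<and>
      (\<forall>s\<in>{-\<tau>..\<tau>}. (w v has_vector_derivative - christoffel0 (y s) (y' s) (w v s)) (at s within {-\<tau>..\<tau>}))"
    by (intro choice) blast
  then obtain w where w0: "\<And>v. w v 0 = v" and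
      dw: "\<And>v s. s \<in> {-\<tau>..\<tau>} \<Longrightarrow> (w v has_vector_derivative - christoffel0 (y s) (y' s) (w v s)) (at s within {-\<tau>..\<tau>})"
    by blast
  have dom: "c s \<in> chart_dom C" if "s \<in> {-T..T}" for s
    using y[OF that] plateau_subset C c[OF that] by (auto intro: chart_inv_in)
  have "parallel_transport A (torsion_free_part A nabla) c 0 t v =
      from_coord A C (c t) (w (to_coord A C (c 0) v) t)" if t: "t \<in> {-\<tau>..\<tau>}" for t v
    unfolding parallel_transport_def
  proof (rule the_equality)
    let ?w = "w (to_coord A C (c 0) v)"
    define a b where "a = min 0 t" and "b = max 0 t"
    have S: "closed_segment 0 t = {a..b}"
      by (auto simp: closed_segment_eq_real_ivl a_def b_def)
    have ab: "a \<le> 0" "0 \<le> b" "-\<tau> \<le> a" "b \<le> \<tau>" "0 \<in> {a..b}" "t \<in> {a..b}" "{a..b} \<subseteq> {-\<tau>..\<tau>}"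
      using t by (auto simp: a_def b_def)
    note subT = order_trans[OF ab(7) sub]
    have dyS: "(y has_vector_derivative y' s) (at s within {a..b})" if "s \<in> {a..b}" for s
      using that subT by (intro has_vector_derivative_within_subset[OF dy subT]) auto
    have dwS: "(?w has_vector_derivative - christoffel0 (y s) (y' s) (?w s)) (at s within {a..b})" if "s \<in> {a..b}" for s
      using that ab(7) by (intro has_vector_derivative_within_subset[OF dw ab(7)]) auto
    have yS: "y s \<in> ball x0 r" and cS: "c s = chart_inv C (y s)" if "s \<in> {a..b}" for s
      using subT that y c by (auto dest: subsetD)
    have "parallel_along A (torsion_free_part A nabla) c (\<lambda>s. from_coord A C (c s) (?w s)) {a..b}"
      by (rule parallel_along_of_solution[OF yS cS dyS dwS])
    moreover have "from_coord A C (c 0) (?w 0) = v"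
      using T by (simp add: w0 from_to_coord C dom)
    ultimately show "\<exists>V. parallel_along A (torsion_free_part A nabla) c V (closed_segment 0 t) \<and> V 0 = v \<and>
        V t = from_coord A C (c t) (?w t)"
      unfolding S by blast
    fix z assume "\<exists>V. parallel_along A (torsion_free_part A nabla) c V (closed_segment 0 t) \<and> V 0 = v \<and> V t = z"
    then obtain V where V: "parallel_along A (torsion_free_part A nabla) c V {a..b}" "V 0 = v" "V t = z"
      unfolding S by blast
    show "z = from_coord A C (c t) (?w t)"
    proof (cases "t = 0")
      case True
      then show ?thesis using V T by (simp add: w0 from_to_coord C dom)
    next
      case False
      then have "a < b" by (auto simp: a_def b_def)
      have "to_coord A C (c t) (V t) - ?w t = 0"
      proof (rule ode_zero[OF ab(1-4) L0 L\<tau>, where R = "\<lambda>s. to_coord A C (c s) (V s) - ?w s"])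
        fix s assume s: "s \<in> {a..b}"
        show "((\<lambda>s. to_coord A C (c s) (V s) - ?w s) has_vector_derivative
            - christoffel0 (y s) (y' s) (to_coord A C (c s) (V s)) - - christoffel0 (y s) (y' s) (?w s)) (at s within {a..b})"
          by (intro has_vector_derivative_diff dwS s solution_of_parallel_along[OF \<open>a < b\<close> yS cS dyS V(1)])
        show "norm (- christoffel0 (y s) (y' s) (to_coord A C (c s) (V s)) - - christoffel0 (y s) (y' s) (?w s)) \<le>
            L * norm (to_coord A C (c s) (V s) - ?w s)"
          using L(2)[of s "?w s - to_coord A C (c s) (V s)"] subsetD[OF subT s]
          by (simp add: linear_diff[OF linear_christoffel0] norm_minus_commute)
      qed (use ab V in \<open>auto simp: w0\<close>)
      moreover have "c t \<in> chart_dom C" using dom subsetD[OF subT ab(6)] by blast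
      ultimately show ?thesis
        using V from_to_coord[OF C] by (metis eq_iff_diff_eq_0)
    qed
  qed
  then have PT: "to_coord A C (c t) (parallel_transport A (torsion_free_part A nabla) c 0 t v) =
      w (to_coord A C (c 0) v) t" if "t \<in> {-\<tau>..\<tau>}" for t v
    using that subsetD[OF sub that] by (simp add: to_from_coord C dom del: atLeastAtMost_iff)
  show thesis
    by (rule that[of \<tau> w]) (fact \<tau> w0 dw PT)+
qed

end

section \<open>The symmetric Lie derivative in a chart\<close>

text \<open>By induction on the number of arguments: the expansion of the first argument in the standard basis leaves
  multilinear forms in the other arguments, in which the first one is constant.\<close>

lemma multilinear_product_rule:
  fixes \<Phi> :: "'a::real_normed_vector \<Rightarrow> 'e::euclidean_space list \<Rightarrow> real"
  assumes S: "open S" "x0 \<in> S"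
    and lin: "\<And>x ws i. x \<in> S \<Longrightarrow> length ws = length us \<Longrightarrow> i < length us \<Longrightarrow> linear (\<lambda>v. \<Phi> x (ws[i := v]))"
    and D: "\<And>ws. length ws = length us \<Longrightarrow> ((\<lambda>x. \<Phi> x ws) has_derivative D ws) (at x0)"
    and us: "length us' = length us" "\<And>i. i < length us \<Longrightarrow> (us ! i has_derivative us' ! i) (at x0)"
  shows "((\<lambda>x. \<Phi> x (map (\<lambda>u. u x) us)) has_derivative
    (\<lambda>v. D (map (\<lambda>u. u x0) us) v + (\<Sum>i<length us. \<Phi> x0 ((map (\<lambda>u. u x0) us)[i := (us' ! i) v])))) (at x0)"
  using lin D us
proof (induction us arbitrary: us' \<Phi> D)
  case Nil
  then show ?case by simp
next
  case (Cons u us)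
  then obtain u' us'' where us': "us' = u' # us''" "length us'' = length us"
    by (cases us') auto
  have u: "(u has_derivative u') (at x0)"
    using Cons.prems(4)[of 0] us' by simp
  have expand: "\<Phi> x (a # ws) = (\<Sum>b\<in>Basis. (a \<bullet> b) * \<Phi> x (b # ws))"
    if "x \<in> S" "length ws = length us" for x a ws
  proof -
    have lin: "linear (\<lambda>v. \<Phi> x (v # ws))"
      using Cons.prems(1)[of x "0 # ws" 0] that by simp
    have "\<Phi> x ((\<Sum>b\<in>Basis. (a \<bullet> b) *\<^sub>R b) # ws) = (\<Sum>b\<in>Basis. (a \<bullet> b) * \<Phi> x (b # ws))"
      using linear_sum[OF lin, of "\<lambda>b. (a \<bullet> b) *\<^sub>R b" Basis] linear_scale[OF lin] by simp
    then show ?thesis by (simp add: euclidean_representation)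
  qed
  have D_expand: "D (a # ws) v = (\<Sum>b\<in>Basis. (a \<bullet> b) * D (b # ws) v)" if "length ws = length us" for a ws v
  proof -
    have "((\<lambda>x. \<Sum>b\<in>Basis. (a \<bullet> b) * \<Phi> x (b # ws)) has_derivative (\<lambda>v. \<Sum>b\<in>Basis. (a \<bullet> b) * D (b # ws) v)) (at x0)"
      using that by (intro has_derivative_sum has_derivative_mult_right Cons.prems(2)) simp
    then have "((\<lambda>x. \<Phi> x (a # ws)) has_derivative (\<lambda>v. \<Sum>b\<in>Basis. (a \<bullet> b) * D (b # ws) v)) (at x0)"
      by (rule has_derivative_transform_within_open[OF _ S]) (use expand that in simp)
    moreover have "((\<lambda>x. \<Phi> x (a # ws)) has_derivative D (a # ws)) (at x0)"
      using that by (intro Cons.prems(2)) simp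
    ultimately have "D (a # ws) = (\<lambda>v. \<Sum>b\<in>Basis. (a \<bullet> b) * D (b # ws) v)"
      using has_derivative_unique by blast
    then show ?thesis by simp
  qed
  let ?vs = "\<lambda>x. map (\<lambda>u. u x) us"
  have IH: "((\<lambda>x. \<Phi> x (b # ?vs x)) has_derivative
      (\<lambda>v. D (b # ?vs x0) v + (\<Sum>i<length us. \<Phi> x0 (b # (?vs x0)[i := (us'' ! i) v])))) (at x0)" for b
  proof (rule Cons.IH[where \<Phi> = "\<lambda>x ws. \<Phi> x (b # ws)" and D = "\<lambda>ws. D (b # ws)"])
    show "linear (\<lambda>v. \<Phi> x (b # ws[i := v]))" if "x \<in> S" "length ws = length us" "i < length us" for x ws i
      using Cons.prems(1)[of x "b # ws" "Suc i"] that by simp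
    show "((\<lambda>x. \<Phi> x (b # ws)) has_derivative D (b # ws)) (at x0)" if "length ws = length us" for ws
      using Cons.prems(2)[of "b # ws"] that by simp
    show "(us ! i has_derivative us'' ! i) (at x0)" if "i < length us" for i
      using Cons.prems(4)[of "Suc i"] that us' by simp
  qed (use us' in simp)
  have "((\<lambda>x. \<Sum>b\<in>Basis. (u x \<bullet> b) * \<Phi> x (b # ?vs x)) has_derivative
      (\<lambda>v. \<Sum>b\<in>Basis. (u x0 \<bullet> b) * (D (b # ?vs x0) v + (\<Sum>i<length us. \<Phi> x0 (b # (?vs x0)[i := (us'' ! i) v])))
        + (u' v \<bullet> b) * \<Phi> x0 (b # ?vs x0))) (at x0)"
    by (intro has_derivative_sum has_derivative_mult has_derivative_inner_left u IH)
  then have "((\<lambda>x. \<Phi> x (u x # ?vs x)) has_derivative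
      (\<lambda>v. \<Sum>b\<in>Basis. (u x0 \<bullet> b) * (D (b # ?vs x0) v + (\<Sum>i<length us. \<Phi> x0 (b # (?vs x0)[i := (us'' ! i) v])))
        + (u' v \<bullet> b) * \<Phi> x0 (b # ?vs x0))) (at x0)"
    by (rule has_derivative_transform_within_open[OF _ S]) (simp flip: expand)
  moreover have "(\<Sum>b\<in>Basis. (u x0 \<bullet> b) * (D (b # ?vs x0) v + (\<Sum>i<length us. \<Phi> x0 (b # (?vs x0)[i := (us'' ! i) v])))
        + (u' v \<bullet> b) * \<Phi> x0 (b # ?vs x0)) =
      D (u x0 # ?vs x0) v + (\<Phi> x0 (u' v # ?vs x0) + (\<Sum>i<length us. \<Phi> x0 (u x0 # (?vs x0)[i := (us'' ! i) v])))" for v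
  proof -
    have "(\<Sum>b\<in>Basis. (u x0 \<bullet> b) * (\<Sum>i<length us. \<Phi> x0 (b # (?vs x0)[i := (us'' ! i) v]))) =
        (\<Sum>i<length us. \<Phi> x0 (u x0 # (?vs x0)[i := (us'' ! i) v]))"
      unfolding sum_distrib_left by (subst sum.swap) (simp flip: expand[OF S(2)])
    then show ?thesis
      by (simp add: distrib_left sum.distrib flip: expand[OF S(2)] D_expand)
  qed
  ultimately show ?case
    by (simp add: us' sum.lessThan_Suc_shift del: sum.lessThan_Suc)
qed

context smooth_manifold
begin

definition tensor_coord :: "('m, 'e) chart \<Rightarrow> ('m \<Rightarrow> 'e ptensor) \<Rightarrow> 'e \<Rightarrow> 'e ptensor" where
  "tensor_coord C \<phi> x us = \<phi> (chart_inv C x) (map (from_coord A C (chart_inv C x)) us)"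

lemma
  assumes "\<phi> \<in> sym_tensor_fields A"
  shows sym_tensor_linear: "i < length vs \<Longrightarrow> linear (\<lambda>v. \<phi> p (vs[i := v]))"
    and sym_tensor_mset: "mset ws = mset vs \<Longrightarrow> \<phi> p ws = \<phi> p vs"
    and smooth_tensor_coord: "C \<in> A \<Longrightarrow> smooth_on (chart_img C) (\<lambda>x. tensor_coord C \<phi> x us)"
  using assms unfolding sym_tensor_fields_def sym_tensor_field_deg_def sym_multilinear_def tensor_coord_def
  by blast+

lemma tensor_coord_linear:
  assumes "\<phi> \<in> sym_tensor_fields A" "C \<in> A" "x \<in> chart_img C" "i < length us"
  shows "linear (\<lambda>v. tensor_coord C \<phi> x (us[i := v]))"
proof -
  have "linear (\<lambda>v. \<phi> (chart_inv C x) ((map (from_coord A C (chart_inv C x)) us)[i := v]))"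
    using assms by (intro sym_tensor_linear) auto
  from linear_compose[OF linear_from_coord[OF assms(2) chart_inv_in[OF assms(2,3)]] this]
  show ?thesis by (simp add: tensor_coord_def map_update o_def)
qed

lemma tensor_coord_vf_coord:
  assumes "C \<in> A" "x \<in> chart_img C"
  shows "tensor_coord C \<phi> x (map (\<lambda>V. vf_coord A C V x) Vs) = \<phi> (chart_inv C x) (map (\<lambda>V. V (chart_inv C x)) Vs)"
  using assms by (simp add: tensor_coord_def vf_coord_def o_def from_to_coord chart_inv_in)

end

context connection_in_chart
begin

context
  fixes \<phi> :: "'m \<Rightarrow> 'e ptensor"
  assumes \<phi>: "\<phi> \<in> sym_tensor_fields A" and C_eq: "C = chart_at A m"
begin

lemma vf_coord_x0: "vf_coord A C V x0 = V m"
  using vf_coord_chart_map[OF C m] by (simp add: C_eq to_coord_chart_at)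

lemma tensor_coord_x0: "tensor_coord C \<phi> x0 us = \<phi> m us"
proof -
  have "from_coord A C m = (\<lambda>v. v)" by (simp add: fun_eq_iff C_eq from_coord_chart_at)
  then show ?thesis by (simp add: tensor_coord_def chart_inv_map C m)
qed

abbreviation D\<phi> :: "'e list \<Rightarrow> 'e \<Rightarrow> real" where
  "D\<phi> us \<equiv> frechet_derivative (\<lambda>x. tensor_coord C \<phi> x us) (at x0)"

lemma tensor_coord_has_derivative: "((\<lambda>x. tensor_coord C \<phi> x us) has_derivative D\<phi> us) (at x0)"
  by (rule smooth_on_has_derivative[OF smooth_tensor_coord[OF \<phi> C] chart_map_in[OF m]])

lemma dfun_tensor:
  assumes Vs: "\<And>V. V \<in> set Vs \<Longrightarrow> smooth_vf A V"
  shows "dfun A (\<lambda>q. \<phi> q (map (\<lambda>V. V q) Vs)) m v = D\<phi> (map (\<lambda>V. V m) Vs) v +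
    (\<Sum>i<length Vs. \<phi> m ((map (\<lambda>V. V m) Vs)[i := frechet_derivative (vf_coord A C (Vs ! i)) (at x0) v]))"
proof -
  let ?us = "map (vf_coord A C) Vs"
  let ?us' = "map (\<lambda>V. frechet_derivative (vf_coord A C V) (at x0)) Vs"
  have "((\<lambda>x. tensor_coord C \<phi> x (map (\<lambda>u. u x) ?us)) has_derivative
      (\<lambda>v. D\<phi> (map (\<lambda>u. u x0) ?us) v +
        (\<Sum>i<length ?us. tensor_coord C \<phi> x0 ((map (\<lambda>u. u x0) ?us)[i := (?us' ! i) v])))) (at x0)"
  proof (rule multilinear_product_rule[OF open_chart_img[OF C] chart_map_in[OF m]])
    show "linear (\<lambda>v. tensor_coord C \<phi> x (ws[i := v]))"
      if "x \<in> chart_img C" "length ws = length ?us" "i < length ?us" for x ws i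
      using that by (intro tensor_coord_linear \<phi> C) auto
    show "(?us ! i has_derivative ?us' ! i) (at x0)" if "i < length ?us" for i
      using that smooth_on_has_derivative[OF smooth_vfD[OF Vs C] chart_map_in[OF m]] by simp
  qed (auto intro: tensor_coord_has_derivative)
  then have "((\<lambda>q. \<phi> q (map (\<lambda>V. V q) Vs)) \<circ> chart_inv C has_derivative
      (\<lambda>v. D\<phi> (map (\<lambda>u. u x0) ?us) v +
        (\<Sum>i<length ?us. tensor_coord C \<phi> x0 ((map (\<lambda>u. u x0) ?us)[i := (?us' ! i) v])))) (at x0)"
    by (rule has_derivative_transform_within_open[OF _ open_chart_img[OF C] chart_map_in[OF m]])
      (simp add: o_def tensor_coord_vf_coord C)
  from frechet_derivative_eqI[OF this] show ?thesis
    by (simp add: dfun_def tensor_coord_x0 o_def vf_coord_x0 flip: C_eq)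
qed

lemma plateau_m: "chart_map C m \<in> ball x0 r"
  using r by simp

lemma nabla_at_m:
  assumes "smooth_vf A Y"
  shows "nabla_at A nabla m v Y = frechet_derivative (vf_coord A C Y) (at x0) v + christoffel x0 v (Y m)"
  using to_coord_nabla_at(1)[OF assms m plateau_m, of v] by (simp add: C_eq to_coord_chart_at)

lemma sym_tensor_add:
  "i < length vs \<Longrightarrow> \<phi> p (vs[i := v + w]) = \<phi> p (vs[i := v]) + \<phi> p (vs[i := w])"
  using linear_add[OF sym_tensor_linear[OF \<phi>]] .

text \<open>The derivatives of the auxiliary extensions of the arguments cancel.\<close>

lemma nabla_tensor_m:
  "nabla_tensor A nabla \<phi> m v vs = D\<phi> vs v - (\<Sum>i<length vs. \<phi> m (vs[i := christoffel x0 v (vs ! i)]))"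
proof -
  let ?Vs = "map (extend_vf A m) vs"
  have at_m: "map (\<lambda>V. V m) ?Vs = vs" by (simp add: o_def extend_vf)
  have "dfun A (\<lambda>q. \<phi> q (map (\<lambda>V. V q) ?Vs)) m v = D\<phi> vs v +
      (\<Sum>i<length vs. \<phi> m (vs[i := frechet_derivative (vf_coord A C (extend_vf A m (vs ! i))) (at x0) v]))"
    by (subst dfun_tensor) (auto simp: at_m extend_vf simp del: map_map)
  moreover have "(\<lambda>q. \<phi> q (map (\<lambda>V. V q) ?Vs)) = (\<lambda>q. \<phi> q (map (\<lambda>w. extend_vf A m w q) vs))"
    by (simp add: o_def)
  moreover have "\<phi> m (vs[i := nabla_at A nabla m v (extend_vf A m (vs ! i))]) =
      \<phi> m (vs[i := frechet_derivative (vf_coord A C (extend_vf A m (vs ! i))) (at x0) v]) +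
      \<phi> m (vs[i := christoffel x0 v (vs ! i)])" if "i < length vs" for i
    using that by (simp add: nabla_at_m extend_vf sym_tensor_add)
  ultimately show ?thesis
    by (simp add: nabla_tensor_def sum.distrib)
qed

text \<open>When contraction comes first, \<open>X\<close> belongs to the tensor that is differentiated and not to its arguments; by the
  Leibniz rule the derivative then falls on \<open>X\<close> as well.\<close>

lemma nabla_tensor_contract_m:
  assumes X: "smooth_vf A X"
  shows "nabla_tensor A nabla (contract X \<phi>) m v vs = nabla_tensor A nabla \<phi> m v (X m # vs) +
    \<phi> m ((christoffel x0 v (X m) + frechet_derivative (vf_coord A C X) (at x0) v) # vs)"
proof -
  let ?Vs = "map (extend_vf A m) vs"
  let ?DV = "\<lambda>w. frechet_derivative (vf_coord A C (extend_vf A m w)) (at x0) v"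
  have at_m: "map (\<lambda>V. V m) ?Vs = vs" by (simp add: o_def extend_vf)
  have "dfun A (\<lambda>q. \<phi> q (map (\<lambda>V. V q) (X # ?Vs))) m v = D\<phi> (X m # vs) v +
      (\<phi> m (frechet_derivative (vf_coord A C X) (at x0) v # vs) + (\<Sum>i<length vs. \<phi> m (X m # vs[i := ?DV (vs ! i)])))"
    by (subst dfun_tensor) (auto simp: at_m extend_vf X sum.lessThan_Suc_shift simp del: map_map sum.lessThan_Suc)
  moreover have "(\<lambda>q. \<phi> q (map (\<lambda>V. V q) (X # ?Vs))) = (\<lambda>q. contract X \<phi> q (map (\<lambda>w. extend_vf A m w q) vs))"
    by (simp add: o_def contract_def)
  moreover have "contract X \<phi> m (vs[i := nabla_at A nabla m v (extend_vf A m (vs ! i))]) =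
      \<phi> m (X m # vs[i := ?DV (vs ! i)]) + \<phi> m (X m # vs[i := christoffel x0 v (vs ! i)])" if "i < length vs" for i
    using that sym_tensor_add[of "Suc i" "X m # vs" m "?DV (vs ! i)" "christoffel x0 v (vs ! i)"]
    by (simp add: nabla_at_m extend_vf contract_def)
  moreover have "\<phi> m ((christoffel x0 v (X m) + frechet_derivative (vf_coord A C X) (at x0) v) # vs) =
      \<phi> m (christoffel x0 v (X m) # vs) + \<phi> m (frechet_derivative (vf_coord A C X) (at x0) v # vs)"
    using sym_tensor_add[of 0 "X m # vs" m "christoffel x0 v (X m)"] by simp
  ultimately show ?thesis
    by (simp add: nabla_tensor_m[of v "X m # vs"] nabla_tensor_def[of _ _ "contract X \<phi>"] sum.distrib sum.lessThan_Suc_shift del: sum.lessThan_Suc)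
qed

text \<open>By the symmetry of \<open>\<phi>\<close> the terms that differentiate in the direction of an argument \<open>v\<close> of \<open>\<phi>\<close> can be collected
  in the slot of \<open>v\<close>.  There the Christoffel symbols in both orders of \<open>X\<close> and \<open>v\<close> add up to twice their symmetric part,
  so that the result depends on the torsion-free connection alone.\<close>

lemma sym_lie_deriv_m:
  assumes X: "smooth_vf A X"
  shows "sym_lie_deriv A nabla X \<phi> m vs = D\<phi> vs (X m) + (\<Sum>i<length vs.
    \<phi> m (vs[i := - (2 *\<^sub>R christoffel0 x0 (X m) (vs ! i) + frechet_derivative (vf_coord A C X) (at x0) (vs ! i))]))"
proof -
  let ?rest = "\<lambda>j. take j vs @ drop (Suc j) vs"
  let ?DX = "frechet_derivative (vf_coord A C X) (at x0)"
  have "sym_deriv A nabla \<phi> m (X m # vs) = nabla_tensor A nabla \<phi> m (X m) vs +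
      (\<Sum>j<length vs. nabla_tensor A nabla \<phi> m (vs ! j) (X m # ?rest j))"
    by (simp add: sym_deriv_def sum.lessThan_Suc_shift del: sum.lessThan_Suc)
  then have "sym_lie_deriv A nabla X \<phi> m vs = nabla_tensor A nabla \<phi> m (X m) vs -
      (\<Sum>j<length vs. \<phi> m ((christoffel x0 (vs ! j) (X m) + ?DX (vs ! j)) # ?rest j))"
    by (simp add: sym_lie_deriv_def contract_def[of X "sym_deriv A nabla \<phi>"] sym_deriv_def[of _ _ "contract X \<phi>"]
        nabla_tensor_contract_m[OF X] sum.distrib)
  also have "(\<Sum>j<length vs. \<phi> m ((christoffel x0 (vs ! j) (X m) + ?DX (vs ! j)) # ?rest j)) =
      (\<Sum>j<length vs. \<phi> m (vs[j := christoffel x0 (vs ! j) (X m) + ?DX (vs ! j)]))"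
    by (intro sum.cong sym_tensor_mset[OF \<phi>]) (auto simp: upd_conv_take_nth_drop)
  also have "nabla_tensor A nabla \<phi> m (X m) vs - \<dots> = D\<phi> vs (X m) + (\<Sum>i<length vs.
      - (\<phi> m (vs[i := christoffel x0 (X m) (vs ! i)]) + \<phi> m (vs[i := christoffel x0 (vs ! i) (X m) + ?DX (vs ! i)])))"
    by (simp add: nabla_tensor_m sum.distrib sum_negf sum_subtractf)
  also have "(\<Sum>i<length vs.
      - (\<phi> m (vs[i := christoffel x0 (X m) (vs ! i)]) + \<phi> m (vs[i := christoffel x0 (vs ! i) (X m) + ?DX (vs ! i)]))) =
      (\<Sum>i<length vs. \<phi> m (vs[i := - (2 *\<^sub>R christoffel0 x0 (X m) (vs ! i) + ?DX (vs ! i))]))"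
  proof (rule sum.cong[OF refl])
    fix i assume "i \<in> {..<length vs}"
    then have i: "i < length vs" by simp
    have "\<phi> m (vs[i := - (2 *\<^sub>R christoffel0 x0 (X m) (vs ! i) + ?DX (vs ! i))]) =
        - \<phi> m (vs[i := christoffel x0 (X m) (vs ! i) + (christoffel x0 (vs ! i) (X m) + ?DX (vs ! i))])"
      using linear_neg[OF sym_tensor_linear[OF \<phi> i]] by (simp add: christoffel0_def add.assoc del: minus_add_distrib)
    then show "- (\<phi> m (vs[i := christoffel x0 (X m) (vs ! i)]) + \<phi> m (vs[i := christoffel x0 (vs ! i) (X m) + ?DX (vs ! i)])) =
        \<phi> m (vs[i := - (2 *\<^sub>R christoffel0 x0 (X m) (vs ! i) + ?DX (vs ! i))])"
      using i by (simp only: sym_tensor_add)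
  qed
  finally show ?thesis .
qed

end

end

section \<open>The derivative of the transported pullback\<close>

lemma has_vector_derivative_shift:
  assumes "(f has_vector_derivative f') (at (d + s))"
  shows "((\<lambda>s. f (d + s)) has_vector_derivative f') (at (s::real))"
proof -
  have "((\<lambda>s. d + s) has_vector_derivative 1) (at s)"
    by (auto intro!: derivative_eq_intros)
  from vector_diff_chain_at[OF this assms] show ?thesis by (simp add: o_def)
qed

lemma has_vector_derivative_mult_scaleR:
  fixes k :: "real \<Rightarrow> 'a::real_normed_vector"
  assumes p: "(p has_vector_derivative p') (at 0)" and k: "(k \<longlongrightarrow> l) (at 0)"
  shows "((\<lambda>t. p t + t *\<^sub>R k t) has_vector_derivative (p' + l)) (at 0)"
proof -
  have "((\<lambda>t. t *\<^sub>R k t) has_derivative (\<lambda>t. t *\<^sub>R l)) (at 0)"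
    unfolding has_derivative_at
  proof
    have "((\<lambda>h. norm (k h - l)) \<longlongrightarrow> 0) (at 0)"
      using k tendsto_norm_zero LIM_zero by blast
    moreover have "norm (h *\<^sub>R k h - h *\<^sub>R l) / norm h = norm (k h - l)" if "h \<noteq> 0" for h
      using that by (simp flip: scaleR_diff_right)
    then have "\<forall>\<^sub>F h in at 0. norm (k h - l) = norm ((0 + h) *\<^sub>R k (0 + h) - 0 *\<^sub>R k 0 - h *\<^sub>R l) / norm h"
      by (auto simp: eventually_at_filter)
    ultimately show "(\<lambda>h. norm ((0 + h) *\<^sub>R k (0 + h) - 0 *\<^sub>R k 0 - h *\<^sub>R l) / norm h) \<midarrow>0\<rightarrow> 0"
      by (rule Lim_transform_eventually)
  qed (simp add: bounded_linear_scaleR_left)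
  then show ?thesis
    using has_vector_derivative_add[OF p] by (simp add: has_vector_derivative_def)
qed

lemma (in smooth_manifold) integral_curve_shift:
  assumes "integral_curve_on A X c {a<..<b}"
  shows "integral_curve_on A X (\<lambda>s. c (d + s)) {a - d<..<b - d}"
  unfolding integral_curve_on_def
proof
  fix s assume s: "s \<in> {a - d<..<b - d}"
  then have ds: "d + s \<in> {a<..<b}" by auto
  then have "has_velocity A c (X (c (d + s))) (d + s) {a<..<b}"
    using assms by (simp add: integral_curve_on_def)
  then have v: "isCont c (d + s)"
      "((\<lambda>s'. chart_map (chart_at A (c (d + s))) (c s')) has_vector_derivative X (c (d + s))) (at (d + s))"
    unfolding has_velocity_def at_within_open[OF ds open_greaterThanLessThan] by auto
  have "isCont (\<lambda>s. c (d + s)) s"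
    by (rule isCont_o2[where f = "\<lambda>s. d + s", OF _ v(1)]) (intro continuous_intros)
  then show "has_velocity A (\<lambda>s. c (d + s)) (X (c (d + s))) s {a - d<..<b - d}"
    unfolding has_velocity_def at_within_open[OF s open_greaterThanLessThan]
    using has_vector_derivative_shift[OF v(2)] by auto
qed

context connection_in_chart
begin

text \<open>Near time zero the function is the tensor \<open>\<phi>\<close> in coordinates, evaluated at the moving base point on moving
  arguments, and the product rule for multilinear forms applies.\<close>

lemma transported_pullback_derivative:
  fixes vs :: "'e list"
  assumes \<phi>: "\<phi> \<in> sym_tensor_fields A" and C_eq: "C = chart_at A m" and X: "smooth_vf A X"
  defines "g \<equiv> \<lambda>t. tensor_transport A (torsion_free_part A nabla) (\<lambda>s. flow A X s m) (2 * t) 0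
               (pullback_at A (flow A X (- t)) (flow A X (2 * t) m) (\<phi> (flow A X t m))) vs"
  shows "(g has_real_derivative sym_lie_deriv A nabla X \<phi> m vs) (at 0)" and "g 0 = \<phi> m vs"
proof -
  let ?F = "cutoff X"
  obtain T Y U K where T: "0 < T" and K: "0 \<le> K" and Y0: "\<And>x. Y x 0 = x"
    and dY: "\<And>x s. s \<in> {-T..T} \<Longrightarrow> (Y x has_vector_derivative ?F (Y x s)) (at s within {-T..T})"
    and Y_in: "\<And>x s. x \<in> ball x0 (r / 2) \<Longrightarrow> s \<in> {-T..T} \<Longrightarrow> Y x s \<in> ball x0 r"
    and dU: "\<And>x s. s \<in> {-T..T} \<Longrightarrow> ((\<lambda>x. Y x s) has_derivative U s x) (at x)"
    and U: "\<And>x s v. s \<in> {-T..T} \<Longrightarrow>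
      norm (U s x v - v - s *\<^sub>R frechet_derivative ?F (at x) v) \<le> K * s\<^sup>2 * norm v"
    by (rule local_flow_exists[OF X]) blast
  define y where "y = Y x0"
  have x0: "x0 \<in> ball x0 (r / 2)" using r by simp
  have y0: "y 0 = x0" by (simp add: y_def Y0)
  have y_in: "y s \<in> ball x0 r" if "s \<in> {-T..T}" for s
    unfolding y_def by (rule Y_in[OF x0 that])
  have dy: "(y has_vector_derivative ?F (y s)) (at s within {-T..T})" if "s \<in> {-T..T}" for s
    unfolding y_def by (rule dY[OF that])
  define c where "c s = flow A X s m" for s
  have c_eq: "c s = chart_inv C (y s)" if "s \<in> {-T<..<T}" for s
    using flow_of_solution[OF X T dy y_in that] by (simp add: c_def y0 chart_inv_map C m)
  have Fx0: "?F x0 = X m"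
    using cutoff_chart_map[OF m] r by (simp add: C_eq to_coord_chart_at)
  have dF_eq: "frechet_derivative ?F (at x0) = frechet_derivative (vf_coord A C X) (at x0)"
  proof (rule frechet_derivative_eqI)
    show "(?F has_derivative frechet_derivative (vf_coord A C X) (at x0)) (at x0)"
      by (rule has_derivative_transform_within_open[OF smooth_on_has_derivative[OF smooth_vfD[OF X C] chart_map_in[OF m]]
            open_ball, of x0 r]) (use r in \<open>auto simp: cutoff_eq\<close>)
  qed
  define T' where "T' = T / 2"
  have T': "0 < T'" "{-T'..T'} \<subseteq> {-T..T}" "{-T'..T'} \<subseteq> {-T<..<T}"
    using T by (auto simp: T'_def)
  obtain \<tau> w where \<tau>: "0 < \<tau>" "\<tau> \<le> T'" and w0: "\<And>v. w v 0 = v"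
    and dw: "\<And>v s. s \<in> {-\<tau>..\<tau>} \<Longrightarrow> (w v has_vector_derivative - christoffel0 (y s) (?F (y s)) (w v s)) (at s within {-\<tau>..\<tau>})"
    and PT: "\<And>v t. t \<in> {-\<tau>..\<tau>} \<Longrightarrow>
      to_coord A C (c t) (parallel_transport A (torsion_free_part A nabla) c 0 t v) = w (to_coord A C (c 0) v) t"
  proof (rule parallel_transport_in_chart[OF T'(1), of y c "\<lambda>s. ?F (y s)"])
    show "y s \<in> ball x0 r" "c s = chart_inv C (y s)"
      "(y has_vector_derivative ?F (y s)) (at s within {-T'..T'})" if "s \<in> {-T'..T'}" for s
      using that T' y_in c_eq has_vector_derivative_within_subset[OF dy T'(2)] by blast+
    show "continuous_on {-T'..T'} (\<lambda>s. ?F (y s))"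
      by (rule continuous_on_compose2[OF smooth_on_imp_continuous_on[OF smooth_cutoff[OF X]]
            continuous_on_subset[OF continuous_on_vector_derivative[OF dy] T'(2)]]) auto
  qed (use that in blast)
  have dy0: "(y has_vector_derivative X m) (at 0)"
    using dy[of 0] T by (simp add: y0 Fx0 at_within_Icc_at)
  have dw0: "(w v has_vector_derivative - christoffel0 x0 (X m) v) (at 0)" for v
    using dw[of 0 v] \<tau> by (simp add: y0 w0 Fx0 at_within_Icc_at)
  define z where "z v t = U (- t) (y (2 * t)) (w v (2 * t))" for v t
  let ?g = "\<lambda>t. tensor_coord C \<phi> (y t) (map (\<lambda>v. z v t) vs)"

  have cont2: "((\<lambda>t. f (2 * t)) \<longlongrightarrow> f 0) (at 0)" if "(f has_vector_derivative f') (at 0)"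
    for f :: "real \<Rightarrow> 'e" and f'
  proof -
    have "isCont f 0"
      by (rule has_vector_derivative_continuous[OF that])
    moreover have "((\<lambda>t. 2 * t) \<longlongrightarrow> (0::real)) (at 0)"
      by (rule tendsto_eq_intros refl)+ simp
    ultimately show ?thesis by (rule isCont_tendsto_compose)
  qed
  \<comment> \<open>For small \<open>t\<close> the flow, its tangent map and the parallel transport are those of the chart.\<close>
  have "\<forall>\<^sub>F t in at 0. y (2 * t) \<in> ball x0 (r / 2)"
    by (rule topological_tendstoD[OF cont2[OF dy0] open_ball]) (simp only: y0 x0)
  then have "\<forall>\<^sub>F t in nhds 0. y (2 * t) \<in> ball x0 (r / 2)"
    unfolding eventually_nhds_conv_at using x0 by (simp only: mult_zero_right y0)
  moreover have "\<forall>\<^sub>F t in nhds (0::real). t \<in> {-\<tau> / 2 <..< \<tau> / 2}"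
    using \<tau> by (intro eventually_nhds_in_open) auto
  ultimately have g_eq: "\<forall>\<^sub>F t in nhds 0. g t = ?g t"
  proof eventually_elim
    case (elim t)
    then have t: "2 * t \<in> {-\<tau>..\<tau>}" "2 * t \<in> {-T<..<T}" "t \<in> {-T<..<T}" "- t \<in> {-T<..<T}" "- t \<in> {-T..T}"
      using \<tau> T by (auto simp: T'_def)
    let ?q = "c (2 * t)" and ?flow = "flow A X (- t)"
    have y2t: "y (2 * t) \<in> chart_img C" and yt: "y t \<in> chart_img C"
      using y_in[of "2 * t"] y_in[of t] t plateau_subset by auto
    have q: "?q \<in> chart_dom C" "chart_map C ?q = y (2 * t)"
      using c_eq[OF t(2)] y2t C by (auto simp: chart_inv_in chart_map_inv)
    have flow_q: "?flow ?q = c t"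
    proof -
      let ?c = "\<lambda>s. chart_inv C (y s)"
      have "integral_curve_on A X (\<lambda>s. ?c (2 * t + s)) {- T - 2 * t<..<T - 2 * t}"
        by (rule integral_curve_shift[OF integral_curve_of_solution[OF X T dy y_in]])
      from flow_eq[OF X this, of "- t"] show ?thesis
        using t c_eq[OF t(2)] c_eq[OF t(3)] by simp
    qed
    have dom: "c t \<in> chart_dom C" using c_eq[OF t(3)] yt C by (simp add: chart_inv_in)
    have tangent: "to_coord A C (?flow ?q) (tangent_map A ?flow ?q v) = U (- t) (y (2 * t)) (to_coord A C ?q v)" for v
    proof (rule to_coord_tangent_map[OF C q(1) open_ball])
      show "chart_map C ?q \<in> ball x0 (r / 2)" using q elim by simp
      show "ball x0 (r / 2) \<subseteq> chart_img C" using plateau_subset r by auto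
      show "Y x (- t) \<in> chart_img C \<and> ?flow (chart_inv C x) = chart_inv C (Y x (- t))" if "x \<in> ball x0 (r / 2)" for x
        using flow_of_solution[OF X T dY Y_in[OF that] t(4)] Y_in[OF that t(5)] plateau_subset by (auto simp: Y0)
      show "((\<lambda>x. Y x (- t)) has_derivative U (- t) (y (2 * t))) (at (chart_map C ?q))"
        using dU[OF t(5)] q by simp
    qed
    have "tangent_map A ?flow ?q (parallel_transport A (torsion_free_part A nabla) c 0 (2 * t) v) =
        from_coord A C (c t) (z v t)" for v
    proof -
      have "c 0 = m" using c_eq[of 0] T by (simp add: y0 chart_inv_map C m)
      then have "to_coord A C (c t) (tangent_map A ?flow ?q (parallel_transport A (torsion_free_part A nabla) c 0 (2 * t) v)) = z v t"
        using tangent PT[OF t(1)] flow_q by (simp add: z_def C_eq to_coord_chart_at)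
      then show ?thesis using from_to_coord[OF C dom] by metis
    qed
    moreover have "chart_inv C (y t) = c t" using c_eq[OF t(3)] by simp
    ultimately show ?case
      by (simp add: g_def tensor_transport_def pullback_at_def tensor_coord_def o_def flip: c_def)
  qed

  \<comment> \<open>The tangent map of the flow contributes the derivative of \<open>X\<close>, and the transport over time \<open>2t\<close> contributes
    twice the Christoffel term.\<close>
  have dz: "(z v has_vector_derivative - (2 *\<^sub>R christoffel0 x0 (X m) v + frechet_derivative (vf_coord A C X) (at x0) v)) (at 0)" for v
  proof -
    let ?h = "\<lambda>t. frechet_derivative ?F (at (y (2 * t))) (w v (2 * t))"
    have z_exp: "norm (z v t - w v (2 * t) + t *\<^sub>R ?h t) \<le> K * t\<^sup>2 * norm (w v (2 * t))" if "\<bar>t\<bar> < T" for t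
      using U[of "- t" "y (2 * t)" "w v (2 * t)"] that by (simp add: z_def abs_less_iff less_imp_le)
    have z0: "z v 0 = v"
      using z_exp[of 0] T by (simp add: w0)
    define k where "k t = (1 / t) *\<^sub>R (z v t - w v (2 * t))" for t
    have w_lim: "((\<lambda>t. w v (2 * t)) \<longlongrightarrow> v) (at 0)"
      using cont2[OF dw0, of v] by (simp add: w0)
    have y_lim: "((\<lambda>t. y (2 * t)) \<longlongrightarrow> x0) (at 0)"
      using cont2[OF dy0] by (simp add: y0)
    have "isCont (\<lambda>x. frechet_derivative ?F (at x) b) x0" for b
      using smooth_on_imp_continuous_on[OF smooth_on_derivative[OF smooth_cutoff[OF X]]]
      by (simp add: continuous_on_eq_continuous_at)
    then have "((\<lambda>t. \<Sum>b\<in>Basis. (w v (2 * t) \<bullet> b) *\<^sub>R frechet_derivative ?F (at (y (2 * t))) b) \<longlongrightarrow>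
        (\<Sum>b\<in>Basis. (v \<bullet> b) *\<^sub>R frechet_derivative ?F (at x0) b)) (at 0)"
      by (intro tendsto_sum tendsto_scaleR tendsto_inner tendsto_const w_lim isCont_tendsto_compose[OF _ y_lim])
    then have h_lim: "(?h \<longlongrightarrow> frechet_derivative ?F (at x0) v) (at 0)"
      by (simp only: frechet_derivative_basis_sum[OF smooth_on_imp_differentiable[OF smooth_cutoff[OF X] UNIV_I], symmetric])
    have "((\<lambda>t. k t + ?h t) \<longlongrightarrow> 0) (at 0)"
    proof (rule Lim_null_comparison)
      have "\<forall>\<^sub>F t in at (0::real). \<bar>t\<bar> < T \<and> t \<noteq> 0"
        using T by (auto simp: eventually_at intro!: exI[of _ T])
      then show "\<forall>\<^sub>F t in at 0. norm (k t + ?h t) \<le> K * \<bar>t\<bar> * norm (w v (2 * t))"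
      proof eventually_elim
        case (elim t)
        have "k t + ?h t = (1 / t) *\<^sub>R (z v t - w v (2 * t) + t *\<^sub>R ?h t)"
          using elim by (simp add: k_def scaleR_add_right)
        then have "norm (k t + ?h t) = norm (z v t - w v (2 * t) + t *\<^sub>R ?h t) / \<bar>t\<bar>"
          by simp
        also have "\<dots> \<le> K * t\<^sup>2 * norm (w v (2 * t)) / \<bar>t\<bar>"
          using z_exp elim by (intro divide_right_mono) auto
        also have "\<dots> = K * \<bar>t\<bar> * norm (w v (2 * t))"
        proof -
          have "K * (\<bar>t\<bar> * \<bar>t\<bar>) * norm (w v (2 * t)) / \<bar>t\<bar> = K * \<bar>t\<bar> * norm (w v (2 * t))"
            using elim by (simp del: abs_mult_self_eq)
          then show ?thesis by (simp add: power2_eq_square)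
        qed
        finally show ?case .
      qed
      have "((\<lambda>t. K * \<bar>t\<bar> * norm (w v (2 * t))) \<longlongrightarrow> K * \<bar>0\<bar> * norm v) (at 0)"
        by (intro tendsto_intros w_lim)
      then show "((\<lambda>t. K * \<bar>t\<bar> * norm (w v (2 * t))) \<longlongrightarrow> 0) (at 0)" by simp
    qed
    from tendsto_diff[OF this h_lim] have k_lim: "(k \<longlongrightarrow> - frechet_derivative ?F (at x0) v) (at 0)"
      by simp
    have "((\<lambda>t. w v (2 * t)) has_vector_derivative 2 *\<^sub>R - christoffel0 x0 (X m) v) (at 0)"
    proof -
      have 1: "((\<lambda>t. 2 * t) has_vector_derivative (2::real)) (at 0)"
        by (auto intro!: derivative_eq_intros)
      have 2: "(w v has_vector_derivative - christoffel0 x0 (X m) v) (at (2 * 0))"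
        using dw0 by simp
      show ?thesis using vector_diff_chain_at[OF 1 2] by (simp add: o_def)
    qed
    from has_vector_derivative_mult_scaleR[OF this k_lim]
    have "((\<lambda>t. w v (2 * t) + t *\<^sub>R k t) has_vector_derivative
        - (2 *\<^sub>R christoffel0 x0 (X m) v + frechet_derivative ?F (at x0) v)) (at 0)"
      by simp
    moreover have "(\<lambda>t. w v (2 * t) + t *\<^sub>R k t) = z v"
      using z0 by (auto simp: k_def fun_eq_iff w0)
    ultimately show ?thesis by (simp only: dF_eq)
  qed
  have z0: "z v 0 = v" for v
    using U[of 0 "y 0" "w v 0"] T by (simp add: z_def w0)

  let ?D = "\<lambda>us. frechet_derivative (\<lambda>x. tensor_coord C \<phi> x us) (at x0)"
  let ?z' = "\<lambda>v. - (2 *\<^sub>R christoffel0 x0 (X m) v + frechet_derivative (vf_coord A C X) (at x0) v)"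
  have "((\<lambda>t. tensor_coord C \<phi> (y t) (map (\<lambda>u. u t) (map z vs))) has_derivative
      (\<lambda>h. ?D (map (\<lambda>u. u 0) (map z vs)) (h *\<^sub>R X m) + (\<Sum>i<length (map z vs).
        tensor_coord C \<phi> (y 0) ((map (\<lambda>u. u 0) (map z vs))[i := (map (\<lambda>v h. h *\<^sub>R ?z' v) vs ! i) h])))) (at 0)"
  proof (rule multilinear_product_rule[of "{-T<..<T}"])
    show "linear (\<lambda>v. tensor_coord C \<phi> (y t) (ws[i := v]))"
      if "t \<in> {-T<..<T}" "length ws = length (map z vs)" "i < length (map z vs)" for t ws i
      using that y_in[of t] plateau_subset by (intro tensor_coord_linear \<phi> C) auto
    show "((\<lambda>t. tensor_coord C \<phi> (y t) ws) has_derivative (\<lambda>h. ?D ws (h *\<^sub>R X m))) (at 0)" for ws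
      by (rule has_derivative_compose[OF dy0[unfolded has_vector_derivative_def]])
        (simp add: y0 tensor_coord_has_derivative[OF \<phi> C_eq])
    show "(map z vs ! i has_derivative map (\<lambda>v h. h *\<^sub>R ?z' v) vs ! i) (at 0)" if "i < length (map z vs)" for i
      using that dz by (simp add: has_vector_derivative_def)
  qed (use T in auto)
  then have "(?g has_derivative (\<lambda>h. ?D vs (h *\<^sub>R X m) + (\<Sum>i<length vs. \<phi> m (vs[i := h *\<^sub>R ?z' (vs ! i)])))) (at 0)"
    by (simp add: o_def z0 y0 tensor_coord_x0[OF \<phi> C_eq] del: scaleR_minus_right)
  moreover have "?D vs (h *\<^sub>R X m) + (\<Sum>i<length vs. \<phi> m (vs[i := h *\<^sub>R ?z' (vs ! i)])) =
      sym_lie_deriv A nabla X \<phi> m vs * h" for h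
    using linear_scale[OF has_derivative_linear[OF tensor_coord_has_derivative[OF \<phi> C_eq]]]
      linear_scale[OF sym_tensor_linear[OF \<phi>]]
    by (simp add: sym_lie_deriv_m[OF \<phi> C_eq X] sum_distrib_left distrib_left mult.commute[of _ h] del: scaleR_minus_right)
  ultimately have "(?g has_real_derivative sym_lie_deriv A nabla X \<phi> m vs) (at 0)"
    by (simp add: has_field_derivative_def)
  then show "(g has_real_derivative sym_lie_deriv A nabla X \<phi> m vs) (at 0)"
    using DERIV_cong_ev[OF refl g_eq refl] by blast
  show "g 0 = \<phi> m vs"
    using eventually_nhds_x_imp_x[OF g_eq] by (simp add: z0 y0 tensor_coord_x0[OF \<phi> C_eq])
qed

end

theorem proposition2p24:
  fixes A :: "('m::{t2_space, second_countable_topology}, 'e::euclidean_space) chart set"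
    and nabla :: "('m \<Rightarrow> 'e) \<Rightarrow> ('m \<Rightarrow> 'e) \<Rightarrow> ('m \<Rightarrow> 'e)"
    and \<phi> :: "'m \<Rightarrow> 'e ptensor" and X :: "'m \<Rightarrow> 'e" and m :: 'm and vs :: "'e list"
  assumes "smooth_atlas A"
    and "affine_connection A nabla"
    and "\<phi> \<in> sym_tensor_fields A"
    and "smooth_vf A X"
  shows "((\<lambda>t. (1 / t) *
            (tensor_transport A (torsion_free_part A nabla) (\<lambda>s. flow A X s m) (2 * t) 0
               (pullback_at A (flow A X (- t)) (flow A X (2 * t) m) (\<phi> (flow A X t m))) vs
             - \<phi> m vs))
           \<longlongrightarrow> sym_lie_deriv A nabla X \<phi> m vs) (at 0)
    \<and> ((\<lambda>t. tensor_transport A (torsion_free_part A nabla) (\<lambda>s. flow A X s m) (2 * t) 0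
               (pullback_at A (flow A X (- t)) (flow A X (2 * t) m) (\<phi> (flow A X t m))) vs)
         has_real_derivative sym_lie_deriv A nabla X \<phi> m vs) (at 0)"
proof -
  interpret smooth_manifold A
    using assms(1) by unfold_locales
  let ?C = "chart_at A m"
  obtain r \<beta> where "0 < r" "cball (chart_map ?C m) (2 * r) \<subseteq> chart_img ?C" "smooth_on UNIV \<beta>"
    "\<And>x. x \<in> ball (chart_map ?C m) r \<Longrightarrow> \<beta> x = (1::real)"
    "\<And>x. x \<notin> cball (chart_map ?C m) (2 * r) \<Longrightarrow> \<beta> x = 0"
    using bump_in_chart[OF chart_at] by metis
  then interpret connection_in_chart A ?C m r \<beta> nabla
    using chart_at assms(2) by unfold_locales
  let ?g = "\<lambda>t. tensor_transport A (torsion_free_part A nabla) (\<lambda>s. flow A X s m) (2 * t) 0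
               (pullback_at A (flow A X (- t)) (flow A X (2 * t) m) (\<phi> (flow A X t m))) vs"
  have d: "(?g has_real_derivative sym_lie_deriv A nabla X \<phi> m vs) (at 0)" and g0: "?g 0 = \<phi> m vs"
    by (rule transported_pullback_derivative[OF assms(3) refl assms(4)])+
  have "(\<lambda>t. (?g (0 + t) - ?g 0) / t) \<midarrow>0\<rightarrow> sym_lie_deriv A nabla X \<phi> m vs"
    using d unfolding DERIV_def .
  then have "((\<lambda>t. (1 / t) * (?g t - \<phi> m vs)) \<longlongrightarrow> sym_lie_deriv A nabla X \<phi> m vs) (at 0)"
    by (simp only: g0 add_0 times_divide_eq_left mult_1)
  with d show ?thesis by (rule conjI[rotated])
qed

end
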